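(* Let $\ell$ be an odd prime, $F$ a complete discrete valuation field of characteristic zero and residue characteristic $\ell$ which is an unramified extension of $\mathbf{Q}_\ell$, and $N$ a finite group of order not divisible by $\ell$. Let $K=F(\zeta_\ell+\zeta_\ell^{-1})$, and let $W$ be a nonzero $K$-vector space which is an absolutely simple faithful symplectic $K[N]$-module. Let $V=W\otimes_K K(\zeta_\ell)$ and $G=N\times\mu_\ell$, with $N$ acting on $W$ and $\mu_\ell$ acting on $K(\zeta_\ell)$ by multiplication. Then $V$ carries a natural structure of a faithful symplectic $K[G]$-module (with form $f_1\otimes f_2$, $f_1$ the given form on $W$ and $f_2(x,y)=\mathrm{tr}_{K(\zeta_\ell)/K}(x\bar y)$, $\bar{\ }$ the nontrivial automorphism of $K(\zeta_\ell)/K$), and there is no $G$-stable lattice $T$ in $V$ with a $G$-invariant perfect alternating pairing $f':T\times T\to\mathcal{O}_K$.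
   Context: $\zeta_\ell$ is a primitive $\ell$-th root of unity and $\mu_\ell$ the group it generates. A $K[N]$-module is symplectic if it carries a nondegenerate $N$-invariant alternating $K$-bilinear form. $\mathcal{O}_K$ is the valuation ring of $K$; a lattice is an $\mathcal{O}_K$-lattice. A bilinear form on a free $\mathcal{O}_K$-module $T$ is perfect if the induced maps $T\to\mathrm{Hom}(T,\mathcal{O}_K)$ are bijective. *)

theory Defs
  imports "HOL-Algebra.Algebra" "HOL-Algebra.Algebraic_Closure_Type"
begin

section \<open>Discretely valued fields\<close>

text \<open>
  Valuations are normalised (the value group is all of \<open>\<int>\<close>) and written additively.
  The value at \<open>0\<close>, which should be \<open>\<infinity>\<close>, is never used.
\<close>

definition discrete_valuation :: "('a::field \<Rightarrow> int) \<Rightarrow> bool" where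
  "discrete_valuation v \<longleftrightarrow>
     v ` (UNIV - {0}) = UNIV \<and>
     (\<forall>x y. x \<noteq> 0 \<longrightarrow> y \<noteq> 0 \<longrightarrow> v (x * y) = v x + v y) \<and>
     (\<forall>x y. x \<noteq> 0 \<longrightarrow> y \<noteq> 0 \<longrightarrow> x + y \<noteq> 0 \<longrightarrow> min (v x) (v y) \<le> v (x + y))"

definition valuation_ring :: "('a::field \<Rightarrow> int) \<Rightarrow> 'a set" where
  "valuation_ring v = {x. x = 0 \<or> 0 \<le> v x}"

definition maximal_ideal_of :: "('a::field \<Rightarrow> int) \<Rightarrow> 'a set" where
  "maximal_ideal_of v = {x. x = 0 \<or> 0 < v x}"

definition val_tendsto :: "('a::field \<Rightarrow> int) \<Rightarrow> (nat \<Rightarrow> 'a) \<Rightarrow> 'a \<Rightarrow> bool" where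
  "val_tendsto v u x \<longleftrightarrow> (\<forall>c. \<exists>n0. \<forall>n\<ge>n0. u n = x \<or> c \<le> v (u n - x))"

definition val_Cauchy :: "('a::field \<Rightarrow> int) \<Rightarrow> (nat \<Rightarrow> 'a) \<Rightarrow> bool" where
  "val_Cauchy v u \<longleftrightarrow> (\<forall>c. \<exists>n0. \<forall>m\<ge>n0. \<forall>n\<ge>n0. u m = u n \<or> c \<le> v (u m - u n))"

definition val_complete :: "('a::field \<Rightarrow> int) \<Rightarrow> bool" where
  "val_complete v \<longleftrightarrow> (\<forall>u. val_Cauchy v u \<longrightarrow> (\<exists>x. val_tendsto v u x))"

text \<open>The multiples of \<open>p\<close> are exactly the integers that vanish in the residue field.\<close>

definition residue_char :: "('a::field \<Rightarrow> int) \<Rightarrow> nat \<Rightarrow> bool" where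
  "residue_char v p \<longleftrightarrow> (\<forall>n. (of_nat n :: 'a) \<in> maximal_ideal_of v \<longleftrightarrow> p dvd n)"

text \<open>
  In a complete discretely valued field of characteristic zero and residue characteristic \<open>p\<close>,
  the topological closure of \<open>\<rat>\<close> is the (unique) copy of the field \<open>\<rat>\<^sub>p\<close>.
\<close>

definition closure_of_rationals :: "('a::field_char_0 \<Rightarrow> int) \<Rightarrow> 'a set" where
  "closure_of_rationals v = {x. \<exists>q. val_tendsto v (\<lambda>n. of_rat (q n)) x}"

text \<open>
  Ramification index one over the subfield \<open>E\<close>. This is only used for \<open>E = \<rat>\<^sub>p\<close>, whose
  residue field is perfect, so that separability of the residue field extension is automatic.
  The extension need not be algebraic.
\<close>

definition unramified_over :: "('a::field \<Rightarrow> int) \<Rightarrow> 'a set \<Rightarrow> bool" where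
  "unramified_over v E \<longleftrightarrow> v ` (E - {0}) = v ` (UNIV - {0})"

definition valuation_extends ::
    "('a::field \<Rightarrow> 'b::field) \<Rightarrow> ('a \<Rightarrow> int) \<Rightarrow> ('b \<Rightarrow> int) \<Rightarrow> bool" where
  "valuation_extends h v w \<longleftrightarrow> (\<exists>e>0. \<forall>x. x \<noteq> 0 \<longrightarrow> w (h x) = e * v x)"


section \<open>Field extensions\<close>

definition field_hom :: "('a::field \<Rightarrow> 'b::field) \<Rightarrow> bool" where
  "field_hom h \<longleftrightarrow> h \<in> ring_hom ring_of_type_algebra ring_of_type_algebra"

definition subfield_generated :: "'a::field set \<Rightarrow> 'a set" where
  "subfield_generated S = generate_field ring_of_type_algebra S"

definition primitive_root_of_unity :: "nat \<Rightarrow> 'a::field \<Rightarrow> bool" where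
  "primitive_root_of_unity n z \<longleftrightarrow> n > 0 \<and> z ^ n = 1 \<and> (\<forall>k. 0 < k \<and> k < n \<longrightarrow> z ^ k \<noteq> 1)"

text \<open>A field \<open>'b\<close> as a vector space over \<open>'a\<close> along an embedding of fields.\<close>

definition ext_module :: "('a::field \<Rightarrow> 'b::field) \<Rightarrow> ('a, 'b) module" where
  "ext_module h = \<lparr>carrier = UNIV, monoid.mult = (*), monoid.one = 1, ring.zero = 0, ring.add = (+),
                   module.smult = (\<lambda>c x. h c * x)\<rparr>"

text \<open>
  The trace of multiplication by \<open>x\<close>, computed in some basis of \<open>'b\<close> over \<open>'a\<close>
  (meaningful when the extension is finite).
\<close>

definition field_trace :: "('a::field \<Rightarrow> 'b::field) \<Rightarrow> 'b \<Rightarrow> 'a" where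
  "field_trace h x =
     (let s = (\<lambda>c y. h c * y);
          B = (SOME B. \<not> module.dependent s B \<and> module.span s B = UNIV)
      in \<Sum>b\<in>B. module.representation s B (x * b) b)"


section \<open>Tensor products\<close>

text \<open>
  The tensor product of two \<open>R\<close>-modules is the free abelian group on pairs modulo biadditivity and
  \<open>R\<close>-balancedness; its elements are cosets.
\<close>

abbreviation tensor_free ::
    "('a, 'b) module \<Rightarrow> ('a, 'c) module \<Rightarrow> ('b \<times> 'c \<Rightarrow>\<^sub>0 int) monoid" where
  "tensor_free M N \<equiv> free_Abelian_group (carrier M \<times> carrier N)"

definition tensor_relations ::
    "('a, 'r) ring_scheme \<Rightarrow> ('a, 'b) module \<Rightarrow> ('a, 'c) module \<Rightarrow> ('b \<times> 'c \<Rightarrow>\<^sub>0 int) set" where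
  "tensor_relations R M N = generate (tensor_free M N)
     ({frag_of (x \<oplus>\<^bsub>M\<^esub> x', y) - frag_of (x, y) - frag_of (x', y) | x x' y.
         x \<in> carrier M \<and> x' \<in> carrier M \<and> y \<in> carrier N} \<union>
      {frag_of (x, y \<oplus>\<^bsub>N\<^esub> y') - frag_of (x, y) - frag_of (x, y') | x y y'.
         x \<in> carrier M \<and> y \<in> carrier N \<and> y' \<in> carrier N} \<union>
      {frag_of (r \<odot>\<^bsub>M\<^esub> x, y) - frag_of (x, r \<odot>\<^bsub>N\<^esub> y) | r x y.
         r \<in> carrier R \<and> x \<in> carrier M \<and> y \<in> carrier N})"

definition pure_tensor ::
    "('a, 'r) ring_scheme \<Rightarrow> ('a, 'b) module \<Rightarrow> ('a, 'c) module \<Rightarrow> 'b \<Rightarrow> 'c \<Rightarrow>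
      ('b \<times> 'c \<Rightarrow>\<^sub>0 int) set" where
  "pure_tensor R M N x y = tensor_relations R M N #>\<^bsub>tensor_free M N\<^esub> frag_of (x, y)"

text \<open>The endomorphism \<open>f \<otimes> g\<close> of \<open>M \<otimes> N\<close>, for linear endomorphisms \<open>f\<close> of \<open>M\<close> and \<open>g\<close> of \<open>N\<close>.\<close>

definition tensor_map ::
    "('a, 'r) ring_scheme \<Rightarrow> ('a, 'b) module \<Rightarrow> ('a, 'c) module \<Rightarrow> ('b \<Rightarrow> 'b) \<Rightarrow> ('c \<Rightarrow> 'c) \<Rightarrow>
      ('b \<times> 'c \<Rightarrow>\<^sub>0 int) set \<Rightarrow> ('b \<times> 'c \<Rightarrow>\<^sub>0 int) set" where
  "tensor_map R M N f g u =
     tensor_relations R M N <#>\<^bsub>tensor_free M N\<^esub>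
       (frag_extend (\<lambda>(x, y). frag_of (f x, g y)) ` u)"

text \<open>
  The ring multiplication and unit in a module record play no role in the theory of modules.
\<close>

definition tensor ::
    "('a, 'r) ring_scheme \<Rightarrow> ('a, 'b) module \<Rightarrow> ('a, 'c) module \<Rightarrow>
      ('a, ('b \<times> 'c \<Rightarrow>\<^sub>0 int) set) module" where
  "tensor R M N =
     \<lparr>carrier = carrier (tensor_free M N Mod tensor_relations R M N),
      monoid.mult = (\<lambda>_ _. undefined), monoid.one = undefined,
      ring.zero = monoid.one (tensor_free M N Mod tensor_relations R M N),
      ring.add = monoid.mult (tensor_free M N Mod tensor_relations R M N),
      module.smult = (\<lambda>r. tensor_map R M N (\<lambda>x. r \<odot>\<^bsub>M\<^esub> x) (\<lambda>y. y))\<rparr>"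

text \<open>\<open>M \<otimes> 'b\<close> as a vector space over the extension field \<open>'b\<close> of \<open>'a\<close>.\<close>

definition scalar_extension ::
    "('a::field \<Rightarrow> 'b::field) \<Rightarrow> ('a, 'm) module \<Rightarrow> ('b, ('m \<times> 'b \<Rightarrow>\<^sub>0 int) set) module" where
  "scalar_extension h M =
     (let R = (ring_of_type_algebra :: 'a ring); T = tensor R M (ext_module h) in
     \<lparr>carrier = carrier T, monoid.mult = monoid.mult T, monoid.one = monoid.one T,
      ring.zero = ring.zero T, ring.add = ring.add T,
      module.smult = (\<lambda>c. tensor_map R M (ext_module h) (\<lambda>x. x) (\<lambda>y. c * y))\<rparr>)"


section \<open>Modules over group rings\<close>

definition linear_maps ::
    "('a, 'r) ring_scheme \<Rightarrow> ('a, 'b) module \<Rightarrow> ('a, 'c) module \<Rightarrow> ('b \<Rightarrow> 'c) set" where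
  "linear_maps R M N =
     {f. f \<in> carrier M \<rightarrow> carrier N \<and>
         (\<forall>x\<in>carrier M. \<forall>y\<in>carrier M. f (x \<oplus>\<^bsub>M\<^esub> y) = f x \<oplus>\<^bsub>N\<^esub> f y) \<and>
         (\<forall>r\<in>carrier R. \<forall>x\<in>carrier M. f (r \<odot>\<^bsub>M\<^esub> x) = r \<odot>\<^bsub>N\<^esub> f x)}"

text \<open>
  An \<open>R[G]\<close>-module is given as an \<open>R\<close>-module \<open>M\<close> with an \<open>R\<close>-linear action \<open>\<rho>\<close> of \<open>G\<close>.
\<close>

definition group_ring_module ::
    "('a, 'r) ring_scheme \<Rightarrow> ('g, 's) monoid_scheme \<Rightarrow> ('a, 'b) module \<Rightarrow> ('g \<Rightarrow> 'b \<Rightarrow> 'b) \<Rightarrow> bool"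
  where
  "group_ring_module R G M \<rho> \<longleftrightarrow>
     module R M \<and> group G \<and>
     (\<forall>g\<in>carrier G. \<rho> g \<in> linear_maps R M M) \<and>
     (\<forall>x\<in>carrier M. \<rho> \<one>\<^bsub>G\<^esub> x = x) \<and>
     (\<forall>g\<in>carrier G. \<forall>h\<in>carrier G. \<forall>x\<in>carrier M. \<rho> (g \<otimes>\<^bsub>G\<^esub> h) x = \<rho> g (\<rho> h x))"

definition stable_under ::
    "('g, 's) monoid_scheme \<Rightarrow> ('g \<Rightarrow> 'b \<Rightarrow> 'b) \<Rightarrow> 'b set \<Rightarrow> bool" where
  "stable_under G \<rho> U \<longleftrightarrow> (\<forall>g\<in>carrier G. \<forall>x\<in>U. \<rho> g x \<in> U)"

definition acts_faithfully ::
    "('g, 's) monoid_scheme \<Rightarrow> ('a, 'b) module \<Rightarrow> ('g \<Rightarrow> 'b \<Rightarrow> 'b) \<Rightarrow> bool" where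
  "acts_faithfully G M \<rho> \<longleftrightarrow>
     (\<forall>g\<in>carrier G. (\<forall>x\<in>carrier M. \<rho> g x = x) \<longrightarrow> g = \<one>\<^bsub>G\<^esub>)"

definition simple_action ::
    "('a, 'r) ring_scheme \<Rightarrow> ('g, 's) monoid_scheme \<Rightarrow> ('a, 'b) module \<Rightarrow> ('g \<Rightarrow> 'b \<Rightarrow> 'b) \<Rightarrow> bool"
  where
  "simple_action R G M \<rho> \<longleftrightarrow>
     carrier M \<noteq> {\<zero>\<^bsub>M\<^esub>} \<and>
     (\<forall>U. submodule U R M \<and> stable_under G \<rho> U \<longrightarrow> U = {\<zero>\<^bsub>M\<^esub>} \<or> U = carrier M)"

text \<open>Simple after extension of scalars to an algebraic closure.\<close>

definition absolutely_simple ::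
    "('g, 's) monoid_scheme \<Rightarrow> ('a::field, 'b) module \<Rightarrow> ('g \<Rightarrow> 'b \<Rightarrow> 'b) \<Rightarrow> bool" where
  "absolutely_simple G M \<rho> \<longleftrightarrow>
     simple_action (ring_of_type_algebra :: 'a alg_closure ring) G
       (scalar_extension to_ac M)
       (\<lambda>g. tensor_map ring_of_type_algebra M (ext_module to_ac) (\<rho> g) (\<lambda>y. y))"


section \<open>Bilinear forms and lattices\<close>

definition dual_module ::
    "('a, 'r) ring_scheme \<Rightarrow> ('a, 'b) module \<Rightarrow> ('b \<Rightarrow> 'a) set" where
  "dual_module R M =
     {\<phi> \<in> carrier M \<rightarrow>\<^sub>E carrier R.
         (\<forall>x\<in>carrier M. \<forall>y\<in>carrier M. \<phi> (x \<oplus>\<^bsub>M\<^esub> y) = \<phi> x \<oplus>\<^bsub>R\<^esub> \<phi> y) \<and>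
         (\<forall>r\<in>carrier R. \<forall>x\<in>carrier M. \<phi> (r \<odot>\<^bsub>M\<^esub> x) = r \<otimes>\<^bsub>R\<^esub> \<phi> x)}"

definition bilinear_form ::
    "('a, 'r) ring_scheme \<Rightarrow> ('a, 'b) module \<Rightarrow> ('b \<Rightarrow> 'b \<Rightarrow> 'a) \<Rightarrow> bool" where
  "bilinear_form R M f \<longleftrightarrow>
     (\<forall>x\<in>carrier M. (\<lambda>y\<in>carrier M. f x y) \<in> dual_module R M) \<and>
     (\<forall>y\<in>carrier M. (\<lambda>x\<in>carrier M. f x y) \<in> dual_module R M)"

definition alternating_form ::
    "('a, 'r) ring_scheme \<Rightarrow> ('a, 'b) module \<Rightarrow> ('b \<Rightarrow> 'b \<Rightarrow> 'a) \<Rightarrow> bool" where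
  "alternating_form R M f \<longleftrightarrow> bilinear_form R M f \<and> (\<forall>x\<in>carrier M. f x x = \<zero>\<^bsub>R\<^esub>)"

definition nondegenerate_form ::
    "('a, 'r) ring_scheme \<Rightarrow> ('a, 'b) module \<Rightarrow> ('b \<Rightarrow> 'b \<Rightarrow> 'a) \<Rightarrow> bool" where
  "nondegenerate_form R M f \<longleftrightarrow>
     (\<forall>x\<in>carrier M. (\<forall>y\<in>carrier M. f x y = \<zero>\<^bsub>R\<^esub>) \<longrightarrow> x = \<zero>\<^bsub>M\<^esub>) \<and>
     (\<forall>y\<in>carrier M. (\<forall>x\<in>carrier M. f x y = \<zero>\<^bsub>R\<^esub>) \<longrightarrow> y = \<zero>\<^bsub>M\<^esub>)"

definition perfect_form ::
    "('a, 'r) ring_scheme \<Rightarrow> ('a, 'b) module \<Rightarrow> ('b \<Rightarrow> 'b \<Rightarrow> 'a) \<Rightarrow> bool" where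
  "perfect_form R M f \<longleftrightarrow>
     bilinear_form R M f \<and>
     bij_betw (\<lambda>x. \<lambda>y\<in>carrier M. f x y) (carrier M) (dual_module R M) \<and>
     bij_betw (\<lambda>y. \<lambda>x\<in>carrier M. f x y) (carrier M) (dual_module R M)"

definition invariant_form ::
    "('g, 's) monoid_scheme \<Rightarrow> ('a, 'b) module \<Rightarrow> ('g \<Rightarrow> 'b \<Rightarrow> 'b) \<Rightarrow> ('b \<Rightarrow> 'b \<Rightarrow> 'a) \<Rightarrow> bool" where
  "invariant_form G M \<rho> f \<longleftrightarrow>
     (\<forall>g\<in>carrier G. \<forall>x\<in>carrier M. \<forall>y\<in>carrier M. f (\<rho> g x) (\<rho> g y) = f x y)"

definition symplectic_form ::
    "('a, 'r) ring_scheme \<Rightarrow> ('g, 's) monoid_scheme \<Rightarrow> ('a, 'b) module \<Rightarrow> ('g \<Rightarrow> 'b \<Rightarrow> 'b) \<Rightarrow>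
      ('b \<Rightarrow> 'b \<Rightarrow> 'a) \<Rightarrow> bool" where
  "symplectic_form R G M \<rho> f \<longleftrightarrow>
     alternating_form R M f \<and> nondegenerate_form R M f \<and> invariant_form G M \<rho> f"

text \<open>
  \<open>f1 \<otimes> f2\<close> is the bilinear form on the tensor product with prescribed values on pure tensors;
  these generate the tensor product, so there is at most one on its carrier.
\<close>

definition is_tensor_form ::
    "('a, 'r) ring_scheme \<Rightarrow> ('a, 'b) module \<Rightarrow> ('a, 'c) module \<Rightarrow>
      ('b \<Rightarrow> 'b \<Rightarrow> 'a) \<Rightarrow> ('c \<Rightarrow> 'c \<Rightarrow> 'a) \<Rightarrow>
      (('b \<times> 'c \<Rightarrow>\<^sub>0 int) set \<Rightarrow> ('b \<times> 'c \<Rightarrow>\<^sub>0 int) set \<Rightarrow> 'a) \<Rightarrow> bool" where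
  "is_tensor_form R M N f1 f2 f \<longleftrightarrow>
     bilinear_form R (tensor R M N) f \<and>
     (\<forall>x\<in>carrier M. \<forall>x'\<in>carrier M. \<forall>y\<in>carrier N. \<forall>y'\<in>carrier N.
        f (pure_tensor R M N x y) (pure_tensor R M N x' y') = f1 x x' \<otimes>\<^bsub>R\<^esub> f2 y y')"

text \<open>
  A lattice in the \<open>R\<close>-vector space \<open>V\<close>, for a subring \<open>D\<close> of the field \<open>R\<close>: a finitely generated
  \<open>D\<close>-submodule spanning \<open>V\<close> over \<open>R\<close>. It is automatically free when \<open>D\<close> is a valuation ring.
\<close>

definition lattice_in ::
    "('a, 'r) ring_scheme \<Rightarrow> ('a, 's) ring_scheme \<Rightarrow> ('a, 'b) module \<Rightarrow> 'b set \<Rightarrow> bool" where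
  "lattice_in R D V T \<longleftrightarrow>
     submodule T D V \<and>
     (\<exists>S. finite S \<and> S \<subseteq> T \<and> (\<forall>U. submodule U D V \<and> S \<subseteq> U \<longrightarrow> T \<subseteq> U)) \<and>
     (\<forall>U. submodule U R V \<and> T \<subseteq> U \<longrightarrow> U = carrier V)"

end

theory Submission
  imports Defs "HOL-Library.Function_Algebras"
begin

text \<open>
  Put \<open>\<delta> = \<zeta> - 1/\<zeta>\<close> and \<open>\<pi> = \<delta>\<^sup>2 \<in> K\<close>. Since \<open>F\<close> is unramified, the minimal polynomial of \<open>\<zeta> + 1/\<zeta> - 2\<close> is
  Eisenstein over \<open>F\<close>, so \<open>\<pi>\<close> is a uniformizer of \<open>K\<close> and \<open>\<O>\<^sub>L = \<O>\<^sub>K + \<delta> \<O>\<^sub>K\<close> is local with maximal ideal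
  \<open>\<delta> \<O>\<^sub>L\<close>, on whose residue field the conjugation \<open>bar\<close> is trivial.

  Suppose that \<open>T\<close> is a stable lattice with an invariant perfect alternating form \<open>f'\<close>. Then \<open>T\<close> is a free
  \<open>\<O>\<^sub>L\<close>-module and \<open>H(x,y) = f'(\<delta> x, y) + \<delta> f'(x,y)\<close> is an \<open>N\<close>-invariant unimodular Hermitian form on it;
  modulo \<open>\<delta>\<close> it is symmetric. On the other hand the \<open>L\<close>-bilinear extension of \<open>f\<^sub>1\<close>, suitably scaled,
  is an \<open>N\<close>-invariant alternating form on \<open>T\<close> that does not vanish modulo \<open>\<delta>\<close>. Because the order of \<open>N\<close>
  is a unit and the commutant of \<open>N\<close> on \<open>W \<otimes> L\<close> is \<open>L\<close>, averaging over \<open>N\<close> shows that modulo \<open>\<delta>\<close> an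
  invariant form is unique up to scalars; so a nonzero form would be both symmetric and alternating,
  in odd characteristic.
\<close>

section \<open>Discrete valuations and an Eisenstein polynomial\<close>

text \<open>Over \<open>L\<close> itself there is no conflict: an invariant alternating bilinear
  form and an invariant Hermitian form can live on the same module, since one is linear and the
  other conjugate-linear in the second argument. They become comparable only modulo \<delta>, where
  \<open>bar\<close> disappears; the argument rests on the ramification of \<open>L\<close> over
  \<open>K\<close>. That the form built from f' is Hermitian is due to \<mu>: under an invariant f'
  the adjoint of \<zeta> is its inverse, so \<delta> is skew-adjoint, and composing with it turns an
  alternating form into a symmetric one. Neither the residue field nor the quotient of T by \<delta>
  T is formed. Reduction is expressed by congruences modulo \<open>PL\<close> between values of
  forms on T, and the uniqueness of the reduced form by sums of \<phi>(n x) n^(-1) a over the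
  elements n of N. Schur's lemma over \<open>L\<close> makes such sums scalar, so irreducibility is
  used only in characteristic zero, where absolute simplicity is given.\<close>

lemma field_homD:
  assumes "field_hom h"
  shows "h (x + y) = h x + h y" "h (x * y) = h x * h y" "h 1 = 1" "h 0 = 0" "h (- x) = - h x"
    "h (x - y) = h x - h y" "h x = h y \<longleftrightarrow> x = y" "h (inverse x) = inverse (h x)"
    "h (of_nat n) = of_nat n" "h (x / y) = h x / h y" "h (x ^ n) = h x ^ n"
    "h (numeral w) = numeral w"
proof -
  have hom: "h \<in> ring_hom ring_of_type_algebra ring_of_type_algebra"
    using assms by (simp add: field_hom_def)
  show add: "h (x + y) = h x + h y" for x y
    using ring_hom_add[OF hom, of x y] by (simp add: ring_of_type_algebra_def)
  show mult: "h (x * y) = h x * h y" for x y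
    using ring_hom_mult[OF hom, of x y] by (simp add: ring_of_type_algebra_def)
  show one: "h 1 = 1"
    using ring_hom_one[OF hom] by (simp add: ring_of_type_algebra_def)
  show zero: "h 0 = 0"
    using add[of 0 0] by (metis add_cancel_right_right)
  show minus: "h (- x) = - h x" for x
    using add[of x "- x"] by (simp add: zero eq_neg_iff_add_eq_0 add.commute)
  show diff: "h (x - y) = h x - h y" for x y
    using add[of x "- y"] minus[of y] by simp
  have nz: "h x \<noteq> 0" if "x \<noteq> 0" for x
    using mult[of x "inverse x"] that one by auto
  show "h x = h y \<longleftrightarrow> x = y" for x y
    using nz[of "x - y"] diff[of x y] by auto
  show inv: "h (inverse x) = inverse (h x)" for x
  proof (cases "x = 0")
    case False
    then show ?thesis using mult[of x "inverse x"] one by (simp add: inverse_unique)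
  qed (simp add: zero)
  show nat: "h (of_nat n) = of_nat n" for n
    by (induction n) (simp_all add: zero one add)
  show "h (numeral w) = numeral w"
    using nat[of "numeral w"] by simp
  show "h (x / y) = h x / h y"
    by (simp add: divide_inverse mult inv)
  show "h (x ^ n) = h x ^ n"
    by (induction n) (simp_all add: one mult)
qed

lemma subfield_generated_subset:
  assumes "S \<subseteq> E" "1 \<in> E" "\<And>x. x \<in> E \<Longrightarrow> - x \<in> E"
    "\<And>x. x \<in> E \<Longrightarrow> x \<noteq> 0 \<Longrightarrow> inverse x \<in> E"
    "\<And>x y. x \<in> E \<Longrightarrow> y \<in> E \<Longrightarrow> x + y \<in> E" "\<And>x y. x \<in> E \<Longrightarrow> y \<in> E \<Longrightarrow> x * y \<in> E"
  shows "subfield_generated S \<subseteq> (E :: 'a::field set)"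
proof
  let ?R = "ring_of_type_algebra :: 'a ring"
  interpret R: field ?R by (rule field_from_type_algebra)
  have min: "\<ominus>\<^bsub>?R\<^esub> h = - h" for h
    by (rule R.minus_equality) (simp_all add: ring_of_type_algebra_def)
  have inv: "inv\<^bsub>?R\<^esub> h = inverse h" if "h \<noteq> 0" for h
    by (rule R.comm_inv_char) (use that in \<open>simp_all add: ring_of_type_algebra_def\<close>)
  fix x assume "x \<in> subfield_generated S"
  then have "x \<in> generate_field ?R S" by (simp add: subfield_generated_def)
  then show "x \<in> E"
  proof (induction rule: generate_field.induct)
    case (a_inv h)
    then show ?case by (simp add: min assms)
  next
    case (m_inv h)
    then show ?case using inv[of h] assms(4) by (simp add: ring_of_type_algebra_def)
  qed (use assms in \<open>auto simp: ring_of_type_algebra_def\<close>)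
qed

text \<open>Builds in the convention that 0 has infinite valuation, so that estimates can be added
  and multiplied without treating 0 apart.\<close>

definition val_ge :: "('a::field \<Rightarrow> int) \<Rightarrow> int \<Rightarrow> 'a \<Rightarrow> bool" where
  "val_ge v c x \<longleftrightarrow> x = 0 \<or> c \<le> v x"

section \<open>Estimates for a discrete valuation\<close>

locale discretely_valued =
  fixes v :: "'a::field \<Rightarrow> int"
  assumes disc_val: "discrete_valuation v"
begin

lemma val_mult: "x \<noteq> 0 \<Longrightarrow> y \<noteq> 0 \<Longrightarrow> v (x * y) = v x + v y"
  using disc_val by (simp add: discrete_valuation_def)

lemma val_one [simp]: "v 1 = 0"
  using val_mult[of 1 1] by simp

lemma val_uminus [simp]: "v (- x) = v x"
proof (cases "x = 0")
  case False
  have "v (- 1) + v (- 1) = 0"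
    using val_mult[of "- 1" "- 1"] by simp
  then show ?thesis using val_mult[of "- 1" x] False by simp
qed simp

lemma val_inverse: "x \<noteq> 0 \<Longrightarrow> v (inverse x) = - v x"
  using val_mult[of x "inverse x"] by simp

lemma val_divide: "x \<noteq> 0 \<Longrightarrow> y \<noteq> 0 \<Longrightarrow> v (x / y) = v x - v y"
  by (simp add: divide_inverse val_mult val_inverse)

lemma val_power: "x \<noteq> 0 \<Longrightarrow> v (x ^ n) = int n * v x"
  by (induction n) (simp_all add: val_mult algebra_simps)

lemma ex_val: "\<exists>x. x \<noteq> 0 \<and> v x = c"
proof -
  have "c \<in> v ` (UNIV - {0})"
    using disc_val by (simp add: discrete_valuation_def)
  then show ?thesis by auto
qed

lemma val_ge_0 [simp]: "val_ge v c 0"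
  by (simp add: val_ge_def)

lemma val_ge_add: "val_ge v c x \<Longrightarrow> val_ge v c y \<Longrightarrow> val_ge v c (x + y)"
  using disc_val unfolding discrete_valuation_def val_ge_def
  by (smt (verit) add.left_neutral add.right_neutral)

lemma val_ge_uminus [simp]: "val_ge v c (- x) \<longleftrightarrow> val_ge v c x"
  by (simp add: val_ge_def)

lemma val_ge_diff: "val_ge v c x \<Longrightarrow> val_ge v c y \<Longrightarrow> val_ge v c (x - y)"
  using val_ge_add[of c x "- y"] by simp

lemma val_ge_sum: "(\<And>a. a \<in> A \<Longrightarrow> val_ge v c (f a)) \<Longrightarrow> val_ge v c (sum f A)"
  by (induction A rule: infinite_finite_induct) (auto intro: val_ge_add)

lemma val_ge_mult: "val_ge v c x \<Longrightarrow> val_ge v d y \<Longrightarrow> val_ge v (c + d) (x * y)"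
  by (auto simp: val_ge_def val_mult)

lemma val_ge_mult_left: "val_ge v 0 x \<Longrightarrow> val_ge v d y \<Longrightarrow> val_ge v d (x * y)"
  using val_ge_mult[of 0 x d y] by simp

lemma val_ge_power: "val_ge v c x \<Longrightarrow> val_ge v (int n * c) (x ^ n)"
proof (induction n)
  case (Suc n)
  then show ?case using val_ge_mult[of c x "int n * c" "x ^ n"] by (simp add: algebra_simps)
qed (simp add: val_ge_def)

lemma val_ge_of_nat [simp]: "val_ge v 0 (of_nat n)"
  by (induction n) (auto intro!: val_ge_add simp: val_ge_def[of v 0 1])

lemma val_ge_trans: "val_ge v d x \<Longrightarrow> c \<le> d \<Longrightarrow> val_ge v c x"
  by (auto simp: val_ge_def)

lemma val_add_eq:
  assumes "x \<noteq> 0" "val_ge v (v x + 1) y"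
  shows "x + y \<noteq> 0" "v (x + y) = v x"
proof -
  have *: "\<not> val_ge v (v x + 1) x" using assms by (simp add: val_ge_def)
  have **: "\<not> val_ge v (v x + 1) (x + y)"
    using val_ge_diff[of "v x + 1" "x + y" y] assms * by auto
  then show "x + y \<noteq> 0" by auto
  have "val_ge v (v x) (x + y)"
    by (rule val_ge_add) (use assms in \<open>auto simp: val_ge_def\<close>)
  with ** show "v (x + y) = v x" by (auto simp: val_ge_def)
qed

text \<open>The term of least valuation is unique, so it dominates the sum of all others.\<close>

lemma val_sum_distinct:
  assumes "finite A" "A \<noteq> {}" "\<And>a. a \<in> A \<Longrightarrow> f a \<noteq> 0" "inj_on (\<lambda>a. v (f a)) A"
  shows "sum f A \<noteq> 0 \<and> (\<exists>a\<in>A. v (sum f A) = v (f a))"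
proof -
  let ?g = "\<lambda>a. v (f a)"
  have "Min (?g ` A) \<in> ?g ` A" using assms by simp
  then obtain a where a: "a \<in> A" "?g a = Min (?g ` A)" by auto
  have "val_ge v (v (f a) + 1) (f b)" if "b \<in> A - {a}" for b
  proof -
    have "?g a \<le> ?g b" using a that assms(1) by simp
    moreover have "?g a \<noteq> ?g b" using a that assms(4) by (auto simp: inj_on_def)
    ultimately show ?thesis by (simp add: val_ge_def)
  qed
  then have "val_ge v (v (f a) + 1) (sum f (A - {a}))" by (rule val_ge_sum)
  moreover have "sum f A = f a + sum f (A - {a})"
    using a assms(1) by (simp add: sum.remove)
  ultimately show ?thesis using val_add_eq[of "f a"] a assms(3) by metis
qed

lemma val_of_nat_coprime:
  assumes "residue_char v p" "\<not> p dvd n"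
  shows "of_nat n \<noteq> (0::'a)" "v (of_nat n) = 0"
proof -
  have "of_nat n \<notin> maximal_ideal_of v"
    using assms by (simp add: residue_char_def)
  then show "of_nat n \<noteq> (0::'a)" "v (of_nat n) = 0"
    using val_ge_of_nat[of n] by (auto simp: maximal_ideal_of_def val_ge_def)
qed

end

text \<open>Every nonzero rational has valuation a multiple of \<open>v (of_nat p)\<close>. An
  element of valuation 1 in the closure of the rationals exists by unramifiedness, and a rational
  close to it has valuation 1 too.\<close>

lemma val_residue_char_unramified:
  fixes v :: "'a::field_char_0 \<Rightarrow> int"
  assumes "discrete_valuation v" "residue_char v p" "Factorial_Ring.prime p"
    "unramified_over v (closure_of_rationals v)"
  shows "v (of_nat p) = 1"
proof -
  interpret discretely_valued v by unfold_locales fact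
  have p0: "p \<noteq> 0" using assms(3) by auto
  have pos: "v (of_nat p) > 0"
    using assms(2) p0 unfolding residue_char_def maximal_ideal_of_def
    by (metis (mono_tags, lifting) dvd_refl mem_Collect_eq of_nat_eq_0_iff)
  have nat: "v (of_nat p) dvd v (of_nat n)" if n0: "n \<noteq> 0" for n
  proof -
    have "\<not> is_unit p" using prime_gt_1_nat[OF assms(3)] by simp
    then obtain r where r: "n = p ^ multiplicity p n * r" "\<not> p dvd r"
      using multiplicity_decompose'[OF n0] by metis
    have "(of_nat n :: 'a) = of_nat p ^ multiplicity p n * of_nat r"
      using r(1) by (metis of_nat_mult of_nat_power)
    then have "v (of_nat n) = int (multiplicity p n) * v (of_nat p)"
      using val_of_nat_coprime[OF assms(2) r(2)] p0 by (simp add: val_mult val_power)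
    then show ?thesis by simp
  qed
  have rat: "v (of_nat p) dvd v (of_rat q)" if "q \<noteq> 0" for q
  proof -
    obtain a b where q: "q = of_int a / of_int b" "b > 0"
      by (metis quotient_of_denom_pos quotient_of_div surj_pair)
    then have a: "a \<noteq> 0" using that by auto
    have ab: "of_int a = (of_nat (nat \<bar>a\<bar>) :: 'a) \<or> of_int a = - (of_nat (nat \<bar>a\<bar>) :: 'a)"
      by (cases "a \<ge> 0") auto
    have "of_rat q = (of_int a / of_nat (nat b) :: 'a)"
      using q by (simp add: of_rat_divide)
    then have "v (of_rat q) = v (of_int a) - v (of_nat (nat b))"
      using a q by (simp add: val_divide)
    moreover have "v (of_int a) = v (of_nat (nat \<bar>a\<bar>))"
      using ab val_uminus by metis
    ultimately show ?thesis using nat[of "nat \<bar>a\<bar>"] nat[of "nat b"] a q by simp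
  qed
  have "1 \<in> v ` (closure_of_rationals v - {0})"
    using assms(4) ex_val[of 1] by (auto simp: unramified_over_def)
  then obtain x where x: "x \<in> closure_of_rationals v" "x \<noteq> 0" "v x = 1" by (metis DiffE image_iff singletonI)
  obtain q where "val_tendsto v (\<lambda>n. of_rat (q n)) x"
    using x by (auto simp: closure_of_rationals_def)
  \<comment> \<open>The bound 2 is \<open>v x + 1\<close>: an error of that size cannot change the
    valuation of \<open>x\<close>.\<close>
  then obtain n where n: "of_rat (q n) = x \<or> 2 \<le> v (of_rat (q n) - x)"
    unfolding val_tendsto_def by blast
  have "of_rat (q n) \<noteq> (0::'a) \<and> v (of_rat (q n)) = 1"
  proof (cases "of_rat (q n) = x")
    case False
    then have "val_ge v (v x + 1) (of_rat (q n) - x)" using n x by (simp add: val_ge_def)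
    from val_add_eq[OF x(2) this] x show ?thesis by simp
  qed (use x in simp)
  then have "v (of_nat p) dvd 1" using rat[of "q n"] by auto
  then show ?thesis using pos by simp
qed

text \<open>
  \<open>real_cyclotomic m\<close> evaluated at \<open>x + 1/x - 2\<close> is \<open>\<Sum>k=-m..m. x\<^sup>k\<close>. Writing it in this shifted
  variable makes it an Eisenstein polynomial when \<open>2m + 1\<close> is prime.
\<close>

definition real_cyclotomic :: "nat \<Rightarrow> int poly" where
  "real_cyclotomic m = (\<Sum>i\<le>m. monom (int (((m + i + 1) choose (2*i + 1)) + ((m + i) choose (2*i + 1)))) i)"

lemma coeff_real_cyclotomic:
  "coeff (real_cyclotomic m) i = int (((m + i + 1) choose (2*i + 1)) + ((m + i) choose (2*i + 1)))"
  by (simp add: real_cyclotomic_def coeff_sum binomial_eq_0)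

text \<open>The recurrence of the sums of x^k over -m \<le> k \<le> m, where \<open>[:2, 1:]\<close>
  stands for x + 1/x in the shifted variable. On coefficients it is Pascal's rule.\<close>

lemma real_cyclotomic_rec:
  "real_cyclotomic (Suc (Suc m)) = [:2, 1:] * real_cyclotomic (Suc m) - real_cyclotomic m"
proof (rule poly_eqI)
  fix i
  show "coeff (real_cyclotomic (Suc (Suc m))) i
      = coeff ([:2, 1:] * real_cyclotomic (Suc m) - real_cyclotomic m) i"
    by (cases i) (simp_all add: coeff_real_cyclotomic coeff_pCons algebra_simps numeral_2_eq_2)
qed

lemma map_poly_ring_hom:
  fixes h :: "'a::comm_ring_1 \<Rightarrow> 'b::comm_ring_1"
  assumes add: "\<And>x y. h (x + y) = h x + h y" and mult: "\<And>x y. h (x * y) = h x * h y"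
  shows "map_poly h (p + q) = map_poly h p + map_poly h q"
    "map_poly h (p - q) = map_poly h p - map_poly h q"
    "map_poly h (p * q) = map_poly h p * map_poly h q"
proof -
  have zero: "h 0 = 0" using add[of 0 0] by (metis add_cancel_right_right)
  have diff: "h (x - y) = h x - h y" for x y using add[of "x - y" y] by simp
  have sum: "h (sum g A) = (\<Sum>a\<in>A. h (g a))" for g :: "nat \<Rightarrow> 'a" and A
    by (induction A rule: infinite_finite_induct) (simp_all add: zero add)
  show "map_poly h (p + q) = map_poly h p + map_poly h q"
    "map_poly h (p - q) = map_poly h p - map_poly h q"
    by (rule poly_eqI; simp add: coeff_map_poly zero add diff)+
  show "map_poly h (p * q) = map_poly h p * map_poly h q"
    by (rule poly_eqI) (simp add: coeff_map_poly zero coeff_mult sum mult)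
qed

text \<open>The factor \<open>(x - 1) * x ^ m\<close> clears denominators and telescopes the
  symmetric geometric sum. Both sides satisfy the same three-term recurrence, so two initial values
  suffice.\<close>

lemma real_cyclotomic_eval:
  fixes x :: "'a::field"
  assumes "x \<noteq> 0"
  shows "(x - 1) * x ^ m * poly (map_poly of_int (real_cyclotomic m)) (x + inverse x - 2)
    = x ^ (2 * m + 1) - 1"
proof -
  let ?s = "\<lambda>m. poly (map_poly of_int (real_cyclotomic m)) (x + inverse x - 2)"
  have s0: "?s 0 = 1"
    by (simp add: real_cyclotomic_def)
  have s1: "?s 1 = 1 + x + inverse x"
    by (simp add: real_cyclotomic_def monom_altdef map_poly_pCons numeral_eq_Suc)
  have rec: "?s (Suc (Suc m)) = (x + inverse x) * ?s (Suc m) - ?s m" for m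
    unfolding real_cyclotomic_rec by (subst map_poly_ring_hom; simp add: map_poly_ring_hom map_poly_pCons del: mult_pCons_left)+
  show ?thesis
  proof (induction m rule: induct_nat_012)
    case 0
    show ?case using s0 by simp
  next
    case 1
    show ?case using s1 assms by (simp add: field_simps numeral_eq_Suc)
  next
    case (ge2 n)
    have "(x - 1) * x ^ Suc (Suc n) * ?s (Suc (Suc n)) =
        (x ^ 2 + 1) * ((x - 1) * x ^ Suc n * ?s (Suc n)) - x ^ 2 * ((x - 1) * x ^ n * ?s n)"
      unfolding rec using assms by (simp add: field_simps power2_eq_square)
    also have "\<dots> = (x ^ 2 + 1) * (x ^ (2 * Suc n + 1) - 1) - x ^ 2 * (x ^ (2 * n + 1) - 1)"
      by (simp only: ge2)
    also have "\<dots> = x ^ (2 * Suc (Suc n) + 1) - 1"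
      by (simp add: algebra_simps power2_eq_square)
    finally show ?case .
  qed
qed

text \<open>Absorption gives (2i+1) c = (2m+1) binom(m+i, 2i) for the coefficient c, and the prime
  2m+1 is too large to divide 2i+1.\<close>

lemma dvd_coeff_real_cyclotomic:
  assumes "Factorial_Ring.prime (2 * m + 1)" "i < m"
  shows "int (2 * m + 1) dvd coeff (real_cyclotomic m) i"
proof -
  let ?c = "((m + i + 1) choose (2*i + 1)) + ((m + i) choose (2*i + 1))"
  let ?b = "(m + i) choose (2 * i)"
  have 1: "(2 * i + 1) * ((m + i + 1) choose (2 * i + 1)) = (m + i + 1) * ?b"
    using Suc_times_binomial_eq[of "m + i" "2 * i"] by simp
  have 2: "(m + i + 1) choose (2 * i + 1) = ?b + ((m + i) choose (2 * i + 1))"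
    by simp
  have "(2 * i + 1) * ?c + (2 * i + 1) * ?b = 2 * ((2 * i + 1) * ((m + i + 1) choose (2 * i + 1)))"
    using 2 by (simp add: algebra_simps)
  also have "\<dots> = (2 * m + 1) * ?b + (2 * i + 1) * ?b"
    unfolding 1 by (simp add: algebra_simps)
  finally have "(2 * i + 1) * ?c = (2 * m + 1) * ?b" by (rule add_right_imp_eq)
  then have "(2 * m + 1) dvd (2 * i + 1) * ?c" by (simp only: dvd_triv_left)
  moreover have "\<not> (2 * m + 1) dvd (2 * i + 1)"
    using assms(2) by (auto dest: dvd_imp_le)
  ultimately have "(2 * m + 1) dvd ?c"
    using assms(1) prime_dvd_multD by blast
  then show ?thesis
    unfolding coeff_real_cyclotomic by (simp only: of_nat_dvd_iff)
qed

lemma coeff_real_cyclotomic_top: "coeff (real_cyclotomic m) m = 1"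
  by (simp add: coeff_real_cyclotomic binomial_eq_0 flip: mult_2)

lemma coeff_real_cyclotomic_0: "coeff (real_cyclotomic m) 0 = int (2 * m + 1)"
  by (simp add: coeff_real_cyclotomic)

lemma degree_real_cyclotomic: "degree (real_cyclotomic m) = m"
proof (rule antisym)
  show "degree (real_cyclotomic m) \<le> m"
    by (rule degree_le) (simp add: coeff_real_cyclotomic binomial_eq_0)
  show "m \<le> degree (real_cyclotomic m)"
    by (rule le_degree) (simp add: coeff_real_cyclotomic_top)
qed

section \<open>The ramified quadratic extension\<close>

lemma (in discretely_valued) val_ge_of_int [simp]: "val_ge v 0 (of_int n)"
  by (cases n) (simp_all del: of_nat_Suc)

locale cyclotomic_tower =
  fixes l :: nat
    and vF :: "'f::field_char_0 \<Rightarrow> int"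
    and vK :: "'k::field \<Rightarrow> int"
    and i :: "'f \<Rightarrow> 'k"
    and j :: "'k \<Rightarrow> 'l::field"
    and \<zeta> :: 'l
    and bar :: "'l \<Rightarrow> 'l"
  assumes prime_l: "Factorial_Ring.prime l" and odd_l: "odd l"
    and vF: "discrete_valuation vF" "residue_char vF l"
      "unramified_over vF (closure_of_rationals vF)"
    and i_hom: "field_hom i" and j_hom: "field_hom j"
    and \<zeta>: "primitive_root_of_unity l \<zeta>"
    and gen_K: "range j = subfield_generated (range (j \<circ> i) \<union> {\<zeta> + inverse \<zeta>})"
    and gen_L: "UNIV = subfield_generated (range j \<union> {\<zeta>})"
    and vK: "discrete_valuation vK" and vK_extends: "valuation_extends i vF vK"
    and bar_hom: "field_hom bar" and bar_j: "\<And>c. bar (j c) = j c" and bar_nontriv: "bar \<noteq> id"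
begin

sublocale F: discretely_valued vF by unfold_locales (rule vF)
sublocale K: discretely_valued vK by unfold_locales (rule vK)

lemmas i_simps = field_homD[OF i_hom]
lemmas j_simps = field_homD[OF j_hom]
lemmas bar_simps = field_homD[OF bar_hom]

definition "hl = l div 2"

lemma l_eq: "l = 2 * hl + 1"
  using odd_l by (auto simp: hl_def elim: oddE)

lemma hl_pos: "0 < hl"
  using prime_gt_1_nat[OF prime_l] l_eq by simp

lemma \<zeta>_simps: "\<zeta> ^ l = 1" "\<zeta> \<noteq> 0" "\<zeta> \<noteq> 1" "l > 1"
proof -
  show l: "l > 1" by (rule prime_gt_1_nat[OF prime_l])
  show "\<zeta> ^ l = 1" using \<zeta> by (simp add: primitive_root_of_unity_def)
  then show "\<zeta> \<noteq> 0" using l by (auto simp: zero_power)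
  show "\<zeta> \<noteq> 1" using \<zeta> l unfolding primitive_root_of_unity_def by (metis less_one power_one_right)
qed

lemma of_nat_K_nonzero: "of_nat n = (0::'k) \<longleftrightarrow> n = 0"
  using i_simps(7)[of "of_nat n" 0] by (simp add: i_simps)

text \<open>The ramification index of K over F, because \<open>l\<close> is a uniformizer of
  F.\<close>

definition "e = vK (of_nat l)"

lemma vK_i: "x \<noteq> 0 \<Longrightarrow> vK (i x) = e * vF x"
  and e_pos: "0 < e"
proof -
  obtain c where c: "c > 0" "\<And>x. x \<noteq> 0 \<Longrightarrow> vK (i x) = c * vF x"
    using vK_extends by (auto simp: valuation_extends_def)
  have "vF (of_nat l) = 1"
    using val_residue_char_unramified[OF vF(1,2) prime_l vF(3)] .
  then have "e = c" using c(2)[of "of_nat l"] \<zeta>_simps(4) by (simp add: e_def i_simps)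
  with c show "0 < e" "x \<noteq> 0 \<Longrightarrow> vK (i x) = e * vF x" by auto
qed

lemma vK_of_nat: "\<not> l dvd n \<Longrightarrow> of_nat n \<noteq> (0::'k)" "\<not> l dvd n \<Longrightarrow> vK (of_nat n) = 0"
  using F.val_of_nat_coprime[OF vF(2), of n] vK_i[of "of_nat n"]
  by (auto simp: i_simps of_nat_K_nonzero)

definition "t = inv_into UNIV j (\<zeta> + inverse \<zeta>)"

lemma j_t: "j t = \<zeta> + inverse \<zeta>"
proof -
  have "\<zeta> + inverse \<zeta> \<in> range j"
    unfolding gen_K by (auto simp: subfield_generated_def intro: generate_field.incl)
  then show ?thesis unfolding t_def by (rule f_inv_into_f)
qed

lemma poly_of_int_hom:
  assumes "field_hom h"
  shows "h (poly (map_poly of_int q) x) = poly (map_poly of_int q) (h x)"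
proof (induction q)
  case (pCons c q)
  have "h (of_int c) = of_int c"
    using field_homD[OF assms] by (cases c) (simp_all del: of_nat_Suc)
  with pCons show ?case by (simp add: map_poly_pCons field_homD[OF assms])
qed (simp add: field_homD[OF assms])

lemma real_cyclotomic_root: "poly (map_poly of_int (real_cyclotomic hl)) (t - 2) = 0"
proof -
  have "(\<zeta> - 1) * \<zeta> ^ hl * poly (map_poly of_int (real_cyclotomic hl)) (\<zeta> + inverse \<zeta> - 2) = 0"
    using real_cyclotomic_eval[of \<zeta> hl] \<zeta>_simps(1,2) unfolding l_eq[symmetric] by simp
  moreover have "j (t - 2) = \<zeta> + inverse \<zeta> - 2"
    by (simp add: j_simps j_t)
  ultimately have "j (poly (map_poly of_int (real_cyclotomic hl)) (t - 2)) = 0"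
    using \<zeta>_simps by (simp add: poly_of_int_hom[OF j_hom])
  then show ?thesis using j_simps(4,7) by metis
qed

text \<open>A Newton polygon argument: in the Eisenstein relation at \<open>t - 2\<close> all middle
  terms have valuation larger than that of the constant term \<open>l\<close>, so the leading term
  must have the same valuation as \<open>l\<close> for the sum to vanish.\<close>

lemma vK_t: "t - 2 \<noteq> 0" "0 < vK (t - 2)" "e = int hl * vK (t - 2)"
proof -
  let ?p = "t - 2"
  let ?c = "\<lambda>k. of_int (coeff (real_cyclotomic hl) k) :: 'k"
  let ?f = "\<lambda>k. ?c k * ?p ^ k"
  have degree: "degree (map_poly (of_int :: int \<Rightarrow> 'k) (real_cyclotomic hl)) = hl"
    by (intro antisym degree_le le_degree)
      (simp_all add: coeff_map_poly coeff_eq_0 degree_real_cyclotomic coeff_real_cyclotomic_top)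
  have "(\<Sum>k\<le>hl. ?f k) = 0"
    using real_cyclotomic_root by (simp add: poly_altdef degree coeff_map_poly)
  moreover have "(\<Sum>k\<le>hl. ?f k) = (\<Sum>k<hl. ?f k) + ?p ^ hl"
    by (simp add: coeff_real_cyclotomic_top flip: lessThan_Suc_atMost)
  ultimately have rel: "?p ^ hl + (\<Sum>k<hl. ?f k) = 0" by (simp add: add.commute)
  have c: "val_ge vK e (?c k)" if "k < hl" for k
  proof -
    have "int l dvd coeff (real_cyclotomic hl) k"
      using dvd_coeff_real_cyclotomic[of hl k] prime_l that unfolding l_eq[symmetric] by simp
    then obtain d where "coeff (real_cyclotomic hl) k = int l * d" by (elim dvdE)
    then have "?c k = of_nat l * of_int d" by simp
    moreover have "val_ge vK e (of_nat l)" by (simp add: val_ge_def e_def)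
    ultimately show ?thesis using K.val_ge_mult[of e "of_nat l" 0 "of_int d"] by simp
  qed
  have split: "(\<Sum>k<hl. ?f k) = of_nat l + (\<Sum>k\<in>{0<..<hl}. ?f k)"
  proof -
    have "{..<hl} = insert 0 {0<..<hl}" using hl_pos by auto
    then show ?thesis using l_eq by (simp add: coeff_real_cyclotomic_0)
  qed
  show nz: "?p \<noteq> 0"
  proof
    assume "?p = 0"
    then have "(\<Sum>k<hl. ?f k) = of_nat l" unfolding split by (auto intro!: sum.neutral)
    then show False using rel \<open>?p = 0\<close> hl_pos \<zeta>_simps(4) by (simp add: of_nat_K_nonzero zero_power)
  qed
  have f: "val_ge vK (e + int k * vK ?p) (?f k)" if "k < hl" for k
  proof -
    have "val_ge vK (int k * vK ?p) (?p ^ k)" by (rule K.val_ge_power) (simp add: val_ge_def)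
    then show ?thesis using K.val_ge_mult[OF c[OF that]] by simp
  qed
  have vp: "vK (?p ^ hl) = int hl * vK ?p" using nz by (rule K.val_power)
  show pos: "0 < vK ?p"
  proof (rule ccontr)
    assume neg: "\<not> 0 < vK ?p"
    \<comment> \<open>If \<open>?p\<close> had valuation at most 0, lowering the exponent would not
      lower the valuation, while every lower coefficient adds \<open>e > 0\<close>; the leading term
      would then dominate strictly and the sum could not vanish.\<close>
    have "val_ge vK (vK (?p ^ hl) + 1) (\<Sum>k<hl. ?f k)"
    proof (rule K.val_ge_sum)
      fix k assume k: "k \<in> {..<hl}"
      then have "int hl * vK ?p \<le> int k * vK ?p"
        using neg by (intro mult_right_mono_neg) auto
      then show "val_ge vK (vK (?p ^ hl) + 1) (?f k)"
        using f[of k] k e_pos by (intro K.val_ge_trans[OF f[of k]]) (auto simp: vp)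
    qed
    then show False using K.val_add_eq(1)[of "?p ^ hl"] rel nz by simp
  qed
  have "val_ge vK (e + 1) (\<Sum>k\<in>{0<..<hl}. ?f k)"
  proof (rule K.val_ge_sum)
    fix k assume k: "k \<in> {0<..<hl}"
    then have "1 * 1 \<le> int k * vK ?p" using pos by (intro mult_mono) auto
    then show "val_ge vK (e + 1) (?f k)"
      using k by (intro K.val_ge_trans[OF f[of k]]) auto
  qed
  then have "vK (\<Sum>k<hl. ?f k) = e"
    unfolding split using K.val_add_eq(2)[of "of_nat l"] \<zeta>_simps(4)
    by (simp add: e_def of_nat_K_nonzero)
  moreover have "(\<Sum>k<hl. ?f k) = - (?p ^ hl)" using rel by (simp add: eq_neg_iff_add_eq_0 add.commute)
  ultimately show "e = int hl * vK ?p" using vp by simp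
qed

text \<open>Evaluation at \<open>t - 2\<close> and not at \<open>t\<close>, because the Eisenstein
  polynomial is written in the shifted variable. The image is F[t].\<close>

definition "ev q = poly (map_poly i q) (t - 2)"

lemma ev_simps: "ev (q + r) = ev q + ev r" "ev (q - r) = ev q - ev r" "ev (q * r) = ev q * ev r"
  "ev [:c:] = i c" "ev [:2, 1:] = t" "ev 0 = 0"
proof -
  note * = map_poly_ring_hom[of i, OF i_simps(1,2)]
  show "ev (q + r) = ev q + ev r" "ev (q - r) = ev q - ev r" "ev (q * r) = ev q * ev r"
    by (simp_all add: ev_def *)
  show "ev [:c:] = i c" "ev 0 = 0" by (simp_all add: ev_def map_poly_pCons i_simps)
  show "ev [:2, 1:] = t"
    by (simp add: ev_def map_poly_pCons i_simps)
qed

text \<open>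
  After reduction modulo the Eisenstein polynomial, the terms of \<open>ev q\<close> have pairwise distinct
  valuations, all of them multiples of the valuation of \<open>t - 2\<close>.
\<close>

lemma val_ev: "ev q = 0 \<or> vK (t - 2) dvd vK (ev q)"
proof -
  let ?p = "t - 2"
  define Q :: "'f poly" where "Q = map_poly of_int (real_cyclotomic hl)"
  have "map_poly i Q = map_poly of_int (real_cyclotomic hl)"
  proof (rule poly_eqI)
    fix n
    have "i (of_int c) = of_int c" for c
      by (cases c) (simp_all add: i_simps del: of_nat_Suc)
    then show "coeff (map_poly i Q) n = coeff (map_poly of_int (real_cyclotomic hl)) n"
      by (simp add: Q_def coeff_map_poly i_simps)
  qed
  then have evQ: "ev Q = 0"
    using real_cyclotomic_root by (simp add: ev_def)
  have degQ: "degree Q = hl"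
    unfolding Q_def by (intro antisym degree_le le_degree)
      (simp_all add: coeff_map_poly coeff_eq_0 degree_real_cyclotomic coeff_real_cyclotomic_top)
  define r where "r = q mod Q"
  have "q = (q div Q) * Q + r" by (simp add: r_def)
  then have "ev q = ev (q div Q) * ev Q + ev r" by (metis ev_simps(1,3))
  then have ev_r: "ev q = ev r" using evQ by simp
  have "Q \<noteq> 0" using degQ hl_pos by auto
  then have deg_r: "r = 0 \<or> degree r < hl"
    using degree_mod_less[of Q q] degQ by (simp add: r_def)
  show ?thesis
  proof (cases "r = 0")
    case True
    then show ?thesis using ev_r by (simp add: ev_simps)
  next
    case False
    let ?f = "\<lambda>k. i (coeff r k) * ?p ^ k"
    let ?A = "{k. k < hl \<and> coeff r k \<noteq> 0}"
    have deg: "degree (map_poly i r) = degree r"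
      using i_simps(4,7) by (intro degree_map_poly) metis
    have "ev r = (\<Sum>k\<le>degree r. ?f k)"
      by (simp add: ev_def poly_altdef deg coeff_map_poly i_simps)
    also have "\<dots> = sum ?f ?A"
      using False deg_r by (intro sum.mono_neutral_cong_right) (auto simp: i_simps le_degree)
    finally have ev: "ev r = sum ?f ?A" .
    have nz: "?f k \<noteq> 0" and val: "vK (?f k) = vK ?p * (int hl * vF (coeff r k) + int k)"
      if "k \<in> ?A" for k
    proof -
      have "i (coeff r k) \<noteq> 0" using that i_simps(4,7) by (metis (mono_tags, lifting) mem_Collect_eq)
      then show "?f k \<noteq> 0" "vK (?f k) = vK ?p * (int hl * vF (coeff r k) + int k)"
        using that vK_t by (simp_all add: K.val_mult K.val_power vK_i algebra_simps)
    qed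
    have "inj_on (\<lambda>k. vK (?f k)) ?A"
    proof (rule inj_onI)
      fix k k' assume k: "k \<in> ?A" "k' \<in> ?A" "vK (?f k) = vK (?f k')"
      then have "int hl * vF (coeff r k) + int k = int hl * vF (coeff r k') + int k'"
        using val[OF k(1)] val[OF k(2)] vK_t(2) by simp
      \<comment> \<open>Elements of F have valuations divisible by \<open>e\<close>, which is
        \<open>hl\<close> times the valuation of \<open>t - 2\<close>. Hence the residue modulo
        \<open>hl\<close> recovers the exponent, as \<open>k < hl\<close>.\<close>
      then have "(int hl * vF (coeff r k) + int k) mod int hl
          = (int hl * vF (coeff r k') + int k') mod int hl" by simp
      then show "k = k'" using k by simp
    qed
    moreover have "finite ?A" "?A \<noteq> {}"
      using False deg_r by (auto intro!: exI[of _ "degree r"])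
    ultimately obtain k where "k \<in> ?A" "vK (ev r) = vK (?f k)"
      using K.val_sum_distinct[of ?A ?f] nz ev by auto
    then show ?thesis using val ev_r by simp
  qed
qed

text \<open>Such fractions form a field containing the generators of \<open>K\<close>. Fractions
  serve the purpose as well as polynomials, since divisibility of valuations passes to
  quotients.\<close>

lemma K_fractions: "\<exists>q r. ev r \<noteq> 0 \<and> y = ev q / ev r"
proof -
  let ?E = "{j (ev q / ev r) | q r. ev r \<noteq> 0}"
  have E: "j (ev q / ev r) \<in> ?E" if "ev r \<noteq> 0" for q r using that by auto
  have one: "ev 1 = 1" using ev_simps(4)[of 1] i_simps(3) by (simp add: one_pCons)
  have "subfield_generated (range (j \<circ> i) \<union> {\<zeta> + inverse \<zeta>}) \<subseteq> ?E"
  proof (rule subfield_generated_subset)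
    show "range (j \<circ> i) \<union> {\<zeta> + inverse \<zeta>} \<subseteq> ?E"
      using E[of 1 "[:_:]"] E[of 1 "[:2, 1:]"] one by (auto simp: ev_simps j_t)
    show "1 \<in> ?E" using E[of 1 1] one j_simps by simp
  next
    fix x assume "x \<in> ?E"
    then obtain q r where x: "ev r \<noteq> 0" "x = j (ev q / ev r)" by auto
    have "- x = j (ev (0 - q) / ev r)" unfolding x ev_simps(2,6) by (simp add: j_simps)
    then show "- x \<in> ?E" using E[of r "0 - q"] x by simp
    have "inverse x = j (ev r / ev q)" unfolding x by (simp add: j_simps)
    moreover have "ev q \<noteq> 0" if "x \<noteq> 0" using that x by (auto simp: j_simps)
    ultimately show "inverse x \<in> ?E" if "x \<noteq> 0" using E[of q r] that by simp
  next
    fix x y assume "x \<in> ?E" "y \<in> ?E"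
    then obtain q r q' r' where x: "ev r \<noteq> 0" "x = j (ev q / ev r)"
      and y: "ev r' \<noteq> 0" "y = j (ev q' / ev r')" by auto
    have "x + y = j (ev (q * r' + q' * r) / ev (r * r'))"
      unfolding x y j_simps(1)[symmetric] using x y by (simp add: ev_simps add_frac_eq)
    then show "x + y \<in> ?E" using E[of "r * r'"] x y by (simp add: ev_simps(3))
    have "x * y = j (ev (q * q') / ev (r * r'))"
      unfolding x y j_simps(2)[symmetric] by (simp add: ev_simps)
    then show "x * y \<in> ?E" using E[of "r * r'" "q * q'"] x y by (simp add: ev_simps(3))
  qed
  then have "j y \<in> ?E" unfolding gen_K[symmetric] by (rule subsetD) (rule rangeI)
  then show ?thesis using j_simps(7) by auto
qed

text \<open>All values of the valuation are multiples of \<open>vK (t - 2)\<close>, and being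
  normalised it takes the value 1.\<close>

lemma vK_t_eq_1: "vK (t - 2) = 1"
proof -
  obtain y where y: "y \<noteq> 0" "vK y = 1" using K.ex_val[of 1] by auto
  obtain q r where "ev r \<noteq> 0" "y = ev q / ev r" using K_fractions[of y] by auto
  then have "vK y = vK (ev q) - vK (ev r)" "ev q \<noteq> 0" "ev r \<noteq> 0"
    using y by (auto simp: K.val_divide)
  then have "vK (t - 2) dvd 1" using val_ev[of q] val_ev[of r] y by (metis dvd_diff)
  then show ?thesis using vK_t(2) by simp
qed

section \<open>The basis 1, \<delta> of \<open>L\<close> over \<open>K\<close> and the trace\<close>

definition "\<delta> = \<zeta> - inverse \<zeta>"
definition "\<pi> = t\<^sup>2 - 4"

lemma l_not_dvd: "\<not> l dvd 2" "\<not> l dvd 4"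
proof -
  show *: "\<not> l dvd 2" using dvd_imp_le[of l 2] odd_l \<zeta>_simps(4) by (cases "l = 2") auto
  show "\<not> l dvd 4" using prime_dvd_multD[of l 2 2] prime_l * by auto
qed

lemma two_K: "(2::'k) \<noteq> 0" "vK 2 = 0" and four_K: "(4::'k) \<noteq> 0" "vK 4 = 0"
  using vK_of_nat[OF l_not_dvd(1)] vK_of_nat[OF l_not_dvd(2)] by simp_all

lemma two_L: "(2::'l) \<noteq> 0"
  using j_simps(7)[of 2 0] two_K by (simp add: j_simps)

text \<open>\<pi> is the product of \<open>t - 2\<close> and \<open>t + 2\<close>; the second factor
  is 4 plus an element of valuation 1, hence a unit.\<close>

lemma \<pi>_nonzero: "\<pi> \<noteq> 0" and vK_\<pi>: "vK \<pi> = 1"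
proof -
  have 1: "\<pi> = (t - 2) * (4 + (t - 2))" by (simp add: \<pi>_def algebra_simps power2_eq_square)
  have 2: "4 + (t - 2) \<noteq> 0" "vK (4 + (t - 2)) = vK 4"
    by (rule K.val_add_eq; use four_K vK_t_eq_1 in \<open>simp add: val_ge_def\<close>)+
  show "\<pi> \<noteq> 0" "vK \<pi> = 1"
    using 1 2 vK_t vK_t_eq_1 four_K by (simp_all add: K.val_mult)
qed

lemma \<delta>_square: "\<delta> * \<delta> = j \<pi>"
  using \<zeta>_simps by (simp add: \<delta>_def \<pi>_def j_simps j_t power2_eq_square field_simps)

lemma \<zeta>_eq: "\<zeta> = j (t / 2) + \<delta> * j (1 / 2)"
  using two_L by (simp add: \<delta>_def j_simps j_t field_simps)

text \<open>Since \<open>bar\<close> fixes \<zeta> + 1/\<zeta>, it permutes the roots \<zeta> and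
  1/\<zeta> of a quadratic polynomial over \<open>K\<close>. Fixing \<zeta> would make it the
  identity on the field that \<zeta> generates.\<close>

lemma bar_\<zeta>: "bar \<zeta> = inverse \<zeta>"
proof -
  have ne: "bar \<zeta> \<noteq> \<zeta>"
  proof
    assume *: "bar \<zeta> = \<zeta>"
    have "subfield_generated (range j \<union> {\<zeta>}) \<subseteq> {x. bar x = x}"
      by (rule subfield_generated_subset) (auto simp: bar_simps bar_j *)
    then have "bar x = x" for x unfolding gen_L[symmetric] by (metis (mono_tags) UNIV_I mem_Collect_eq subsetD)
    then show False using bar_nontriv by (simp add: fun_eq_iff)
  qed
  have nz: "bar \<zeta> \<noteq> 0" using \<zeta>_simps(2) bar_simps(4,7) by metis
  have "bar \<zeta> + inverse (bar \<zeta>) = \<zeta> + inverse \<zeta>"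
    using bar_j[of t] by (simp add: j_t bar_simps)
  then have "(bar \<zeta> - \<zeta>) * (bar \<zeta> * \<zeta> - 1) = 0"
    using nz \<zeta>_simps(2) by (simp add: field_simps)
  then have "bar \<zeta> * \<zeta> = 1" using ne by simp
  then show ?thesis using \<zeta>_simps(2) by (simp add: field_simps)
qed

lemma bar_\<delta>: "bar \<delta> = - \<delta>"
  by (simp add: \<delta>_def bar_simps bar_\<zeta>)

lemma \<delta>_nonzero: "\<delta> \<noteq> 0"
  using \<delta>_square \<pi>_nonzero j_simps(4,7) by (metis mult_zero_left)

lemma L_decompose_unique:
  assumes "x = j a + \<delta> * j b"
  shows "j a = (x + bar x) / 2" "j b = (x - bar x) / (2 * \<delta>)"
  using two_L \<delta>_nonzero by (simp_all add: assms bar_simps bar_j bar_\<delta> field_simps)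

lemma L_decompose: "\<exists>a b. x = j a + \<delta> * j b"
proof -
  let ?E = "{j a + \<delta> * j b | a b. True}"
  have E: "j a + \<delta> * j b \<in> ?E" for a b by auto
  have "subfield_generated (range j \<union> {\<zeta>}) \<subseteq> ?E"
  proof (rule subfield_generated_subset)
    show "range j \<union> {\<zeta>} \<subseteq> ?E" using E[of _ 0] E[of "t / 2" "1 / 2"] \<zeta>_eq by (auto simp: j_simps)
    show "1 \<in> ?E" using E[of 1 0] by (simp add: j_simps)
  next
    fix x assume "x \<in> ?E"
    then obtain a b where x: "x = j a + \<delta> * j b" by auto
    then show "- x \<in> ?E" using E[of "- a" "- b"] by (simp add: j_simps)
    show "inverse x \<in> ?E" if "x \<noteq> 0"
    proof -
      define n where "n = a\<^sup>2 - \<pi> * b\<^sup>2"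
      have n: "j n = x * bar x"
        by (simp add: n_def x bar_simps bar_j bar_\<delta> j_simps \<delta>_square[symmetric] algebra_simps power2_eq_square)
      have "bar x \<noteq> 0" using that bar_simps(4,7) by metis
      then have "inverse x = bar x * inverse (j n)" using that by (simp add: n)
      also have "\<dots> = j (a * inverse n) + \<delta> * j (- b * inverse n)"
        by (simp add: x bar_simps bar_j bar_\<delta> j_simps algebra_simps)
      finally have "inverse x = j (a * inverse n) + \<delta> * j (- b * inverse n)" .
      then show ?thesis using E by metis
    qed
  next
    fix x y assume "x \<in> ?E" "y \<in> ?E"
    then obtain a b c d where x: "x = j a + \<delta> * j b" and y: "y = j c + \<delta> * j d" by auto
    have "x + y = j (a + c) + \<delta> * j (b + d)"
      by (simp add: x y j_simps algebra_simps)
    then show "x + y \<in> ?E" using E by metis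
    have "x * y = j (a * c + \<pi> * b * d) + \<delta> * j (a * d + b * c)"
      by (simp add: x y j_simps \<delta>_square[symmetric] algebra_simps)
    then show "x * y \<in> ?E" using E by metis
  qed
  then show ?thesis using gen_L by auto
qed

text \<open>Coordinates with respect to 1, \<delta>, named as for complex numbers: \<delta> has
  square \<pi> and \<open>bar\<close> changes the sign of the \<delta>-part, so both are projections
  onto eigenspaces of \<open>bar\<close>.\<close>

definition "re x = inv_into UNIV j ((x + bar x) / 2)"
definition "im x = inv_into UNIV j ((x - bar x) / (2 * \<delta>))"

lemma re_eqI: "x = j a + \<delta> * j b \<Longrightarrow> re x = a"
  and im_eqI: "x = j a + \<delta> * j b \<Longrightarrow> im x = b"
proof -
  have "inj j" using j_simps(7) by (simp add: inj_def)
  then show "x = j a + \<delta> * j b \<Longrightarrow> re x = a" "x = j a + \<delta> * j b \<Longrightarrow> im x = b"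
    using L_decompose_unique[of x a b] by (simp_all add: re_def im_def flip: L_decompose_unique)
qed

lemma re_im: "x = j (re x) + \<delta> * j (im x)"
  using L_decompose[of x] re_eqI im_eqI by metis

lemma re_im_eqI: "re x = re y \<Longrightarrow> im x = im y \<Longrightarrow> x = y"
  using re_im by metis

lemma re_im_simps [simp]:
  "re (j a) = a" "im (j a) = 0" "re \<delta> = 0" "im \<delta> = 1" "re 0 = 0" "im 0 = 0" "re 1 = 1" "im 1 = 0"
  "re (x + y) = re x + re y" "im (x + y) = im x + im y" "re (- x) = - re x" "im (- x) = - im x"
  "re (x - y) = re x - re y" "im (x - y) = im x - im y"
  "re (x * y) = re x * re y + \<pi> * (im x * im y)" "im (x * y) = re x * im y + im x * re y"
  "re (bar x) = re x" "im (bar x) = - im x"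
proof -
  note I = re_eqI im_eqI
  show "re (j a) = a" "im (j a) = 0" using I[of "j a" a 0] by (simp_all add: j_simps)
  show "re \<delta> = 0" "im \<delta> = 1" using I[of \<delta> 0 1] by (simp_all add: j_simps)
  show "re 0 = 0" "im 0 = 0" using I[of 0 0 0] by (simp_all add: j_simps)
  show "re 1 = 1" "im 1 = 0" using I[of 1 1 0] by (simp_all add: j_simps)
  have "x + y = j (re x + re y) + \<delta> * j (im x + im y)"
    by (subst re_im[of x], subst re_im[of y]) (simp add: j_simps algebra_simps)
  then show "re (x + y) = re x + re y" "im (x + y) = im x + im y" by (rule I)+
  have "- x = j (- re x) + \<delta> * j (- im x)"
    by (subst re_im[of x]) (simp add: j_simps algebra_simps)
  then show "re (- x) = - re x" "im (- x) = - im x" by (rule I)+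
  have "x - y = j (re x - re y) + \<delta> * j (im x - im y)"
    by (subst re_im[of x], subst re_im[of y]) (simp add: j_simps algebra_simps)
  then show "re (x - y) = re x - re y" "im (x - y) = im x - im y" by (rule I)+
  have "x * y = j (re x * re y + \<pi> * (im x * im y)) + \<delta> * j (re x * im y + im x * re y)"
    by (subst re_im[of x], subst re_im[of y])
      (simp add: j_simps \<delta>_square[symmetric] algebra_simps)
  then show "re (x * y) = re x * re y + \<pi> * (im x * im y)" "im (x * y) = re x * im y + im x * re y"
    by (rule I)+
  have "bar x = j (re x) + \<delta> * j (- im x)"
    by (subst re_im[of x]) (simp add: j_simps bar_simps bar_j bar_\<delta>)
  then show "re (bar x) = re x" "im (bar x) = - im x" by (rule I)+
qed

lemma fixed_by_bar: "bar x = x \<Longrightarrow> x = j (re x)"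
proof (rule re_im_eqI)
  assume "bar x = x"
  then have "im x = - im x" using re_im_simps(18) by metis
  then have "2 * im x = 0" by simp
  then show "im x = im (j (re x))" using two_K by simp
qed simp

lemma vector_space_L: "vector_space (\<lambda>c y. j c * y)"
  by unfold_locales (simp_all add: j_simps algebra_simps)

text \<open>
  Applying \<open>bar\<close> to the equations of multiplication by \<open>x\<close> in a basis shows that the conjugate
  basis is an eigenvector for \<open>bar x\<close>, which determines the trace without a change of basis.
\<close>

lemma field_trace_eq: "field_trace j x = 2 * re x"
proof -
  let ?s = "\<lambda>c y. j c * y"
  interpret vs: vector_space ?s by (rule vector_space_L)
  define B where "B = (SOME B. \<not> vs.dependent B \<and> vs.span B = UNIV)"
  obtain B0 where "\<not> vs.dependent B0" "UNIV \<subseteq> vs.span B0"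
    using vs.maximal_independent_subset[of UNIV] by metis
  then have "\<exists>B. \<not> vs.dependent B \<and> vs.span B = UNIV" by auto
  then have B: "\<not> vs.dependent B" "vs.span B = UNIV"
    unfolding B_def by (metis (mono_tags, lifting) someI_ex)+
  have sp: "vs.span {1, \<delta>} = UNIV"
  proof -
    have "x \<in> vs.span {1, \<delta>}" for x
    proof -
      have "?s (re x) 1 + ?s (im x) \<delta> \<in> vs.span {1, \<delta>}"
        by (intro vs.span_add vs.span_scale vs.span_base) auto
      then show ?thesis using re_im[of x] by (simp add: mult.commute)
    qed
    then show ?thesis by auto
  qed
  have ind: "\<not> vs.dependent {1, \<delta>}"
  proof (rule ccontr)
    assume "\<not> \<not> vs.dependent {1, \<delta>}"
    moreover have ne: "\<delta> \<noteq> 1" using re_im_simps(3,7) by (metis zero_neq_one)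
    ultimately obtain u where "(\<Sum>x\<in>{1, \<delta>}. j (u x) * x) = 0" and "\<exists>x\<in>{1, \<delta>}. u x \<noteq> 0"
      by (subst (asm) not_not, subst (asm) vs.dependent_finite) auto
    then have u: "j (u 1) + j (u \<delta>) * \<delta> = 0" "u 1 \<noteq> 0 \<or> u \<delta> \<noteq> 0" using ne by auto
    have "re (j (u 1) + j (u \<delta>) * \<delta>) = u 1" "im (j (u 1) + j (u \<delta>) * \<delta>) = u \<delta>" by simp_all
    then show False using u(2) unfolding u(1) by simp
  qed
  have ne: "\<delta> \<noteq> 1" using re_im_simps(3,7) by (metis zero_neq_one)
  \<comment> \<open>The basis chosen inside \<open>field_trace\<close> is unknown; comparison with
    1, \<delta> shows that it has two elements.\<close>
  have "card B = vs.dim (UNIV :: 'l set)" using B by (metis vs.dim_eq_card vs.dim_span)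
  also have "\<dots> = card {1, \<delta>}" using ind sp by (metis vs.dim_eq_card vs.dim_span)
  finally have "card B = 2" using ne by simp
  then obtain b c where bc: "B = {b, c}" "b \<noteq> c" by (auto simp: card_2_iff)
  define r where "r = vs.representation B"
  have rep: "y = j (r y b) * b + j (r y c) * c" for y
  proof -
    have "(\<Sum>a\<in>B. ?s (r y a) a) = y"
      unfolding r_def using B bc by (intro vs.sum_representation_eq) auto
    then show ?thesis using bc by simp
  qed
  have "field_trace j x = r (x * b) b + r (x * c) c"
    unfolding field_trace_def Let_def B_def[symmetric] r_def[symmetric] using bc by simp
  moreover have "j (r (x * b) b + r (x * c) c) = x + bar x"
  proof -
    obtain p q p' q' where pq: "p = r (x * b) b" "q = r (x * b) c" "p' = r (x * c) b" "q' = r (x * c) c"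
      by simp
    have 1: "x * b = j p * b + j q * c" "x * c = j p' * b + j q' * c" using rep pq by auto
    have 2: "bar x * bar b = j p * bar b + j q * bar c" "bar x * bar c = j p' * bar b + j q' * bar c"
      using arg_cong[OF 1(1), of bar] arg_cong[OF 1(2), of bar] by (simp_all add: bar_simps bar_j)
    have "(x + bar x) * (b * bar c - c * bar b) =
        (x * b) * bar c - (x * c) * bar b + b * (bar x * bar c) - c * (bar x * bar b)"
      by (simp add: algebra_simps)
    also have "\<dots> = (j p + j q') * (b * bar c - c * bar b)"
      unfolding 1 2 by (simp add: algebra_simps)
    finally have *: "(x + bar x - (j p + j q')) * (b * bar c - c * bar b) = 0"
      by (simp add: algebra_simps)
    \<comment> \<open>The determinant of the basis and its conjugate. If it vanished,
      \<open>c / b\<close> would be fixed by \<open>bar\<close> and so lie in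
      \<open>K\<close>.\<close>
    have "b * bar c - c * bar b \<noteq> 0"
    proof
      assume "b * bar c - c * bar b = 0"
      moreover have "b \<noteq> 0" using B bc vs.dependent_zero by auto
      moreover from this have "bar b \<noteq> 0" using bar_simps(4,7) by metis
      ultimately have "bar (c / b) = c / b" by (simp add: bar_simps field_simps)
      then have "c = j (re (c / b)) * b"
        using fixed_by_bar[of "c / b"] \<open>b \<noteq> 0\<close> by (simp add: field_simps)
      then have "c \<in> vs.span {b}" by (metis vs.span_base vs.span_scale singletonI)
      moreover have "vs.dependent B" if "c \<in> vs.span {b}"
        using bc that by (auto simp: vs.dependent_def intro!: bexI[of _ c] simp: insert_Diff_if)
      ultimately show False using B by simp
    qed
    with * show ?thesis unfolding pq[symmetric] by (simp add: j_simps)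
  qed
  moreover have "j (2 * re x) = x + bar x"
    by (rule re_im_eqI) simp_all
  ultimately show ?thesis using j_simps(7) by metis
qed

text \<open>\<open>OL = \<O>\<^sub>K + \<delta> \<O>\<^sub>K\<close> is the valuation ring of \<open>'l\<close> and \<open>PL\<close> its maximal ideal.\<close>

definition "OL = {x. val_ge vK 0 (re x) \<and> val_ge vK 0 (im x)}"
definition "PL = {x. val_ge vK 1 (re x) \<and> val_ge vK 0 (im x)}"

lemma val_ge_\<pi>: "val_ge vK c x \<Longrightarrow> val_ge vK (c + 1) (\<pi> * x)"
  using K.val_ge_mult[of 1 \<pi> c x] vK_\<pi> by (simp add: val_ge_def add.commute)

lemma \<pi>_integral: "val_ge vK 0 \<pi>"
  using vK_\<pi> by (simp add: val_ge_def)

lemma OL_0: "0 \<in> OL" and OL_1: "1 \<in> OL" and OL_\<delta>: "\<delta> \<in> OL"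
  and OL_add: "x \<in> OL \<Longrightarrow> y \<in> OL \<Longrightarrow> x + y \<in> OL" and OL_uminus: "x \<in> OL \<Longrightarrow> - x \<in> OL"
  and OL_mult: "x \<in> OL \<Longrightarrow> y \<in> OL \<Longrightarrow> x * y \<in> OL" and OL_bar: "x \<in> OL \<Longrightarrow> bar x \<in> OL"
  and OL_j: "j a \<in> OL \<longleftrightarrow> val_ge vK 0 a"
proof -
  have one: "val_ge vK 0 1" using K.val_ge_of_nat[of 1] by simp
  show "0 \<in> OL" "1 \<in> OL" "\<delta> \<in> OL" "x \<in> OL \<Longrightarrow> y \<in> OL \<Longrightarrow> x + y \<in> OL" "x \<in> OL \<Longrightarrow> - x \<in> OL"
    "x \<in> OL \<Longrightarrow> bar x \<in> OL" "j a \<in> OL \<longleftrightarrow> val_ge vK 0 a"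
    using one by (auto simp: OL_def intro: K.val_ge_add)
  assume "x \<in> OL" "y \<in> OL"
  then show "x * y \<in> OL"
    by (auto simp: OL_def \<pi>_integral intro!: K.val_ge_add K.val_ge_mult_left)
qed

lemma PL_one: "1 \<notin> PL"
  and PL_add: "x \<in> PL \<Longrightarrow> y \<in> PL \<Longrightarrow> x + y \<in> PL"
  and PL_mult: "x \<in> OL \<Longrightarrow> y \<in> PL \<Longrightarrow> x * y \<in> PL"
  and PL_j: "j a \<in> PL \<longleftrightarrow> val_ge vK 1 a"
  and bar_diff: "x \<in> OL \<Longrightarrow> bar x - x \<in> PL"
proof -
  show "1 \<notin> PL" by (simp add: PL_def val_ge_def)
  show "x \<in> PL \<Longrightarrow> y \<in> PL \<Longrightarrow> x + y \<in> PL" "j a \<in> PL \<longleftrightarrow> val_ge vK 1 a"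
    by (auto simp: PL_def intro: K.val_ge_add)
  \<comment> \<open>The difference is - 2 \<delta> \<open>im x\<close>: its real part vanishes. This
    is the triviality of \<open>bar\<close> on the residue field.\<close>
  show "x \<in> OL \<Longrightarrow> bar x - x \<in> PL"
    using K.val_ge_mult_left[of 2 0 "im x"] two_K by (auto simp: PL_def OL_def val_ge_def[of _ _ 2])
  assume *: "x \<in> OL" "y \<in> PL"
  then have "val_ge vK (0 + 1) (\<pi> * (im x * im y))"
    by (intro val_ge_\<pi> K.val_ge_mult_left) (auto simp: OL_def PL_def)
  then show "x * y \<in> PL"
    using * by (auto simp: PL_def OL_def intro!: K.val_ge_add K.val_ge_mult_left intro: K.val_ge_trans)
qed

text \<open>The inverse is the conjugate divided by the norm, and the norm is a unit: it is the
  square of the unit \<open>re x\<close> minus a multiple of \<pi>.\<close>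

lemma OL_unit:
  assumes "x \<in> OL" "x \<notin> PL"
  shows "inverse x \<in> OL"
proof -
  have re: "re x \<noteq> 0" "vK (re x) = 0" and im: "val_ge vK 0 (im x)"
    using assms by (auto simp: OL_def PL_def val_ge_def)
  let ?n = "re x * re x + - (\<pi> * (im x * im x))"
  have "val_ge vK (0 + 1) (\<pi> * (im x * im x))"
    using im by (intro val_ge_\<pi> K.val_ge_mult_left)
  then have n: "?n \<noteq> 0" "vK ?n = vK (re x * re x)"
    by (intro K.val_add_eq; use re in \<open>simp add: K.val_mult\<close>)+
  then have vn: "vK ?n = 0" using re by (simp add: K.val_mult)
  have *: "j ?n = x * bar x" by (rule re_im_eqI) simp_all
  moreover have "x \<noteq> 0" using re by auto
  moreover have "bar x \<noteq> 0" using \<open>x \<noteq> 0\<close> bar_simps(4,7) by metis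
  ultimately have "inverse x = bar x * j (inverse ?n)"
    unfolding j_simps(8) * by (simp add: field_simps)
  moreover have "val_ge vK 0 (inverse ?n)" using n(1) vn by (simp add: val_ge_def K.val_inverse)
  then have "bar x * j (inverse ?n) \<in> OL"
    using assms(1) by (intro OL_mult OL_bar) (simp_all add: OL_j)
  ultimately show ?thesis by simp
qed

text \<open>Factor out the dominating coordinate: x = y (1 + \<delta> c) with c integral, where the
  second factor is a unit. For y of the form \<open>j a\<close> or \<open>\<delta> * j a\<close> the
  claim can be read off the valuation of a.\<close>

lemma OL_valuation_ring:
  assumes "x \<notin> OL"
  shows "inverse x \<in> OL"
proof -
  have unit: "1 + \<delta> * j c \<in> OL" "inverse (1 + \<delta> * j c) \<in> OL" if "val_ge vK 0 c" for c
  proof -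
    show *: "1 + \<delta> * j c \<in> OL" using that by (intro OL_add OL_mult OL_1 OL_\<delta>) (simp add: OL_j)
    have "1 + \<delta> * j c \<notin> PL" by (simp add: PL_def val_ge_def)
    with * show "inverse (1 + \<delta> * j c) \<in> OL" by (rule OL_unit)
  qed
  have *: "inverse x \<in> OL" if "x = y * (1 + \<delta> * j c)" "val_ge vK 0 c" "y \<in> OL \<or> inverse y \<in> OL" for y c
  proof -
    have "inverse y \<in> OL" using that assms unit[of c] OL_mult by metis
    then show ?thesis using that unit[of c] by (simp add: OL_mult)
  qed
  have jj: "j a \<in> OL \<or> inverse (j a) \<in> OL" for a
    by (cases "a = 0")
      (auto simp: OL_j OL_0 val_ge_def K.val_inverse simp flip: j_simps(8))
  show ?thesis
  proof (cases "re x \<noteq> 0 \<and> (im x = 0 \<or> vK (re x) \<le> vK (im x))")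
    case True
    show ?thesis
    proof (rule *[of "j (re x)" "im x / re x"])
      show "x = j (re x) * (1 + \<delta> * j (im x / re x))"
        using True by (intro re_im_eqI) simp_all
      show "val_ge vK 0 (im x / re x)" using True by (auto simp: val_ge_def K.val_divide)
    qed (rule jj)
  next
    case False
    then have im: "im x \<noteq> 0" using assms re_im_eqI[of x 0] OL_0 by auto
    show ?thesis
    \<comment> \<open>In this case \<open>re x\<close> is zero or has strictly larger valuation than
      \<open>im x\<close>; the gap of at least 1 pays for the division by \<pi>.\<close>
    proof (rule *[of "\<delta> * j (im x)" "re x / (\<pi> * im x)"])
      show "x = \<delta> * j (im x) * (1 + \<delta> * j (re x / (\<pi> * im x)))"
        using im \<pi>_nonzero by (intro re_im_eqI) simp_all
      show "val_ge vK 0 (re x / (\<pi> * im x))"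
        using False im \<pi>_nonzero vK_\<pi> by (auto simp: val_ge_def K.val_divide K.val_mult)
      show "\<delta> * j (im x) \<in> OL \<or> inverse (\<delta> * j (im x)) \<in> OL"
      proof (cases "0 \<le> vK (im x)")
        case True
        then have "\<delta> * j (im x) \<in> OL" by (intro OL_mult OL_\<delta>) (simp add: OL_j val_ge_def)
        then show ?thesis ..
      next
        case False
        have "inverse (\<delta> * j (im x)) = \<delta> * j (inverse (\<pi> * im x))"
          using im \<delta>_nonzero
          by (simp add: j_simps \<delta>_square[symmetric] field_simps)
        moreover have "\<delta> * j (inverse (\<pi> * im x)) \<in> OL"
          using False im \<pi>_nonzero vK_\<pi>
          by (intro OL_mult OL_\<delta>) (simp add: OL_j val_ge_def K.val_mult K.val_inverse)
        ultimately show ?thesis by simp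
      qed
    qed
  qed
qed

lemma of_nat_PL: "\<not> l dvd n \<Longrightarrow> of_nat n \<notin> PL"
  using vK_of_nat[of n] PL_j[of "of_nat n"] by (simp add: j_simps val_ge_def)

end

section \<open>Tensor products\<close>

locale tensor_product =
  fixes R :: "('a, 'r) ring_scheme" and M :: "('a, 'b) module" and N :: "('a, 'c) module"
  assumes module_M: "module R M" and module_N: "module R N"
begin

sublocale M: module R M by (rule module_M)
sublocale N: module R N by (rule module_N)

abbreviation "S \<equiv> carrier M \<times> carrier N"
abbreviation "F \<equiv> tensor_free M N"
abbreviation "Rel \<equiv> tensor_relations R M N"
abbreviation "T \<equiv> tensor R M N"
abbreviation "supp c \<equiv> Poly_Mapping.keys c \<subseteq> S"
abbreviation "cls c \<equiv> Rel #>\<^bsub>F\<^esub> c"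
abbreviation "pt \<equiv> pure_tensor R M N"

definition "relators =
     {frag_of (x \<oplus>\<^bsub>M\<^esub> x', y) - frag_of (x, y) - frag_of (x', y) | x x' y.
         x \<in> carrier M \<and> x' \<in> carrier M \<and> y \<in> carrier N} \<union>
      {frag_of (x, y \<oplus>\<^bsub>N\<^esub> y') - frag_of (x, y) - frag_of (x, y') | x y y'.
         x \<in> carrier M \<and> y \<in> carrier N \<and> y' \<in> carrier N} \<union>
      {frag_of (r \<odot>\<^bsub>M\<^esub> x, y) - frag_of (x, r \<odot>\<^bsub>N\<^esub> y) | r x y.
         r \<in> carrier R \<and> x \<in> carrier M \<and> y \<in> carrier N}"

lemma Rel_eq: "Rel = generate F relators"
  by (simp add: tensor_relations_def relators_def)

interpretation FG: comm_group F by (rule abelian_free_Abelian_group)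

lemma keys_diff_subset: "Poly_Mapping.keys a \<subseteq> A \<Longrightarrow> Poly_Mapping.keys b \<subseteq> A \<Longrightarrow> Poly_Mapping.keys (a - b) \<subseteq> A"
  using keys_diff[of a b] by blast

lemma keys_add_subset: "Poly_Mapping.keys a \<subseteq> A \<Longrightarrow> Poly_Mapping.keys b \<subseteq> A \<Longrightarrow> Poly_Mapping.keys (a + b) \<subseteq> A"
  using Poly_Mapping.keys_add[of a b] by blast

lemma relators_carrier: "relators \<subseteq> carrier F"
proof
  fix c assume "c \<in> relators"
  then show "c \<in> carrier F"
    unfolding relators_def carrier_free_Abelian_group_iff
    by (elim UnE CollectE exE conjE) (simp_all add: keys_diff_subset)
qed

lemma subgroup_Rel: "subgroup Rel F"
  unfolding Rel_eq by (rule FG.generate_is_subgroup[OF relators_carrier])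

lemma Rel_minimal: "subgroup H F \<Longrightarrow> relators \<subseteq> H \<Longrightarrow> Rel \<subseteq> H"
  unfolding Rel_eq by (rule FG.generate_subgroup_incl)

lemma Rel_simps:
  "0 \<in> Rel" "c \<in> Rel \<Longrightarrow> supp c"
  "c \<in> Rel \<Longrightarrow> d \<in> Rel \<Longrightarrow> c + d \<in> Rel" "c \<in> Rel \<Longrightarrow> - c \<in> Rel"
proof -
  interpret subgroup Rel F by (rule subgroup_Rel)
  show 1: "c \<in> Rel \<Longrightarrow> supp c" using mem_carrier by simp
  show "0 \<in> Rel" using one_closed by simp
  show "c \<in> Rel \<Longrightarrow> d \<in> Rel \<Longrightarrow> c + d \<in> Rel" using m_closed[of c d] by simp
  show "c \<in> Rel \<Longrightarrow> - c \<in> Rel" using m_inv_closed[of c] 1 by simp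
qed

lemma cls_eq: "cls c = {r + c | r. r \<in> Rel}"
  by (auto simp: r_coset_def)

lemma cls_eqI: "c - d \<in> Rel \<Longrightarrow> cls c = cls d"
proof -
  have sub: "{r + c | r. r \<in> Rel} \<subseteq> {r + d | r. r \<in> Rel}" if *: "c - d \<in> Rel" for c d
  proof clarsimp
    fix r assume "r \<in> Rel"
    then have "r + (c - d) \<in> Rel" using * by (rule Rel_simps)
    then show "\<exists>r'. r + c = r' + d \<and> r' \<in> Rel" by (intro exI[of _ "r + (c - d)"]) simp
  qed
  assume "c - d \<in> Rel"
  then show ?thesis using sub[of c d] sub[of d c] Rel_simps(4)[of "c - d"] by (simp add: cls_eq)
qed

lemma carrier_T: "carrier T = {cls c | c. supp c}"
  by (auto simp: tensor_def FactGroup_def RCOSETS_def)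

lemma cls_carrier: "supp c \<Longrightarrow> cls c \<in> carrier T"
  by (auto simp: carrier_T)

lemma zero_T: "\<zero>\<^bsub>T\<^esub> = cls 0"
  by (simp add: tensor_def FactGroup_def cls_eq)

lemma add_cls:
  assumes "supp c" "supp d"
  shows "cls c \<oplus>\<^bsub>T\<^esub> cls d = cls (c + d)"
proof -
  interpret normal Rel F by (rule FG.subgroup_imp_normal[OF subgroup_Rel])
  show ?thesis using rcos_sum[of c d] assms by (simp add: tensor_def FactGroup_def)
qed

lemma abelian_group_T: "abelian_group T"
proof (rule abelian_groupI)
  fix x assume "x \<in> carrier T"
  then obtain c where c: "x = cls c" "supp c" by (auto simp: carrier_T)
  then show "\<exists>y\<in>carrier T. y \<oplus>\<^bsub>T\<^esub> x = \<zero>\<^bsub>T\<^esub>"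
    by (intro bexI[of _ "cls (- c)"]) (simp_all add: add_cls zero_T cls_carrier)
next
  fix x y assume "x \<in> carrier T" "y \<in> carrier T"
  then obtain c d where c: "x = cls c" "supp c" and d: "y = cls d" "supp d"
    by (auto simp: carrier_T)
  show "x \<oplus>\<^bsub>T\<^esub> y = y \<oplus>\<^bsub>T\<^esub> x" using c d by (simp add: add_cls add.commute)
  show "x \<oplus>\<^bsub>T\<^esub> y \<in> carrier T" using c d by (simp add: add_cls cls_carrier keys_add_subset)
  fix z assume "z \<in> carrier T"
  then obtain e where "z = cls e" "supp e" by (auto simp: carrier_T)
  with c d show "x \<oplus>\<^bsub>T\<^esub> y \<oplus>\<^bsub>T\<^esub> z = x \<oplus>\<^bsub>T\<^esub> (y \<oplus>\<^bsub>T\<^esub> z)"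
    by (simp add: add_cls add.assoc keys_add_subset)
qed (auto simp: carrier_T zero_T add_cls cls_carrier)

sublocale T: abelian_group T by (rule abelian_group_T)

lemma pt_eq: "pt x y = cls (frag_of (x, y))"
  by (simp add: pure_tensor_def)

lemma pt_closed [simp]: "x \<in> carrier M \<Longrightarrow> y \<in> carrier N \<Longrightarrow> pt x y \<in> carrier T"
  by (simp add: pt_eq cls_carrier)

lemma relators_Rel: "relators \<subseteq> Rel"
  unfolding Rel_eq by (auto intro: generate.incl)

lemma pt_add_left:
  assumes "x \<in> carrier M" "x' \<in> carrier M" "y \<in> carrier N"
  shows "pt (x \<oplus>\<^bsub>M\<^esub> x') y = pt x y \<oplus>\<^bsub>T\<^esub> pt x' y"
proof -
  have "frag_of (x \<oplus>\<^bsub>M\<^esub> x', y) - (frag_of (x, y) + frag_of (x', y)) \<in> Rel"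
    using relators_Rel assms unfolding relators_def diff_diff_add[symmetric] by blast
  then show ?thesis using assms by (simp add: pt_eq add_cls cls_eqI)
qed

lemma pt_add_right:
  assumes "x \<in> carrier M" "y \<in> carrier N" "y' \<in> carrier N"
  shows "pt x (y \<oplus>\<^bsub>N\<^esub> y') = pt x y \<oplus>\<^bsub>T\<^esub> pt x y'"
proof -
  have "frag_of (x, y \<oplus>\<^bsub>N\<^esub> y') - (frag_of (x, y) + frag_of (x, y')) \<in> Rel"
    using relators_Rel assms unfolding relators_def diff_diff_add[symmetric] by blast
  then show ?thesis using assms by (simp add: pt_eq add_cls cls_eqI)
qed

lemma pt_balanced:
  assumes "r \<in> carrier R" "x \<in> carrier M" "y \<in> carrier N"
  shows "pt (r \<odot>\<^bsub>M\<^esub> x) y = pt x (r \<odot>\<^bsub>N\<^esub> y)"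
proof -
  have "frag_of (r \<odot>\<^bsub>M\<^esub> x, y) - frag_of (x, r \<odot>\<^bsub>N\<^esub> y) \<in> Rel"
    using relators_Rel assms unfolding relators_def by blast
  then show ?thesis by (simp add: pt_eq cls_eqI)
qed

lemma pt_zero_left: "y \<in> carrier N \<Longrightarrow> pt \<zero>\<^bsub>M\<^esub> y = \<zero>\<^bsub>T\<^esub>"
  using pt_add_left[of "\<zero>\<^bsub>M\<^esub>" "\<zero>\<^bsub>M\<^esub>" y] T.add.l_cancel_one by auto

lemma pt_zero_right: "x \<in> carrier M \<Longrightarrow> pt x \<zero>\<^bsub>N\<^esub> = \<zero>\<^bsub>T\<^esub>"
  using pt_add_right[of x "\<zero>\<^bsub>N\<^esub>" "\<zero>\<^bsub>N\<^esub>"] T.add.l_cancel_one by auto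

lemma pt_minus_left:
  assumes "x \<in> carrier M" "y \<in> carrier N"
  shows "pt (\<ominus>\<^bsub>M\<^esub> x) y = cls (- frag_of (x, y))"
proof -
  have "pt (\<ominus>\<^bsub>M\<^esub> x) y \<oplus>\<^bsub>T\<^esub> pt x y = \<zero>\<^bsub>T\<^esub>"
    using assms by (simp add: pt_add_left[symmetric] M.M.l_neg pt_zero_left)
  moreover have "cls (- frag_of (x, y)) \<oplus>\<^bsub>T\<^esub> pt x y = \<zero>\<^bsub>T\<^esub>"
    using assms by (simp add: pt_eq add_cls zero_T)
  ultimately show ?thesis
    using assms by (metis M.M.a_inv_closed T.add.inv_equality pt_closed cls_carrier keys_minus pt_eq
        carrier_free_Abelian_group_iff frag_of_in_free_Abelian_group mem_Sigma_iff)
qed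

text \<open>Sums suffice, without differences, because the negative of a pure tensor is again a pure
  tensor.\<close>

lemma tensor_induct [consumes 1, case_names pure add]:
  assumes u: "u \<in> carrier T"
    and pure: "\<And>x y. x \<in> carrier M \<Longrightarrow> y \<in> carrier N \<Longrightarrow> P (pt x y)"
    and add: "\<And>u v. u \<in> carrier T \<Longrightarrow> v \<in> carrier T \<Longrightarrow> P u \<Longrightarrow> P v \<Longrightarrow> P (u \<oplus>\<^bsub>T\<^esub> v)"
  shows "P u"
proof -
  obtain c where c: "u = cls c" "supp c" using u by (auto simp: carrier_T)
  \<comment> \<open>Induction in the free abelian group proceeds by differences, so the claim is
    carried for a representative and its negative together.\<close>
  have "P (cls c) \<and> P (cls (- c))"
    using c(2)
  proof (induction c rule: free_Abelian_group_induct [consumes 1, case_names zero diff one])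
    case zero
    have "P (pt \<zero>\<^bsub>M\<^esub> \<zero>\<^bsub>N\<^esub>)" by (rule pure) auto
    then show ?case by (simp add: pt_zero_left zero_T)
  next
    case (diff x y)
    have "cls (x - y) = cls x \<oplus>\<^bsub>T\<^esub> cls (- y)" "cls (- (x - y)) = cls (- x) \<oplus>\<^bsub>T\<^esub> cls y"
      using diff(1,2) by (simp_all add: add_cls)
    then show ?case using diff by (simp add: add cls_carrier)
  next
    case (one a)
    then obtain x y where a: "a = (x, y)" "x \<in> carrier M" "y \<in> carrier N" by auto
    have "P (pt x y)" "P (pt (\<ominus>\<^bsub>M\<^esub> x) y)" using a by (auto intro: pure)
    then show ?case using a by (simp add: pt_minus_left pt_eq[symmetric])
  qed
  then show ?thesis using c by simp
qed

text \<open>The universal property. The induced map on the free abelian group kills the three kinds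
  of relators, hence the subgroup that they generate.\<close>

lemma tensor_lift:
  fixes A :: "('d, 'e) ring_scheme"
  assumes "abelian_group A"
    and closed: "\<And>x y. x \<in> carrier M \<Longrightarrow> y \<in> carrier N \<Longrightarrow> \<beta> x y \<in> carrier A"
    and addl: "\<And>x x' y. x \<in> carrier M \<Longrightarrow> x' \<in> carrier M \<Longrightarrow> y \<in> carrier N \<Longrightarrow>
      \<beta> (x \<oplus>\<^bsub>M\<^esub> x') y = \<beta> x y \<oplus>\<^bsub>A\<^esub> \<beta> x' y"
    and addr: "\<And>x y y'. x \<in> carrier M \<Longrightarrow> y \<in> carrier N \<Longrightarrow> y' \<in> carrier N \<Longrightarrow>
      \<beta> x (y \<oplus>\<^bsub>N\<^esub> y') = \<beta> x y \<oplus>\<^bsub>A\<^esub> \<beta> x y'"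
    and bal: "\<And>r x y. r \<in> carrier R \<Longrightarrow> x \<in> carrier M \<Longrightarrow> y \<in> carrier N \<Longrightarrow>
      \<beta> (r \<odot>\<^bsub>M\<^esub> x) y = \<beta> x (r \<odot>\<^bsub>N\<^esub> y)"
  obtains H where "H \<in> carrier T \<rightarrow> carrier A"
    and "\<And>u v. u \<in> carrier T \<Longrightarrow> v \<in> carrier T \<Longrightarrow> H (u \<oplus>\<^bsub>T\<^esub> v) = H u \<oplus>\<^bsub>A\<^esub> H v"
    and "\<And>x y. x \<in> carrier M \<Longrightarrow> y \<in> carrier N \<Longrightarrow> H (pt x y) = \<beta> x y"
proof -
  interpret A: abelian_group A by fact
  have "(\<lambda>(x, y). \<beta> x y) ` S \<subseteq> carrier (add_monoid A)" using closed by auto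
  from A.a_comm_group[THEN comm_group.free_Abelian_group_universal, OF this]
  obtain h where h: "h \<in> hom F (add_monoid A)"
    and hf: "\<And>p. p \<in> S \<Longrightarrow> h (frag_of p) = (\<lambda>(x, y). \<beta> x y) p" by auto
  interpret h: group_hom F "add_monoid A" h
    by unfold_locales (rule h)
  have hfrag: "h (frag_of (x, y)) = \<beta> x y" if "x \<in> carrier M" "y \<in> carrier N" for x y
    using hf[of "(x, y)"] that by simp
  have hadd: "h (c + d) = h c \<oplus>\<^bsub>A\<^esub> h d" if "supp c" "supp d" for c d
    using h.hom_mult[of c d] that by simp
  have hdiff: "h (c - d) = h c \<ominus>\<^bsub>A\<^esub> h d" if "supp c" "supp d" for c d
    using hadd[of c "- d"] h.hom_inv[of d] that by (simp add: a_minus_def a_inv_def)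
  have hclosed: "h c \<in> carrier A" if "supp c" for c
    using h.hom_closed[of c] that by simp
  have "a \<ominus>\<^bsub>A\<^esub> a = \<zero>\<^bsub>A\<^esub>" if "a \<in> carrier A" for a
    using that by (simp add: a_minus_def A.r_neg)
  moreover have "(a \<oplus>\<^bsub>A\<^esub> b) \<ominus>\<^bsub>A\<^esub> a \<ominus>\<^bsub>A\<^esub> b = \<zero>\<^bsub>A\<^esub>"
    if "a \<in> carrier A" "b \<in> carrier A" for a b
    using that by (simp add: a_minus_def A.a_comm[of a b] A.a_assoc A.r_neg A.r_neg2)
  note cancel = calculation this
  have "Rel \<subseteq> kernel F (add_monoid A) h"
  proof (rule Rel_minimal)
    show "subgroup (kernel F (add_monoid A) h) F" by (rule h.subgroup_kernel)
    show "relators \<subseteq> kernel F (add_monoid A) h"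
    proof
      fix c assume c: "c \<in> relators"
      then have "c \<in> carrier F" using relators_carrier by blast
      moreover have "h c = \<zero>\<^bsub>A\<^esub>"
        using c unfolding relators_def
        by (elim UnE CollectE exE conjE)
          (simp_all add: hdiff hfrag keys_diff_subset addl addr bal closed cancel)
      ultimately show "c \<in> kernel F (add_monoid A) h" by (simp add: kernel_def)
    qed
  qed
  then have ker: "h c = \<zero>\<^bsub>A\<^esub>" if "c \<in> Rel" for c using that by (auto simp: kernel_def)
  \<comment> \<open>The value does not depend on the chosen representative of the coset, since
    \<open>h\<close> vanishes on \<open>Rel\<close>.\<close>
  define H where "H u = h (SOME c. c \<in> u)" for u
  have H: "H (cls c) = h c" if c: "supp c" for c
  proof -
    have "(SOME d. d \<in> cls c) \<in> cls c"
      by (rule someI[of _ c]) (auto simp: cls_eq intro: Rel_simps exI[of _ 0])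
    then obtain r where "r \<in> Rel" "(SOME d. d \<in> cls c) = r + c" by (auto simp: cls_eq)
    then show ?thesis using c Rel_simps(2) by (simp add: H_def hadd ker hclosed)
  qed
  show ?thesis
  proof (rule that)
    show "H \<in> carrier T \<rightarrow> carrier A" by (auto simp: carrier_T H hclosed)
    show "H (u \<oplus>\<^bsub>T\<^esub> v) = H u \<oplus>\<^bsub>A\<^esub> H v" if "u \<in> carrier T" "v \<in> carrier T" for u v
      using that by (auto simp: carrier_T add_cls H hadd keys_add_subset)
    show "H (pt x y) = \<beta> x y" if "x \<in> carrier M" "y \<in> carrier N" for x y
      using that by (simp add: pt_eq H hfrag)
  qed
qed

context
  fixes f g
  assumes f: "f \<in> linear_maps R M M" and g: "g \<in> linear_maps R N N"
begin

interpretation f_g: group_hom F F "frag_extend (\<lambda>(x, y). frag_of (f x, g y))"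
proof unfold_locales
  let ?h = "frag_extend (\<lambda>(x, y). frag_of (f x, g y))"
  have "Poly_Mapping.keys (?h c) \<subseteq> S" if "supp c" for c
    using that f g by (intro order.trans[OF keys_frag_extend]) (auto simp: linear_maps_def Pi_iff)
  then show "?h \<in> hom F F" by (auto simp: hom_def frag_extend_add)
qed

text \<open>\<open>tensor_map\<close> takes the product of \<open>Rel\<close> with the image of a
  whole coset. The induced map sends relators to relators, hence \<open>Rel\<close> into itself, so
  this product is a single coset.\<close>

lemma tensor_map_cls:
  assumes c: "supp c"
  shows "tensor_map R M N f g (cls c) = cls (frag_extend (\<lambda>(x, y). frag_of (f x, g y)) c)"
proof -
  let ?h = "frag_extend (\<lambda>(x, y). frag_of (f x, g y))"
  have "Rel \<subseteq> {c \<in> carrier F. ?h c \<in> Rel}"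
  proof (rule Rel_minimal)
    show "subgroup {c \<in> carrier F. ?h c \<in> Rel} F"
      by (rule FG.subgroupI)
        (auto simp: Rel_simps frag_extend_minus frag_extend_add keys_add_subset intro!: exI[of _ 0])
    show "relators \<subseteq> {c \<in> carrier F. ?h c \<in> Rel}"
    proof
      fix c assume c: "c \<in> relators"
      then have "?h c \<in> relators"
        using f g unfolding relators_def linear_maps_def
        by (auto simp: frag_extend_diff Pi_iff) metis+
      then show "c \<in> {c \<in> carrier F. ?h c \<in> Rel}"
        using c relators_carrier relators_Rel by blast
    qed
  qed
  then have hRel: "?h r \<in> Rel" if "r \<in> Rel" for r using that by blast
  have "Rel <#>\<^bsub>F\<^esub> (?h ` cls c) = cls (?h c)"
  proof (rule equalityI)
    show "Rel <#>\<^bsub>F\<^esub> (?h ` cls c) \<subseteq> cls (?h c)"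
    proof
      fix w assume "w \<in> Rel <#>\<^bsub>F\<^esub> (?h ` cls c)"
      then obtain r r' where r: "r \<in> Rel" "r' \<in> Rel" and w: "w = r + ?h (r' + c)"
        by (auto simp: set_mult_def cls_eq)
      have "w = (r + ?h r') + ?h c" by (simp add: w frag_extend_add add.assoc)
      moreover have "r + ?h r' \<in> Rel" using r by (intro Rel_simps hRel)
      ultimately show "w \<in> cls (?h c)" unfolding cls_eq by blast
    qed
    show "cls (?h c) \<subseteq> Rel <#>\<^bsub>F\<^esub> (?h ` cls c)"
    proof
      fix w assume "w \<in> cls (?h c)"
      then obtain r where r: "r \<in> Rel" "w = r + ?h c" by (auto simp: cls_eq)
      moreover have "c \<in> cls c" using Rel_simps(1) by (force simp: cls_eq)
      ultimately show "w \<in> Rel <#>\<^bsub>F\<^esub> (?h ` cls c)"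
        unfolding set_mult_def by auto
    qed
  qed
  then show ?thesis by (simp add: tensor_map_def)
qed

lemma tensor_map_closed: "u \<in> carrier T \<Longrightarrow> tensor_map R M N f g u \<in> carrier T"
proof -
  assume "u \<in> carrier T"
  then obtain c where c: "u = cls c" "supp c" by (auto simp: carrier_T)
  then show ?thesis
    unfolding c(1) tensor_map_cls[OF c(2)] using f_g.hom_closed[of c] by (intro cls_carrier) simp
qed

lemma tensor_map_add:
  "u \<in> carrier T \<Longrightarrow> v \<in> carrier T \<Longrightarrow>
    tensor_map R M N f g (u \<oplus>\<^bsub>T\<^esub> v) = tensor_map R M N f g u \<oplus>\<^bsub>T\<^esub> tensor_map R M N f g v"
proof -
  assume "u \<in> carrier T" "v \<in> carrier T"
  then obtain c d where c: "u = cls c" "supp c" and d: "v = cls d" "supp d"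
    by (auto simp: carrier_T)
  then show ?thesis
    using f_g.hom_closed[of c] f_g.hom_closed[of d]
    by (simp add: tensor_map_cls add_cls keys_add_subset frag_extend_add)
qed

lemma tensor_map_pt:
  "x \<in> carrier M \<Longrightarrow> y \<in> carrier N \<Longrightarrow> tensor_map R M N f g (pt x y) = pt (f x) (g y)"
  by (simp add: pt_eq tensor_map_cls)

end

lemma smult_linear: "r \<in> carrier R \<Longrightarrow> (\<lambda>x. r \<odot>\<^bsub>M\<^esub> x) \<in> linear_maps R M M"
  by (auto simp: linear_maps_def M.smult_r_distr M.smult_assoc1[symmetric] M.R.m_comm)

lemma id_linear: "(\<lambda>x. x) \<in> linear_maps R M M" "(\<lambda>x. x) \<in> linear_maps R N N"
  by (auto simp: linear_maps_def)

lemma smult_T: "r \<odot>\<^bsub>T\<^esub> u = tensor_map R M N (\<lambda>x. r \<odot>\<^bsub>M\<^esub> x) (\<lambda>y. y) u"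
  by (simp add: tensor_def)

lemma smult_pt:
  "r \<in> carrier R \<Longrightarrow> x \<in> carrier M \<Longrightarrow> y \<in> carrier N \<Longrightarrow> r \<odot>\<^bsub>T\<^esub> pt x y = pt (r \<odot>\<^bsub>M\<^esub> x) y"
  by (simp add: smult_T tensor_map_pt[OF smult_linear id_linear(2)])

lemma module_T: "module R T"
proof (rule moduleI)
  note closed = tensor_map_closed[OF smult_linear id_linear(2), folded smult_T]
  note add = tensor_map_add[OF smult_linear id_linear(2), folded smult_T]
  show "cring R" "abelian_group T" by unfold_locales
  show "r \<odot>\<^bsub>T\<^esub> u \<in> carrier T" if "r \<in> carrier R" "u \<in> carrier T" for r u
    using closed that by simp
  show "r \<odot>\<^bsub>T\<^esub> (u \<oplus>\<^bsub>T\<^esub> v) = r \<odot>\<^bsub>T\<^esub> u \<oplus>\<^bsub>T\<^esub> r \<odot>\<^bsub>T\<^esub> v"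
    if "r \<in> carrier R" "u \<in> carrier T" "v \<in> carrier T" for r u v
    using add that by simp
  fix r u assume u: "u \<in> carrier T"
  show "\<one>\<^bsub>R\<^esub> \<odot>\<^bsub>T\<^esub> u = u"
    using u by (induction rule: tensor_induct) (simp_all add: add smult_pt)
  fix s assume rs: "r \<in> carrier R" "s \<in> carrier R"
  show "(r \<otimes>\<^bsub>R\<^esub> s) \<odot>\<^bsub>T\<^esub> u = r \<odot>\<^bsub>T\<^esub> (s \<odot>\<^bsub>T\<^esub> u)"
    using u by (induction rule: tensor_induct) (simp_all add: add closed rs smult_pt M.smult_assoc1)
  show "(r \<oplus>\<^bsub>R\<^esub> s) \<odot>\<^bsub>T\<^esub> u = r \<odot>\<^bsub>T\<^esub> u \<oplus>\<^bsub>T\<^esub> s \<odot>\<^bsub>T\<^esub> u"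
    using u
  proof (induction rule: tensor_induct)
    case (add u v)
    then show ?case
      using rs by (simp add: tensor_map_add[OF smult_linear id_linear(2), folded smult_T] closed
          T.a_ac)
  qed (use rs in \<open>simp add: smult_pt M.smult_l_distr pt_add_left\<close>)
qed

lemma tensor_map_linear:
  assumes f: "f \<in> linear_maps R M M" and g: "g \<in> linear_maps R N N"
  shows "tensor_map R M N f g \<in> linear_maps R T T"
proof -
  interpret MT: module R T by (rule module_T)
  note map = tensor_map_closed[OF f g] tensor_map_add[OF f g] tensor_map_pt[OF f g]
  have "tensor_map R M N f g (r \<odot>\<^bsub>T\<^esub> u) = r \<odot>\<^bsub>T\<^esub> tensor_map R M N f g u"
    if r: "r \<in> carrier R" and u: "u \<in> carrier T" for r u
    using u
  proof (induction rule: tensor_induct)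
    case (pure x y)
    then have "f x \<in> carrier M" "g y \<in> carrier N" "f (r \<odot>\<^bsub>M\<^esub> x) = r \<odot>\<^bsub>M\<^esub> f x"
      using f g r by (auto simp: linear_maps_def)
    then show ?case using pure r by (simp add: smult_pt map)
  next
    case (add u v)
    then show ?case using r by (simp add: MT.smult_r_distr map)
  qed
  then show ?thesis using map by (auto simp: linear_maps_def)
qed

end

section \<open>Extension of scalars and Schur's lemma\<close>

lemma ring_of_type_algebra_simps [simp]:
  "carrier ring_of_type_algebra = UNIV" "\<zero>\<^bsub>ring_of_type_algebra\<^esub> = 0" "\<one>\<^bsub>ring_of_type_algebra\<^esub> = 1"
  "x \<oplus>\<^bsub>ring_of_type_algebra\<^esub> y = x + y" "x \<otimes>\<^bsub>ring_of_type_algebra\<^esub> y = x * y"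
  by (simp_all add: ring_of_type_algebra_def)

lemma ext_module_simps [simp]:
  "carrier (ext_module h) = UNIV" "\<zero>\<^bsub>ext_module h\<^esub> = 0" "x \<oplus>\<^bsub>ext_module h\<^esub> y = x + y"
  "c \<odot>\<^bsub>ext_module h\<^esub> x = h c * x"
  by (simp_all add: ext_module_def)

lemma module_ext_module:
  fixes h :: "'a::field \<Rightarrow> 'b::field"
  assumes "field_hom h"
  shows "module ring_of_type_algebra (ext_module h)"
proof (rule moduleI)
  show "abelian_group (ext_module h)"
    by (rule abelian_groupI) (auto simp: algebra_simps intro!: exI[of _ "- x" for x])
  show "cring (ring_of_type_algebra :: 'a ring)" by (rule cring_from_type_algebra)
qed (use field_homD[OF assms] in \<open>auto simp: algebra_simps\<close>)

locale extended_scalars =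
  fixes h :: "'a::field \<Rightarrow> 'b::field" and M :: "('a, 'm) module"
  assumes hom: "field_hom h" and module_base: "module ring_of_type_algebra M"
begin

sublocale tensor_product "ring_of_type_algebra :: 'a ring" M "ext_module h"
  by (intro tensor_product.intro module_base module_ext_module hom)

lemmas h_simps = field_homD[OF hom]

lemma M_simps:
  "x \<in> carrier M \<Longrightarrow> (a + b) \<odot>\<^bsub>M\<^esub> x = a \<odot>\<^bsub>M\<^esub> x \<oplus>\<^bsub>M\<^esub> b \<odot>\<^bsub>M\<^esub> x"
  "x \<in> carrier M \<Longrightarrow> (a * b) \<odot>\<^bsub>M\<^esub> x = a \<odot>\<^bsub>M\<^esub> (b \<odot>\<^bsub>M\<^esub> x)"
  "x \<in> carrier M \<Longrightarrow> 1 \<odot>\<^bsub>M\<^esub> x = x"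
  "x \<in> carrier M \<Longrightarrow> 0 \<odot>\<^bsub>M\<^esub> x = \<zero>\<^bsub>M\<^esub>"
  using M.smult_l_distr[of a b x] M.smult_assoc1[of a b x] M.smult_one[of x] M.smult_l_null[of x]
  by simp_all

sublocale ext: vector_space "\<lambda>c y. h c * y"
  by unfold_locales (simp_all add: h_simps algebra_simps)

text \<open>The action of the extension field. It is kept apart from the record \<open>T\<close>,
  whose own scalars are those of the base field; \<open>scalar_extension_simps\<close> identifies it
  with the scalars of \<open>scalar_extension h M\<close>.\<close>

definition "sc c = tensor_map ring_of_type_algebra M (ext_module h) (\<lambda>x. x) (\<lambda>y. c * y)"

lemma mult_linear: "(\<lambda>y. c * y) \<in> linear_maps ring_of_type_algebra (ext_module h) (ext_module h)"
  by (auto simp: linear_maps_def algebra_simps)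

lemmas sc_closed = tensor_map_closed[OF id_linear(1) mult_linear, folded sc_def]
  and sc_add = tensor_map_add[OF id_linear(1) mult_linear, folded sc_def]
  and sc_pt = tensor_map_pt[OF id_linear(1) mult_linear, folded sc_def]

lemma sc_smult: "u \<in> carrier T \<Longrightarrow> sc (h a) u = a \<odot>\<^bsub>T\<^esub> u"
proof (induction rule: tensor_induct)
  case (pure x y)
  then show ?case using pt_balanced[of a x y] by (simp add: sc_pt smult_pt)
next
  interpret MT: module "ring_of_type_algebra :: 'a ring" T by (rule module_T)
  case (add u v)
  then show ?case by (simp add: sc_add MT.smult_r_distr)
qed

lemma sc_one: "u \<in> carrier T \<Longrightarrow> sc 1 u = u"
  by (induction rule: tensor_induct) (simp_all add: sc_pt sc_add)

lemma sc_mult: "u \<in> carrier T \<Longrightarrow> sc (c * d) u = sc c (sc d u)"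
  by (induction rule: tensor_induct) (simp_all add: sc_pt sc_add sc_closed mult.assoc)

lemma sc_add_left: "u \<in> carrier T \<Longrightarrow> sc (c + d) u = sc c u \<oplus>\<^bsub>T\<^esub> sc d u"
proof (induction rule: tensor_induct)
  case (pure x y)
  then show ?case using pt_add_right[of x "c * y" "d * y"] by (simp add: sc_pt algebra_simps)
next
  case (add u v)
  then show ?case by (simp add: sc_add sc_closed T.a_ac)
qed

lemma sc_zero_left: "u \<in> carrier T \<Longrightarrow> sc 0 u = \<zero>\<^bsub>T\<^esub>"
  using sc_add_left[of u 0 0] T.add.l_cancel_one sc_closed[of u 0] by auto

lemma sc_zero: "sc c \<zero>\<^bsub>T\<^esub> = \<zero>\<^bsub>T\<^esub>"
  using sc_add[of "\<zero>\<^bsub>T\<^esub>" "\<zero>\<^bsub>T\<^esub>" c] T.add.l_cancel_one sc_closed[of "\<zero>\<^bsub>T\<^esub>" c] by auto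

text \<open>The map id \<otimes> \<theta>. It brings identities between tensors back to M without a
  basis of M.\<close>

lemma contraction:
  assumes "Vector_Spaces.linear (\<lambda>c y. h c * y) (*) \<theta>"
  obtains C where "C \<in> carrier T \<rightarrow> carrier M"
    and "\<And>u v. u \<in> carrier T \<Longrightarrow> v \<in> carrier T \<Longrightarrow> C (u \<oplus>\<^bsub>T\<^esub> v) = C u \<oplus>\<^bsub>M\<^esub> C v"
    and "\<And>x y. x \<in> carrier M \<Longrightarrow> C (pt x y) = \<theta> y \<odot>\<^bsub>M\<^esub> x"
proof -
  interpret \<theta>: Vector_Spaces.linear "\<lambda>c y. h c * y" "(*)" \<theta> by fact
  obtain C where "C \<in> carrier T \<rightarrow> carrier M"
    and "\<And>u v. u \<in> carrier T \<Longrightarrow> v \<in> carrier T \<Longrightarrow> C (u \<oplus>\<^bsub>T\<^esub> v) = C u \<oplus>\<^bsub>M\<^esub> C v"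
    and "\<And>x y. x \<in> carrier M \<Longrightarrow> y \<in> carrier (ext_module h) \<Longrightarrow> C (pt x y) = \<theta> y \<odot>\<^bsub>M\<^esub> x"
  proof (rule tensor_lift[of M "\<lambda>x y. \<theta> y \<odot>\<^bsub>M\<^esub> x"])
    show "\<theta> y \<odot>\<^bsub>M\<^esub> (r \<odot>\<^bsub>M\<^esub> x) = \<theta> (r \<odot>\<^bsub>ext_module h\<^esub> y) \<odot>\<^bsub>M\<^esub> x"
      if "x \<in> carrier M" for r x y
      using that by (simp add: \<theta>.scale mult.commute[of r] M_simps)
  qed (auto simp: M.smult_r_distr \<theta>.add M_simps M.M.abelian_group_axioms)
  then show ?thesis using that by simp
qed

lemma ex_functional:
  assumes "\<not> ext.dependent B"
  obtains \<theta> where "Vector_Spaces.linear (\<lambda>c y. h c * y) (*) \<theta>" "\<And>b. b \<in> B \<Longrightarrow> \<theta> b = f b"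
proof -
  interpret vector_space "(*) :: 'a \<Rightarrow> 'a \<Rightarrow> 'a" by unfold_locales (simp_all add: algebra_simps)
  interpret vector_space_pair "\<lambda>c y. h c * y" "(*) :: 'a \<Rightarrow> 'a \<Rightarrow> 'a" by unfold_locales
  show ?thesis using linear_independent_extend[OF assms, of f] that by auto
qed

lemma independent_one: "\<not> ext.dependent {1}"
  by simp

lemma independent_one_insert: "c \<notin> range h \<Longrightarrow> \<not> ext.dependent {1, c}"
  using independent_one by (subst insert_commute, subst ext.independent_insert)
    (auto simp: ext.span_breakdown_eq image_iff eq_neg_iff_add_eq_0)

text \<open>If c were outside the base field, 1 and c would be independent, and contracting with a
  functional that is 0 at 1 and 1 at c would give w = 0. This is how an eigenvalue descends from the
  algebraic closure.\<close>

lemma pt_one_eqD: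
  assumes eq: "pt x 1 = pt w c" and x: "x \<in> carrier M" and w: "w \<in> carrier M" "w \<noteq> \<zero>\<^bsub>M\<^esub>"
  shows "\<exists>a. c = h a \<and> x = a \<odot>\<^bsub>M\<^esub> w"
proof -
  have "c \<in> range h"
  proof (rule ccontr)
    assume c: "c \<notin> range h"
    then have "c \<noteq> 1" using h_simps(3) by (metis rangeI)
    obtain \<theta> where \<theta>: "Vector_Spaces.linear (\<lambda>c y. h c * y) (*) \<theta>"
      "\<And>b. b \<in> {1, c} \<Longrightarrow> \<theta> b = (if b = c then 1 else 0)"
      using ex_functional[OF independent_one_insert[OF c], of "\<lambda>b. if b = c then 1 else 0"] by metis
    obtain C where "\<And>x y. x \<in> carrier M \<Longrightarrow> C (pt x y) = \<theta> y \<odot>\<^bsub>M\<^esub> x"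
      using contraction[OF \<theta>(1)] by metis
    then have "\<theta> 1 \<odot>\<^bsub>M\<^esub> x = \<theta> c \<odot>\<^bsub>M\<^esub> w" using eq x w by metis
    moreover have "\<theta> 1 = 0" "\<theta> c = 1" using \<theta>(2)[of 1] \<theta>(2)[of c] \<open>c \<noteq> 1\<close> by auto
    ultimately show False using x w M_simps by simp
  qed
  then obtain a where a: "c = h a" by auto
  obtain \<theta> where \<theta>: "Vector_Spaces.linear (\<lambda>c y. h c * y) (*) \<theta>" "\<theta> 1 = 1"
    using ex_functional[OF independent_one, of "\<lambda>b. 1"] by (metis singletonI)
  interpret \<theta>: Vector_Spaces.linear "\<lambda>c y. h c * y" "(*)" \<theta> by fact
  obtain C where "\<And>x y. x \<in> carrier M \<Longrightarrow> C (pt x y) = \<theta> y \<odot>\<^bsub>M\<^esub> x"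
    using contraction[OF \<theta>(1)] by metis
  then have "\<theta> 1 \<odot>\<^bsub>M\<^esub> x = \<theta> c \<odot>\<^bsub>M\<^esub> w" using eq x w by metis
  moreover have "\<theta> c = a" using \<theta>.scale[of a 1] \<theta>(2) a by simp
  ultimately have "x = a \<odot>\<^bsub>M\<^esub> w" using x \<theta>(2) M_simps by simp
  then show ?thesis using a by auto
qed

lemma scalar_extension_simps:
  "carrier (scalar_extension h M) = carrier T" "\<zero>\<^bsub>scalar_extension h M\<^esub> = \<zero>\<^bsub>T\<^esub>"
  "u \<oplus>\<^bsub>scalar_extension h M\<^esub> v = u \<oplus>\<^bsub>T\<^esub> v" "c \<odot>\<^bsub>scalar_extension h M\<^esub> u = sc c u"
  by (simp_all add: scalar_extension_def Let_def sc_def)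

lemma module_scalar_extension: "module ring_of_type_algebra (scalar_extension h M)"
proof (rule moduleI)
  show "abelian_group (scalar_extension h M)"
    using T.a_assoc T.a_comm T.add.l_inv_ex
    by (intro abelian_groupI) (auto simp: scalar_extension_simps)
  show "cring (ring_of_type_algebra :: 'b ring)" by (rule cring_from_type_algebra)
qed (simp_all add: scalar_extension_simps sc_closed sc_add sc_add_left sc_mult sc_one)

end

text \<open>Horner's scheme for q(\<Psi>) applied to a vector, the constant polynomial a being sent
  to \<open>emb a\<close>. Addition and zero are arguments because modules here are records and not
  types.\<close>

definition horner :: "('b \<Rightarrow> 'b \<Rightarrow> 'b) \<Rightarrow> 'b \<Rightarrow> ('a::zero \<Rightarrow> 'b) \<Rightarrow> ('b \<Rightarrow> 'b) \<Rightarrow> 'a poly \<Rightarrow> 'b" where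
  "horner pl z emb \<Psi> q = fold_coeffs (\<lambda>a u. pl (emb a) (\<Psi> u)) q z"

lemma horner_0 [simp]: "horner pl z emb \<Psi> 0 = z"
  by (simp add: horner_def)

lemma horner_pCons:
  assumes "pl (emb 0) (\<Psi> z) = z"
  shows "horner pl z emb \<Psi> (pCons a q) = pl (emb a) (\<Psi> (horner pl z emb \<Psi> q))"
  using assms by (cases "a = 0 \<and> q = 0") (auto simp: horner_def)

section \<open>Eigenvectors over the algebraic closure\<close>

locale schur =
  fixes N :: "'n monoid" and W :: "('k::field, 'w) module" and \<rho> :: "'n \<Rightarrow> 'w \<Rightarrow> 'w" and \<phi> :: "'w \<Rightarrow> 'w"
  assumes repr: "group_ring_module ring_of_type_algebra N W \<rho>"
    and abs_simple: "absolutely_simple N W \<rho>"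
    and \<phi>: "\<phi> \<in> linear_maps ring_of_type_algebra W W"
    and \<phi>_comm: "\<And>n x. n \<in> carrier N \<Longrightarrow> x \<in> carrier W \<Longrightarrow> \<phi> (\<rho> n x) = \<rho> n (\<phi> x)"
begin

sublocale extended_scalars "to_ac :: 'k \<Rightarrow> 'k alg_closure" W
proof (rule extended_scalars.intro)
  show "field_hom (to_ac :: 'k \<Rightarrow> 'k alg_closure)"
    by (auto simp: field_hom_def ring_hom_def)
  show "module ring_of_type_algebra W"
    using repr by (simp add: group_ring_module_def)
qed

abbreviation "\<Psi> \<equiv> tensor_map ring_of_type_algebra W (ext_module to_ac) \<phi> (\<lambda>y. y)"

lemmas \<Psi>_closed = tensor_map_closed[OF \<phi> id_linear(2)]
  and \<Psi>_add = tensor_map_add[OF \<phi> id_linear(2)]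
  and \<Psi>_pt = tensor_map_pt[OF \<phi> id_linear(2)]

lemma \<phi>_closed: "x \<in> carrier W \<Longrightarrow> \<phi> x \<in> carrier W"
  using \<phi> by (auto simp: linear_maps_def)

lemma \<phi>_simps: "x \<in> carrier W \<Longrightarrow> y \<in> carrier W \<Longrightarrow> \<phi> (x \<oplus>\<^bsub>W\<^esub> y) = \<phi> x \<oplus>\<^bsub>W\<^esub> \<phi> y"
  "x \<in> carrier W \<Longrightarrow> \<phi> (a \<odot>\<^bsub>W\<^esub> x) = a \<odot>\<^bsub>W\<^esub> \<phi> x" "\<phi> \<zero>\<^bsub>W\<^esub> = \<zero>\<^bsub>W\<^esub>"
proof -
  show *: "x \<in> carrier W \<Longrightarrow> y \<in> carrier W \<Longrightarrow> \<phi> (x \<oplus>\<^bsub>W\<^esub> y) = \<phi> x \<oplus>\<^bsub>W\<^esub> \<phi> y" for x y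
    using \<phi> by (auto simp: linear_maps_def)
  show "x \<in> carrier W \<Longrightarrow> \<phi> (a \<odot>\<^bsub>W\<^esub> x) = a \<odot>\<^bsub>W\<^esub> \<phi> x"
    using \<phi> by (auto simp: linear_maps_def)
  show "\<phi> \<zero>\<^bsub>W\<^esub> = \<zero>\<^bsub>W\<^esub>"
    using *[of "\<zero>\<^bsub>W\<^esub>" "\<zero>\<^bsub>W\<^esub>"] M.M.add.l_cancel_one \<phi>_closed[of "\<zero>\<^bsub>W\<^esub>"] by auto
qed

lemma \<Psi>_sc: "u \<in> carrier T \<Longrightarrow> \<Psi> (sc c u) = sc c (\<Psi> u)"
  by (induction rule: tensor_induct)
    (simp_all add: sc_pt \<Psi>_pt \<phi>_closed sc_add \<Psi>_add sc_closed \<Psi>_closed)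

lemma \<Psi>_zero: "\<Psi> \<zero>\<^bsub>T\<^esub> = \<zero>\<^bsub>T\<^esub>"
  using \<Psi>_add[of "\<zero>\<^bsub>T\<^esub>" "\<zero>\<^bsub>T\<^esub>"] T.add.l_cancel_one \<Psi>_closed[of "\<zero>\<^bsub>T\<^esub>"] by auto

context
  fixes w
  assumes w: "w \<in> carrier W" "w \<noteq> \<zero>\<^bsub>W\<^esub>"
begin

abbreviation "U \<equiv> horner (\<lambda>u v. u \<oplus>\<^bsub>T\<^esub> v) \<zero>\<^bsub>T\<^esub> (pt w) \<Psi>"
abbreviation "U0 \<equiv> horner (\<lambda>u v. u \<oplus>\<^bsub>W\<^esub> v) \<zero>\<^bsub>W\<^esub> (\<lambda>a. a \<odot>\<^bsub>W\<^esub> w) \<phi>"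

lemma U_pCons: "U (pCons a q) = pt w a \<oplus>\<^bsub>T\<^esub> \<Psi> (U q)"
  using w pt_zero_right[of w] by (intro horner_pCons) (simp add: \<Psi>_zero)

lemma U0_pCons: "U0 (pCons a q) = a \<odot>\<^bsub>W\<^esub> w \<oplus>\<^bsub>W\<^esub> \<phi> (U0 q)"
  using w M_simps(4)[of w] by (intro horner_pCons) (simp add: \<phi>_simps)

lemma U_closed: "U q \<in> carrier T"
  using w by (induction q) (simp_all add: U_pCons \<Psi>_closed)

lemma U0_closed: "U0 q \<in> carrier W"
  using w by (induction q) (simp_all add: U0_pCons \<phi>_closed)

lemma U_add: "U (p + q) = U p \<oplus>\<^bsub>T\<^esub> U q"
proof (induction p q rule: poly_induct2)
  case (pCons a p b q)
  have "pt w (a + b) = pt w a \<oplus>\<^bsub>T\<^esub> pt w b" using pt_add_right[of w a b] w by simp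
  then show ?case
    using w by (simp add: U_pCons pCons.IH \<Psi>_add U_closed \<Psi>_closed T.a_ac)
qed simp

lemma U_smult: "U (Polynomial.smult c q) = sc c (U q)"
  using w by (induction q) (simp_all add: U_pCons sc_zero sc_add sc_pt \<Psi>_closed U_closed \<Psi>_sc)

lemma U0_add: "U0 (p + q) = U0 p \<oplus>\<^bsub>W\<^esub> U0 q"
  using w by (induction p q rule: poly_induct2)
    (simp_all add: U0_pCons \<phi>_simps U0_closed \<phi>_closed M_simps M.M.a_ac)

lemma U0_smult: "U0 (Polynomial.smult c q) = c \<odot>\<^bsub>W\<^esub> U0 q"
  using w M.smult_r_null[of c] by (induction q)
    (simp_all add: U0_pCons \<phi>_simps U0_closed \<phi>_closed M_simps M.smult_r_distr)

lemma U_linear_factor: "U ([:- c, 1:] * q) = sc (- c) (U q) \<oplus>\<^bsub>T\<^esub> \<Psi> (U q)"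
proof -
  have "[:- c, 1:] * q = Polynomial.smult (- c) q + pCons 0 q" by simp
  moreover have "U (pCons 0 q) = \<Psi> (U q)"
    using w pt_zero_right[of w] by (simp add: U_pCons \<Psi>_closed U_closed)
  ultimately show ?thesis by (simp only: U_add U_smult)
qed

lemma U_map_poly: "U (map_poly to_ac p) = pt (U0 p) 1"
proof (induction p)
  case 0
  show ?case using pt_zero_left[of 1] by simp
next
  case (pCons a p)
  have "pt w (to_ac a) = pt (a \<odot>\<^bsub>W\<^esub> w) 1"
    using pt_balanced[of a w 1] w by simp
  then show ?case
    using pCons w
    by (simp add: map_poly_pCons U_pCons U0_pCons \<Psi>_pt U0_closed pt_add_left \<phi>_closed)
qed

lemma pt_nonzero: "a \<noteq> 0 \<Longrightarrow> pt w a \<noteq> \<zero>\<^bsub>T\<^esub>"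
proof
  assume a: "a \<noteq> 0" "pt w a = \<zero>\<^bsub>T\<^esub>"
  then have "pt w 1 = \<zero>\<^bsub>T\<^esub>" using sc_pt[of w a "inverse a"] w sc_zero[of "inverse a"] by simp
  then have "pt \<zero>\<^bsub>W\<^esub> 1 = pt w 1" using pt_zero_left[of 1] by simp
  from pt_one_eqD[OF this _ w] obtain b where b: "1 = to_ac b" "\<zero>\<^bsub>W\<^esub> = b \<odot>\<^bsub>W\<^esub> w" by blast
  have "b = 1" using b(1) by (metis to_ac_1 to_ac_eq_iff)
  then show False using w M_simps(3)[OF w(1)] b(2) by metis
qed

text \<open>Linear factors are split off \<open>P\<close> one at a time. As long as the cofactor
  still annihilates the vector it replaces \<open>P\<close>; once it does not, its value is an
  eigenvector for the root just removed. Nonzero constants annihilate nothing, so this must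
  happen.\<close>

lemma ex_eigenvector:
  "P \<noteq> 0 \<Longrightarrow> U P = \<zero>\<^bsub>T\<^esub> \<Longrightarrow> \<exists>c q. U q \<noteq> \<zero>\<^bsub>T\<^esub> \<and> \<Psi> (U q) = sc c (U q)"
proof (induction "degree P" arbitrary: P rule: less_induct)
  case less
  have "degree P \<noteq> 0"
  proof
    assume "degree P = 0"
    then obtain a where "P = [:a:]" by (auto elim: degree_eq_zeroE)
    moreover from this less.prems have "a \<noteq> 0" by auto
    ultimately show False
      using pt_nonzero[of a] less.prems w by (simp add: U_pCons \<Psi>_zero)
  qed
  then obtain c where "poly P c = 0" using alg_closed_imp_poly_has_root by blast
  then obtain q where q: "P = [:- c, 1:] * q" by (auto simp: poly_eq_0_iff_dvd elim: dvdE)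
  show ?case
  proof (cases "U q = \<zero>\<^bsub>T\<^esub>")
    case True
    have "q \<noteq> 0" using q less.prems by auto
    moreover from this have "degree q < degree P" unfolding q by (subst degree_mult_eq) auto
    ultimately show ?thesis using less.hyps True by blast
  next
    case False
    have 0: "sc (- c) (U q) \<oplus>\<^bsub>T\<^esub> \<Psi> (U q) = \<zero>\<^bsub>T\<^esub>"
      using less.prems unfolding q U_linear_factor by simp
    have "sc (- c) (U q) \<oplus>\<^bsub>T\<^esub> sc c (U q) = \<zero>\<^bsub>T\<^esub>"
      using sc_add_left[of "U q" "- c" c] sc_zero_left by (simp add: U_closed)
    then have "sc (- c) (U q) \<oplus>\<^bsub>T\<^esub> \<Psi> (U q) = sc (- c) (U q) \<oplus>\<^bsub>T\<^esub> sc c (U q)"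
      unfolding 0 by (rule sym)
    moreover have "sc (- c) (U q) \<in> carrier T" "sc c (U q) \<in> carrier T" "\<Psi> (U q) \<in> carrier T"
      by (simp_all add: sc_closed \<Psi>_closed U_closed)
    ultimately have "\<Psi> (U q) = sc c (U q)" using T.add.l_cancel by blast
    then show ?thesis using False by blast
  qed
qed

text \<open>The polynomial \<open>p\<close> with p(\<phi>) w = 0 yields an eigenvector over the
  algebraic closure. Its eigenspace is stable under \<open>N\<close>, hence everything by absolute
  simplicity, and comparing tensors x \<otimes> 1 puts the eigenvalue into the base field.\<close>

lemma schur_scalar:
  assumes p: "p \<noteq> 0" "U0 p = \<zero>\<^bsub>W\<^esub>"
  shows "\<exists>a. \<forall>x\<in>carrier W. \<phi> x = a \<odot>\<^bsub>W\<^esub> x"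
proof -
  let ?K = "ring_of_type_algebra :: 'k alg_closure ring"
  let ?E = "scalar_extension to_ac W"
  interpret E: module ?K ?E by (rule module_scalar_extension)
  have "map_poly to_ac p \<noteq> 0" using p(1) by (simp add: map_poly_eq_0_iff)
  moreover have "U (map_poly to_ac p) = \<zero>\<^bsub>T\<^esub>" using p(2) pt_zero_left by (simp add: U_map_poly)
  ultimately obtain c q where q: "U q \<noteq> \<zero>\<^bsub>T\<^esub>" "\<Psi> (U q) = sc c (U q)"
    using ex_eigenvector by blast
  let ?Z = "{u \<in> carrier T. \<Psi> u = sc c u}"
  have "submodule ?Z ?K ?E"
  proof (rule E.submoduleI)
    show "\<And>a. a \<in> ?Z \<Longrightarrow> \<ominus>\<^bsub>?E\<^esub> a \<in> ?Z"
    proof -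
      fix u assume u: "u \<in> ?Z"
      have "\<ominus>\<^bsub>?E\<^esub> u = sc (- 1) u"
      proof (rule E.M.minus_equality)
        show "sc (- 1) u \<oplus>\<^bsub>?E\<^esub> u = \<zero>\<^bsub>?E\<^esub>"
          using u sc_add_left[of u "- 1" 1] sc_zero_left[of u] sc_one[of u] by (simp add: scalar_extension_simps)
      qed (use u in \<open>simp_all add: scalar_extension_simps sc_closed\<close>)
      then show "\<ominus>\<^bsub>?E\<^esub> u \<in> ?Z"
        using u by (simp add: sc_closed \<Psi>_sc sc_mult[symmetric])
    qed
  qed (auto simp: scalar_extension_simps \<Psi>_zero sc_zero \<Psi>_add sc_add sc_closed \<Psi>_sc
      sc_mult[symmetric] mult.commute)
  moreover have "stable_under N (\<lambda>g. tensor_map ring_of_type_algebra W (ext_module to_ac) (\<rho> g) (\<lambda>y. y)) ?Z"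
  proof (unfold stable_under_def, intro ballI)
    fix n u assume n: "n \<in> carrier N" and u: "u \<in> ?Z"
    have lin: "\<rho> n \<in> linear_maps ring_of_type_algebra W W"
      using repr n by (simp add: group_ring_module_def)
    then have \<rho>_closed: "x \<in> carrier W \<Longrightarrow> \<rho> n x \<in> carrier W" for x by (auto simp: linear_maps_def)
    note \<rho> = tensor_map_closed[OF lin id_linear(2)] tensor_map_add[OF lin id_linear(2)]
      tensor_map_pt[OF lin id_linear(2)]
    let ?\<rho> = "tensor_map ring_of_type_algebra W (ext_module to_ac) (\<rho> n) (\<lambda>y. y)"
    have 1: "\<Psi> (?\<rho> v) = ?\<rho> (\<Psi> v)" if "v \<in> carrier T" for v
      using that by (induction rule: tensor_induct)
        (simp_all add: \<rho> \<Psi>_pt \<Psi>_add \<Psi>_closed \<rho>_closed \<phi>_closed \<phi>_comm n)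
    have 2: "sc c (?\<rho> v) = ?\<rho> (sc c v)" if "v \<in> carrier T" for v
      using that by (induction rule: tensor_induct)
        (simp_all add: \<rho> sc_pt sc_add sc_closed \<rho>_closed)
    show "?\<rho> u \<in> ?Z" using u by (simp add: 1 2 \<rho>)
  qed
  moreover have "?Z \<noteq> {\<zero>\<^bsub>T\<^esub>}" using q U_closed by blast
  ultimately have Z: "?Z = carrier T"
    using abs_simple unfolding absolutely_simple_def simple_action_def scalar_extension_simps by blast
  have 1: "pt (\<phi> x) 1 = pt x c" if "x \<in> carrier W" for x
  proof -
    have "pt x 1 \<in> ?Z" unfolding Z using that by simp
    then show ?thesis using that by (simp add: \<Psi>_pt sc_pt)
  qed
  obtain a where a: "c = to_ac a" using pt_one_eqD[OF 1[OF w(1)]] w \<phi>_closed by auto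
  have "\<phi> x = a \<odot>\<^bsub>W\<^esub> x" if x: "x \<in> carrier W" for x
  proof (cases "x = \<zero>\<^bsub>W\<^esub>")
    case True
    then show ?thesis using M.smult_r_null[of a] by (simp add: \<phi>_simps)
  next
    case False
    then show ?thesis using pt_one_eqD[OF 1[OF x] \<phi>_closed[OF x] x] a by auto
  qed
  then show ?thesis by blast
qed

end

end

section \<open>Unimodular Hermitian lattices\<close>

text \<open>A valuation ring \<open>OL\<close> with maximal ideal \<open>PL\<close> and residue
  characteristic different from 2, where \<open>bar\<close> is the identity modulo
  \<open>PL\<close>.\<close>

locale local_conjugation =
  fixes OL PL :: "'l::field set" and bar :: "'l \<Rightarrow> 'l"
  assumes OL_zero: "0 \<in> OL" and OL_one: "1 \<in> OL"
    and OL_plus: "x \<in> OL \<Longrightarrow> y \<in> OL \<Longrightarrow> x + y \<in> OL" and OL_minus: "x \<in> OL \<Longrightarrow> - x \<in> OL"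
    and OL_times: "x \<in> OL \<Longrightarrow> y \<in> OL \<Longrightarrow> x * y \<in> OL"
    and OL_valuation: "x \<notin> OL \<Longrightarrow> inverse x \<in> OL"
    and PL_one: "1 \<notin> PL" and PL_plus: "x \<in> PL \<Longrightarrow> y \<in> PL \<Longrightarrow> x + y \<in> PL"
    and PL_times: "x \<in> OL \<Longrightarrow> y \<in> PL \<Longrightarrow> x * y \<in> PL"
    and OL_inverse: "x \<in> OL \<Longrightarrow> x \<notin> PL \<Longrightarrow> inverse x \<in> OL"
    and conj_mod: "x \<in> OL \<Longrightarrow> bar x - x \<in> PL"
    and two_unit: "2 \<notin> PL"
begin

lemma PL_zero: "0 \<in> PL"
  using conj_mod[OF OL_zero] PL_times[OF OL_zero] by simp

lemma PL_minus: "x \<in> PL \<Longrightarrow> - x \<in> PL"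
  using PL_times[of "- 1" x] OL_minus[OF OL_one] by simp

lemma PL_diff: "x \<in> PL \<Longrightarrow> y \<in> PL \<Longrightarrow> x - y \<in> PL"
  using PL_plus[of x "- y"] PL_minus by simp

lemma OL_sum: "(\<And>a. a \<in> A \<Longrightarrow> f a \<in> OL) \<Longrightarrow> sum f A \<in> OL"
  by (induction A rule: infinite_finite_induct) (auto intro: OL_zero OL_plus)

lemma PL_sum: "(\<And>a. a \<in> A \<Longrightarrow> f a \<in> PL) \<Longrightarrow> sum f A \<in> PL"
  by (induction A rule: infinite_finite_induct) (auto intro: PL_zero PL_plus)

lemma PL_cancel:
  assumes "x \<in> OL" "x \<notin> PL" "x * y \<in> PL"
  shows "y \<in> PL"
proof -
  have "x \<noteq> 0" using assms PL_zero by auto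
  then show ?thesis using PL_times[OF OL_inverse[OF assms(1,2)] assms(3)] by (simp flip: mult.assoc)
qed

text \<open>Divisibility in a valuation ring is total; the element found has least valuation. It
  decides below which generator to discard and by what to scale the alternating form.\<close>

lemma ex_divisor:
  assumes "finite A" "A \<noteq> {}" "0 \<notin> A"
  shows "\<exists>a\<in>A. \<forall>b\<in>A. b / a \<in> OL"
  using assms
proof (induction rule: finite_ne_induct)
  case (singleton x)
  then show ?case by (simp add: OL_one)
next
  case (insert x A)
  then obtain a where a: "a \<in> A" "\<And>b. b \<in> A \<Longrightarrow> b / a \<in> OL" by auto
  show ?case
  proof (cases "x / a \<in> OL")
    case True
    then show ?thesis using a by auto
  next
    case False
    then have "a / x \<in> OL" using OL_valuation[of "x / a"] by simp
    moreover have "a \<noteq> 0" using a(1) insert.prems by auto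
    ultimately have "b / x \<in> OL" if "b \<in> A" for b
      using OL_times[OF a(2)[OF that], of "a / x"] by simp
    then show ?thesis using insert.prems by (auto simp: OL_one)
  qed
qed

end

text \<open>The conditions on \<open>act\<close> and \<open>A\<close> are restricted to
  \<open>span T\<close> because these maps will be transported along an injection and mean nothing
  outside its image. Taking Schur's lemma as a hypothesis separates the lattice argument from tensor
  products.\<close>

locale unimodular_hermitian_lattice = local_conjugation OL PL bar + vector_space scale + group N
  for OL PL :: "'l::field set" and bar :: "'l \<Rightarrow> 'l"
    and scale :: "'l \<Rightarrow> 'v::ab_group_add \<Rightarrow> 'v" and N :: "'n monoid" (structure) +
  fixes act :: "'n \<Rightarrow> 'v \<Rightarrow> 'v" and T :: "'v set" and A H :: "'v \<Rightarrow> 'v \<Rightarrow> 'l"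
  assumes fin_N: "finite (carrier N)" and order_unit: "of_nat (card (carrier N)) \<notin> PL"
    and T_zero: "0 \<in> T" and T_add: "x \<in> T \<Longrightarrow> y \<in> T \<Longrightarrow> x + y \<in> T"
    and T_scale: "c \<in> OL \<Longrightarrow> x \<in> T \<Longrightarrow> scale c x \<in> T"
    and T_fg: "\<exists>S. finite S \<and> S \<subseteq> T \<and> (\<forall>x\<in>T. \<exists>c. (\<forall>s\<in>S. c s \<in> OL) \<and> x = (\<Sum>s\<in>S. scale (c s) s))"
    and act_T: "n \<in> carrier N \<Longrightarrow> x \<in> T \<Longrightarrow> act n x \<in> T"
    and act_add: "n \<in> carrier N \<Longrightarrow> x \<in> span T \<Longrightarrow> y \<in> span T \<Longrightarrow> act n (x + y) = act n x + act n y"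
    and act_scale: "n \<in> carrier N \<Longrightarrow> x \<in> span T \<Longrightarrow> act n (scale c x) = scale c (act n x)"
    and act_one: "x \<in> span T \<Longrightarrow> act \<one> x = x"
    and act_mult: "m \<in> carrier N \<Longrightarrow> n \<in> carrier N \<Longrightarrow> x \<in> span T \<Longrightarrow> act (m \<otimes> n) x = act m (act n x)"
    and schur: "\<And>\<Phi>. (\<And>x. x \<in> span T \<Longrightarrow> \<Phi> x \<in> span T) \<Longrightarrow>
        (\<And>x y. x \<in> span T \<Longrightarrow> y \<in> span T \<Longrightarrow> \<Phi> (x + y) = \<Phi> x + \<Phi> y) \<Longrightarrow>
        (\<And>c x. x \<in> span T \<Longrightarrow> \<Phi> (scale c x) = scale c (\<Phi> x)) \<Longrightarrow>
        (\<And>n x. n \<in> carrier N \<Longrightarrow> x \<in> span T \<Longrightarrow> \<Phi> (act n x) = act n (\<Phi> x)) \<Longrightarrow>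
        \<exists>c. \<forall>x\<in>span T. \<Phi> x = scale c x"
    and A_add: "x \<in> span T \<Longrightarrow> y \<in> span T \<Longrightarrow> z \<in> span T \<Longrightarrow> A (x + y) z = A x z + A y z"
    and A_scale: "x \<in> span T \<Longrightarrow> y \<in> span T \<Longrightarrow> A (scale c x) y = c * A x y"
    and A_skew: "x \<in> span T \<Longrightarrow> y \<in> span T \<Longrightarrow> A y x = - A x y"
    and A_act: "n \<in> carrier N \<Longrightarrow> x \<in> span T \<Longrightarrow> y \<in> span T \<Longrightarrow> A (act n x) (act n y) = A x y"
    and A_nonzero: "\<exists>x\<in>span T. \<exists>y\<in>span T. A x y \<noteq> 0"
    and H_OL: "x \<in> T \<Longrightarrow> y \<in> T \<Longrightarrow> H x y \<in> OL"
    and H_add: "x \<in> T \<Longrightarrow> y \<in> T \<Longrightarrow> z \<in> T \<Longrightarrow> H z (x + y) = H z x + H z y"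
    and H_scale: "c \<in> OL \<Longrightarrow> x \<in> T \<Longrightarrow> y \<in> T \<Longrightarrow> H y (scale c x) = bar c * H y x"
    and H_hermitian: "x \<in> T \<Longrightarrow> y \<in> T \<Longrightarrow> H y x = bar (H x y)"
    and H_act: "n \<in> carrier N \<Longrightarrow> x \<in> T \<Longrightarrow> y \<in> T \<Longrightarrow> H (act n x) (act n y) = H x y"
    and H_unimodular: "\<And>\<alpha>. (\<And>x. x \<in> T \<Longrightarrow> \<alpha> x \<in> OL) \<Longrightarrow>
        (\<And>x y. x \<in> T \<Longrightarrow> y \<in> T \<Longrightarrow> \<alpha> (x + y) = \<alpha> x + \<alpha> y) \<Longrightarrow>
        (\<And>c x. c \<in> OL \<Longrightarrow> x \<in> T \<Longrightarrow> \<alpha> (scale c x) = c * \<alpha> x) \<Longrightarrow>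
        \<exists>a\<in>T. \<forall>y\<in>T. \<alpha> y = H y a"
begin

lemma T_sum: "(\<And>a. a \<in> B \<Longrightarrow> f a \<in> T) \<Longrightarrow> sum f B \<in> T"
  by (induction B rule: infinite_finite_induct) (auto intro: T_zero T_add)

text \<open>A generating set of least size is independent: dividing a linear relation by its
  coefficient of least valuation would express one generator by the others with coefficients in
  \<open>OL\<close>.\<close>

lemma ex_basis:
  "\<exists>B. finite B \<and> B \<subseteq> T \<and> independent B \<and>
    (\<forall>x\<in>T. \<exists>c. (\<forall>s\<in>B. c s \<in> OL) \<and> x = (\<Sum>s\<in>B. scale (c s) s))"
proof -
  let ?gen = "\<lambda>B. finite B \<and> B \<subseteq> T \<and> (\<forall>x\<in>T. \<exists>c. (\<forall>s\<in>B. c s \<in> OL) \<and> x = (\<Sum>s\<in>B. scale (c s) s))"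
  obtain B0 where "?gen B0" using T_fg by blast
  from ex_has_least_nat[of ?gen B0 card, OF this]
  obtain B where B: "?gen B" and min: "\<And>C. ?gen C \<Longrightarrow> card B \<le> card C" by blast
  have "independent B"
  proof
    assume "dependent B"
    then obtain u b where u: "(\<Sum>b\<in>B. scale (u b) b) = 0" "b \<in> B" "u b \<noteq> 0"
      using B by (auto simp: dependent_finite)
    then have "\<exists>a\<in>u ` {b \<in> B. u b \<noteq> 0}. \<forall>x\<in>u ` {b \<in> B. u b \<noteq> 0}. x / a \<in> OL"
      using B by (intro ex_divisor) auto
    then obtain a where a: "a \<in> B" "u a \<noteq> 0" and div: "\<And>b. b \<in> B \<Longrightarrow> u b \<noteq> 0 \<Longrightarrow> u b / u a \<in> OL"
      by auto
    have div': "u b / u a \<in> OL" if "b \<in> B" for b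
      using div[OF that] OL_zero by (cases "u b = 0") auto
    have "scale (u a) a + (\<Sum>b\<in>B - {a}. scale (u b) b) = 0"
      using u(1) B a(1) by (simp add: sum.remove)
    then have "scale (u a) a = - (\<Sum>b\<in>B - {a}. scale (u b) b)"
      by (simp only: eq_neg_iff_add_eq_0)
    then have "scale (inverse (u a)) (scale (u a) a) = scale (inverse (u a)) (- (\<Sum>b\<in>B - {a}. scale (u b) b))"
      by (simp only:)
    then have a_eq: "a = (\<Sum>b\<in>B - {a}. scale (- (u b / u a)) b)"
      using a(2) by (simp add: scale_minus_right scale_sum_right sum_negf scale_minus_left divide_inverse mult.commute)
    have "?gen (B - {a})"
    proof (intro conjI ballI)
      fix x assume "x \<in> T"
      then obtain c where c: "\<forall>s\<in>B. c s \<in> OL" "x = (\<Sum>s\<in>B. scale (c s) s)" using B by metis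
      have "x = scale (c a) a + (\<Sum>s\<in>B - {a}. scale (c s) s)"
        using c(2) B a(1) by (simp add: sum.remove)
      also have "scale (c a) a = (\<Sum>b\<in>B - {a}. scale (c a * - (u b / u a)) b)"
        by (subst a_eq) (simp add: scale_sum_right)
      finally have "x = (\<Sum>s\<in>B - {a}. scale (c a * - (u s / u a) + c s) s)"
        by (simp only: scale_left_distrib sum.distrib)
      moreover have "\<forall>s\<in>B - {a}. c a * - (u s / u a) + c s \<in> OL"
        using c(1) a(1) div' by (auto intro!: OL_plus OL_times OL_minus simp del: mult_minus_right)
      ultimately show "\<exists>c. (\<forall>s\<in>B - {a}. c s \<in> OL) \<and> x = (\<Sum>s\<in>B - {a}. scale (c s) s)"
        by (intro exI[of _ "\<lambda>s. c a * - (u s / u a) + c s"] conjI)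
    qed (use B in auto)
    then show False using min[of "B - {a}"] B a(1) by (metis card_Diff1_less linorder_not_less)
  qed
  then show ?thesis using B by blast
qed

definition "B = (SOME B. finite B \<and> B \<subseteq> T \<and> independent B \<and>
    (\<forall>x\<in>T. \<exists>c. (\<forall>s\<in>B. c s \<in> OL) \<and> x = (\<Sum>s\<in>B. scale (c s) s)))"

lemma B: "finite B" "B \<subseteq> T" "independent B"
  and B_gen: "x \<in> T \<Longrightarrow> \<exists>c. (\<forall>s\<in>B. c s \<in> OL) \<and> x = (\<Sum>s\<in>B. scale (c s) s)"
  using someI_ex[OF ex_basis, folded B_def] by auto

lemma span_B: "span B = span T"
proof
  show "span B \<subseteq> span T" using B(2) by (rule span_mono)
  have "x \<in> span B" if "x \<in> T" for x
    using B_gen[OF that] by (auto intro!: span_sum span_scale intro: span_base)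
  then show "span T \<subseteq> span B" by (intro span_minimal) auto
qed

definition "\<phi> b x = representation B x b"

lemma \<phi>_linear: "x \<in> span T \<Longrightarrow> y \<in> span T \<Longrightarrow> \<phi> b (x + y) = \<phi> b x + \<phi> b y"
  "x \<in> span T \<Longrightarrow> \<phi> b (scale c x) = c * \<phi> b x"
  using B(3) by (simp_all add: \<phi>_def representation_add representation_scale span_B)

lemma \<phi>_expand: "x \<in> span T \<Longrightarrow> (\<Sum>b\<in>B. scale (\<phi> b x) b) = x"
  using sum_representation_eq[OF B(3), of x B] B(1) by (simp add: \<phi>_def span_B)

lemma \<phi>_OL:
  assumes "x \<in> T" "b \<in> B"
  shows "\<phi> b x \<in> OL"
proof -
  obtain c where c: "\<forall>s\<in>B. c s \<in> OL" "x = (\<Sum>s\<in>B. scale (c s) s)" using B_gen[OF assms(1)] by auto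
  have "representation B x b = (\<Sum>s\<in>B. representation B (scale (c s) s) b)"
    unfolding c(2) using B(3) by (subst representation_sum) (auto intro: span_scale span_base)
  also have "\<dots> = (\<Sum>s\<in>B. if s = b then c b else 0)"
    using B(3) by (intro sum.cong) (auto simp: representation_scale span_base representation_basis)
  also have "\<dots> = c b" using B(1) assms(2) by simp
  finally show ?thesis using c(1) assms(2) by (simp add: \<phi>_def)
qed

lemma T_span: "x \<in> T \<Longrightarrow> x \<in> span T"
  by (rule span_base)

lemma act_span: "n \<in> carrier N \<Longrightarrow> x \<in> span T \<Longrightarrow> act n x \<in> span T"
proof -
  assume n: "n \<in> carrier N" and x: "x \<in> span T"
  have act_zero: "act n 0 = 0" using act_scale[OF n, of 0 0] span_zero by simp
  have "x \<in> {x \<in> span T. act n x \<in> span T}"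
  proof (rule span_minimal[THEN subsetD, OF _ _ x])
    show "subspace {x \<in> span T. act n x \<in> span T}"
      using n by (auto intro!: subspaceI simp: act_zero act_add act_scale span_add span_scale span_zero)
    show "T \<subseteq> {x \<in> span T. act n x \<in> span T}" using n by (auto simp: T_span act_T)
  qed
  then show "act n x \<in> span T" by simp
qed

lemma act_sum:
  assumes "n \<in> carrier N" "\<And>a. a \<in> Y \<Longrightarrow> f a \<in> span T"
  shows "act n (sum f Y) = (\<Sum>a\<in>Y. act n (f a))"
  using assms(2)
proof (induction Y rule: infinite_finite_induct)
  case (insert x Y)
  then show ?case using assms(1) by (simp add: act_add span_sum)
qed (use act_scale[OF assms(1), of 0 0] span_zero in simp_all)

lemma act_inv: "n \<in> carrier N \<Longrightarrow> x \<in> span T \<Longrightarrow> act (inv n) (act n x) = x"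
  "n \<in> carrier N \<Longrightarrow> x \<in> span T \<Longrightarrow> act n (act (inv n) x) = x"
  using act_mult[of "inv n" n x] act_mult[of n "inv n" x] by (simp_all add: act_one)

text \<open>The rank one map sending x to \<phi>_b(x) a, summed over its conjugates by
  \<open>N\<close> to make it equivariant. There is no division by the order of
  \<open>N\<close>.\<close>

definition "proj b a x = (\<Sum>n\<in>carrier N. scale (\<phi> b (act n x)) (act (inv n) a))"

lemma proj_act:
  assumes m: "m \<in> carrier N" and x: "x \<in> span T" and a: "a \<in> span T"
  shows "proj b a (act m x) = act m (proj b a x)"
proof -
  have "proj b a (act m x) = (\<Sum>n\<in>carrier N. scale (\<phi> b (act (n \<otimes> m) x)) (act (m \<otimes> inv (n \<otimes> m)) a))"
    unfolding proj_def using m x by (intro sum.cong) (simp_all add: act_mult inv_mult_group m_assoc[symmetric])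
  also have "\<dots> = (\<Sum>n\<in>carrier N. scale (\<phi> b (act n x)) (act (m \<otimes> inv n) a))"
  proof (rule sum.reindex_bij_betw)
    show "bij_betw (\<lambda>n. n \<otimes> m) (carrier N) (carrier N)"
      by (rule bij_betwI[where g = "\<lambda>n. n \<otimes> inv m"]) (use m in \<open>auto simp: m_assoc\<close>)
  qed
  also have "\<dots> = act m (proj b a x)"
    unfolding proj_def using m a
    by (subst act_sum) (auto intro!: span_scale act_span sum.cong simp: act_mult act_scale act_span)
  finally show ?thesis .
qed

lemma proj_scalar:
  assumes a: "a \<in> T" and b: "b \<in> B"
  shows "\<exists>c\<in>OL. \<forall>x\<in>span T. proj b a x = scale c x"
proof -
  have "\<exists>c. \<forall>x\<in>span T. proj b a x = scale c x"
  proof (rule schur)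
    show "proj b a x \<in> span T" for x
      unfolding proj_def using a by (intro span_sum span_scale act_span T_span) auto
    show "proj b a (act n x) = act n (proj b a x)" if "n \<in> carrier N" "x \<in> span T" for n x
      using that T_span[OF a] by (rule proj_act)
  qed (simp_all add: proj_def act_add act_scale \<phi>_linear act_span scale_left_distrib sum.distrib scale_sum_right)
  then obtain c where c: "\<And>x. x \<in> span T \<Longrightarrow> proj b a x = scale c x" by auto
  have bT: "b \<in> T" using b B by auto
  \<comment> \<open>Evaluating at \<open>b\<close>, whose own coordinate is 1, shows the scalar as a
    coordinate of an element of \<open>T\<close>.\<close>
  have "scale c b \<in> T"
    unfolding c[OF T_span[OF bT], symmetric] proj_def
    using a b bT by (intro T_sum T_scale \<phi>_OL act_T) auto
  then have "\<phi> b (scale c b) \<in> OL" using b by (rule \<phi>_OL)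
  moreover have "\<phi> b b = 1" using B(3) b by (simp add: \<phi>_def representation_basis)
  ultimately have "c \<in> OL" using bT by (simp add: \<phi>_linear T_span)
  then show ?thesis using c by blast
qed

text \<open>
  The endomorphisms \<open>proj b b\<close> sum to the order of \<open>N\<close>, a unit; so one of them is a unit scalar.
  This replaces the theorem that the dimension of \<open>T\<close> divides the order of \<open>N\<close>.
\<close>

lemma ex_unit_projection:
  obtains b c where "b \<in> B" "c \<in> OL" "c \<notin> PL" "\<And>x. x \<in> span T \<Longrightarrow> proj b b x = scale c x"
proof -
  have "\<forall>b\<in>B. \<exists>c\<in>OL. \<forall>x\<in>span T. proj b b x = scale c x"
    using proj_scalar B(2) by blast
  then obtain c where c: "\<And>b. b \<in> B \<Longrightarrow> c b \<in> OL" "\<And>b x. b \<in> B \<Longrightarrow> x \<in> span T \<Longrightarrow> proj b b x = scale (c b) x"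
    by metis
  obtain x where x: "x \<in> T" "x \<noteq> 0"
  proof -
    obtain x y where xy: "x \<in> span T" "y \<in> span T" "A x y \<noteq> 0" using A_nonzero by auto
    moreover have "A 0 y = 0" using A_scale[of 0 y 0] xy span_zero by simp
    ultimately have "\<not> span T \<subseteq> {0}" by auto
    then have "\<not> T \<subseteq> {0}" using span_minimal[of T "{0}"] by auto
    then show ?thesis using that by blast
  qed
  have xs: "x \<in> span T" using x by (simp add: T_span)
  have "scale (\<Sum>b\<in>B. c b) x = (\<Sum>b\<in>B. proj b b x)"
    using c xs by (simp add: scale_sum_left)
  \<comment> \<open>Summing over the basis first rebuilds \<open>act n x\<close>, so each group
    element contributes just \<open>x\<close>.\<close>
  also have "\<dots> = (\<Sum>n\<in>carrier N. \<Sum>b\<in>B. act (inv n) (scale (\<phi> b (act n x)) b))"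
    unfolding proj_def using B(2) by (subst sum.swap) (auto intro!: sum.cong simp: act_scale T_span)
  also have "\<dots> = (\<Sum>n\<in>carrier N. act (inv n) (\<Sum>b\<in>B. scale (\<phi> b (act n x)) b))"
    using B(2) by (intro sum.cong refl act_sum[symmetric]) (auto intro: span_scale span_base)
  also have "\<dots> = (\<Sum>n\<in>carrier N. x)"
    using xs by (intro sum.cong) (simp_all add: \<phi>_expand act_span act_inv)
  also have "\<dots> = scale (of_nat (card (carrier N))) x"
    by (simp add: sum_constant_scale)
  finally have "(\<Sum>b\<in>B. c b) = of_nat (card (carrier N))" using x(2) by simp
  then have "(\<Sum>b\<in>B. c b) \<notin> PL" using order_unit by simp
  then have "\<not> (\<forall>b\<in>B. c b \<in> PL)" using PL_sum[of B c] by blast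
  then obtain b where "b \<in> B" "c b \<notin> PL" by blast
  then show ?thesis using that c by blast
qed

lemma A_right:
  assumes "x \<in> span T" "y \<in> span T"
  shows "z \<in> span T \<Longrightarrow> A z (x + y) = A z x + A z y" "A x (scale c y) = c * A x y"
  using assms A_skew[of "x + y" z] A_add A_skew[of x z] A_skew[of y z]
    A_skew[of "scale c y" x] A_scale[of y x c] A_skew[of y x]
  by (simp_all add: span_add span_scale)

lemma A_sum:
  assumes "\<And>a. a \<in> Y \<Longrightarrow> f a \<in> span T" "y \<in> span T"
  shows "A (sum f Y) y = (\<Sum>a\<in>Y. A (f a) y)"
  using assms(1)
proof (induction Y rule: infinite_finite_induct)
  case (insert x Y)
  then show ?case using assms(2) by (simp add: A_add span_sum)
qed (use A_scale[of 0 y 0] assms(2) span_zero in simp_all)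

lemma H_sum:
  assumes "\<And>a. a \<in> Y \<Longrightarrow> f a \<in> T" "y \<in> T"
  shows "H y (sum f Y) = (\<Sum>a\<in>Y. H y (f a))"
proof -
  have "H y 0 + H y 0 = H y 0" using H_add[of 0 0 y] T_zero assms(2) by simp
  then have "H y 0 = 0" by (metis add_cancel_right_right)
  then show ?thesis using assms(1)
  proof (induction Y rule: infinite_finite_induct)
    case (insert x Y)
    then show ?case using assms(2) by (simp add: H_add T_sum)
  qed auto
qed

text \<open>Scale by the inverse of an entry of least valuation in the Gram matrix of
  \<open>A\<close> on the basis: all values become integral and one of them becomes 1.\<close>

lemma ex_normalisation:
  obtains d p q where "p \<in> T" "q \<in> T" "d * A p q = 1" "\<And>x y. x \<in> T \<Longrightarrow> y \<in> T \<Longrightarrow> d * A x y \<in> OL"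
proof -
  let ?V = "(\<lambda>(b, b'). A b b') ` (B \<times> B) - {0}"
  have expand: "A x y = (\<Sum>b\<in>B. \<Sum>b'\<in>B. \<phi> b x * (\<phi> b' y * A b b'))"
    if xy: "x \<in> span T" "y \<in> span T" for x y
  proof -
    have B': "\<And>b. b \<in> B \<Longrightarrow> b \<in> span T" using B(2) T_span by blast
    have "A z y = (\<Sum>b'\<in>B. \<phi> b' y * A z b')" if z: "z \<in> span T" for z
    proof -
      have "A z y = - A (\<Sum>b\<in>B. scale (\<phi> b y) b) z" unfolding \<phi>_expand[OF xy(2)] by (rule A_skew[OF xy(2) z])
      also have "\<dots> = - (\<Sum>b\<in>B. \<phi> b y * A b z)"
        using z B' by (simp add: A_sum span_scale A_scale)
      also have "\<dots> = (\<Sum>b\<in>B. \<phi> b y * A z b)"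
        unfolding sum_negf[symmetric]
        by (rule sum.cong) (simp_all add: A_skew[OF z B'])
      finally show ?thesis .
    qed
    moreover have "A x y = (\<Sum>b\<in>B. \<phi> b x * A b y)"
    proof -
      have "A x y = A (\<Sum>b\<in>B. scale (\<phi> b x) b) y" using xy by (simp add: \<phi>_expand)
      then show ?thesis using xy B' by (simp add: A_sum span_scale A_scale)
    qed
    ultimately show ?thesis using B' by (simp add: sum_distrib_left)
  qed
  have "?V \<noteq> {}"
  proof
    assume "?V = {}"
    then have "A b b' = 0" if "b \<in> B" "b' \<in> B" for b b' using that by auto
    then have "A x y = 0" if "x \<in> span T" "y \<in> span T" for x y using expand[OF that] by simp
    then show False using A_nonzero by auto
  qed
  then have "\<exists>a\<in>?V. \<forall>b\<in>?V. b / a \<in> OL" using B(1) by (intro ex_divisor) auto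
  then obtain p q where pq: "p \<in> B" "q \<in> B" "A p q \<noteq> 0" and
    div: "\<And>b b'. b \<in> B \<Longrightarrow> b' \<in> B \<Longrightarrow> A b b' \<noteq> 0 \<Longrightarrow> A b b' / A p q \<in> OL" by auto
  have div': "A b b' / A p q \<in> OL" if "b \<in> B" "b' \<in> B" for b b'
    using div[OF that] OL_zero by (cases "A b b' = 0") auto
  show ?thesis
  proof (rule that[of p q "inverse (A p q)"])
    fix x y assume xy: "x \<in> T" "y \<in> T"
    have "inverse (A p q) * A x y = (\<Sum>b\<in>B. \<Sum>b'\<in>B. \<phi> b x * (\<phi> b' y * (A b b' / A p q)))"
      unfolding expand[OF T_span[OF xy(1)] T_span[OF xy(2)]] sum_distrib_left
      by (intro sum.cong) (simp_all add: divide_inverse algebra_simps)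
    also have "\<dots> \<in> OL" using xy by (intro OL_sum OL_times \<phi>_OL div') auto
    finally show "inverse (A p q) * A x y \<in> OL" .
  qed (use pq B(2) in auto)
qed

text \<open>Modulo \<open>PL\<close> a unit multiple of the normalised alternating form is
  proportional to the symmetric reduction of \<open>H\<close>. Being both alternating and symmetric
  it vanishes, although its value at \<open>p\<close>, \<open>q\<close> is the unit
  \<open>c\<close>.\<close>

theorem contradiction: False
proof -
  obtain b c where b: "b \<in> B" and c: "c \<in> OL" "c \<notin> PL" "\<And>x. x \<in> span T \<Longrightarrow> proj b b x = scale c x"
    by (rule ex_unit_projection) blast
  obtain d p q where pq: "p \<in> T" "q \<in> T" "d * A p q = 1"
    and d: "\<And>x y. x \<in> T \<Longrightarrow> y \<in> T \<Longrightarrow> d * A x y \<in> OL"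
    by (rule ex_normalisation) blast
  have bT: "b \<in> T" using b B by auto
  \<comment> \<open>Unimodularity represents an integral functional of \<open>A\<close> by a vector
    of \<open>T\<close>; the endomorphism \<open>proj b a\<close> formed with this vector is what
    relates the two forms.\<close>
  have "\<exists>a\<in>T. \<forall>y\<in>T. d * A b y = H y a"
    using d[OF bT] bT by (intro H_unimodular) (simp_all add: A_right T_span algebra_simps)
  then obtain a where a: "a \<in> T" "\<And>y. y \<in> T \<Longrightarrow> d * A b y = H y a" by auto
  obtain c' where c': "c' \<in> OL" "\<And>x. x \<in> span T \<Longrightarrow> proj b a x = scale c' x"
    using proj_scalar[OF a(1) b] by auto
  \<comment> \<open>Moving \<open>proj b b\<close> through \<open>A\<close> and
    \<open>proj b a\<close> through \<open>H\<close> gives two sums over \<open>N\<close> with the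
    same values of \<open>H\<close>; their coefficients differ only by \<open>bar\<close>, which is
    invisible modulo \<open>PL\<close>.\<close>
  have key: "c * (d * A x y) - c' * H y x \<in> PL" if xy: "x \<in> T" "y \<in> T" for x y
  proof -
    have xyS: "x \<in> span T" "y \<in> span T" using xy T_span by auto
    have "c * (d * A x y) = d * A (proj b b x) y"
      using xyS by (simp add: c(3) A_scale)
    also have "\<dots> = (\<Sum>n\<in>carrier N. \<phi> b (act n x) * (d * A (act (inv n) b) y))"
      unfolding proj_def using xyS bT
      by (subst A_sum) (auto simp: A_scale sum_distrib_left T_span act_span span_scale algebra_simps intro!: sum.cong)
    also have "\<dots> = (\<Sum>n\<in>carrier N. \<phi> b (act n x) * H (act n y) a)"
    proof (rule sum.cong)
      fix n assume n: "n \<in> carrier N"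
      have "A (act (inv n) b) y = A (act n (act (inv n) b)) (act n y)"
        using n xyS bT by (simp add: A_act act_span T_span)
      also have "\<dots> = A b (act n y)" using n bT by (simp add: act_inv T_span)
      finally show "\<phi> b (act n x) * (d * A (act (inv n) b) y) = \<phi> b (act n x) * H (act n y) a"
        using a(2) n xy by (simp add: act_T)
    qed simp
    finally have 1: "c * (d * A x y) = (\<Sum>n\<in>carrier N. \<phi> b (act n x) * H (act n y) a)" .
    have "bar c' * H y x = H y (proj b a x)"
      using xy xyS c' by (simp add: H_scale)
    also have "\<dots> = (\<Sum>n\<in>carrier N. bar (\<phi> b (act n x)) * H y (act (inv n) a))"
      unfolding proj_def using xy a(1) b
      by (subst H_sum) (auto simp: H_scale T_scale \<phi>_OL act_T intro!: sum.cong)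
    also have "\<dots> = (\<Sum>n\<in>carrier N. bar (\<phi> b (act n x)) * H (act n y) a)"
    proof (rule sum.cong)
      fix n assume n: "n \<in> carrier N"
      have "H y (act (inv n) a) = H (act n y) (act n (act (inv n) a))"
        using n xy a(1) by (simp add: H_act act_T)
      then show "bar (\<phi> b (act n x)) * H y (act (inv n) a) = bar (\<phi> b (act n x)) * H (act n y) a"
        using n a(1) by (simp add: act_inv T_span)
    qed simp
    finally have 2: "bar c' * H y x = (\<Sum>n\<in>carrier N. bar (\<phi> b (act n x)) * H (act n y) a)" .
    have "bar c' * H y x - c * (d * A x y)
        = (\<Sum>n\<in>carrier N. H (act n y) a * (bar (\<phi> b (act n x)) - \<phi> b (act n x)))"
      unfolding 1 2 sum_subtractf[symmetric] by (simp add: algebra_simps)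
    also have "\<dots> \<in> PL"
      using xy a(1) b by (intro PL_sum PL_times conj_mod H_OL \<phi>_OL act_T) auto
    finally have 3: "bar c' * H y x - c * (d * A x y) \<in> PL" .
    have "H y x * (bar c' - c') \<in> PL"
      using xy c'(1) by (intro PL_times conj_mod H_OL)
    from PL_diff[OF this 3] show ?thesis by (simp add: algebra_simps)
  qed
  have "c' * (H p q - H q p) \<in> PL"
    using PL_times[OF c'(1) conj_mod[OF H_OL[OF pq(2,1)]]] H_hermitian[OF pq(2,1)] by simp
  \<comment> \<open>Adding \<open>key\<close> for both orders of \<open>p\<close>, \<open>q\<close>
    cancels the alternating form. After the correction by the symmetry of \<open>H\<close> modulo
    \<open>PL\<close>, \<open>2 * (c' * H q p)\<close> remains.\<close>
  from PL_diff[OF PL_minus[OF PL_plus[OF key[OF pq(1,2)] key[OF pq(2,1)]]] this]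
  have "- (c * (d * A p q) - c' * H q p + (c * (d * A q p) - c' * H p q)) - c' * (H p q - H q p) \<in> PL" .
  moreover have "A q p = - A p q" using pq by (intro A_skew T_span)
  ultimately have "2 * (c' * H q p) \<in> PL" by (simp add: algebra_simps)
  moreover have "2 \<in> OL" using OL_plus[OF OL_one OL_one] by simp
  ultimately have "c' * H q p \<in> PL" using two_unit PL_cancel by blast
  then have "(c * (d * A p q) - c' * H q p) + c' * H q p \<in> PL"
    using key[OF pq(1,2)] by (rule PL_plus[rotated])
  then have "c \<in> PL" using pq(3) by simp
  then show False using c(2) by simp
qed

end

section \<open>The symplectic module\<close>

lemma dual_moduleD:
  assumes "\<phi> \<in> dual_module R M"
  shows "x \<in> carrier M \<Longrightarrow> \<phi> x \<in> carrier R"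
    "x \<in> carrier M \<Longrightarrow> y \<in> carrier M \<Longrightarrow> \<phi> (x \<oplus>\<^bsub>M\<^esub> y) = \<phi> x \<oplus>\<^bsub>R\<^esub> \<phi> y"
    "r \<in> carrier R \<Longrightarrow> x \<in> carrier M \<Longrightarrow> \<phi> (r \<odot>\<^bsub>M\<^esub> x) = r \<otimes>\<^bsub>R\<^esub> \<phi> x"
  using assms by (auto simp: dual_module_def)

lemma bilinear_formD:
  assumes f: "bilinear_form R M f"
    and closed: "\<And>x y. x \<in> carrier M \<Longrightarrow> y \<in> carrier M \<Longrightarrow> x \<oplus>\<^bsub>M\<^esub> y \<in> carrier M"
      "\<And>r x. r \<in> carrier R \<Longrightarrow> x \<in> carrier M \<Longrightarrow> r \<odot>\<^bsub>M\<^esub> x \<in> carrier M"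
  shows "x \<in> carrier M \<Longrightarrow> y \<in> carrier M \<Longrightarrow> f x y \<in> carrier R"
    "x \<in> carrier M \<Longrightarrow> y \<in> carrier M \<Longrightarrow> z \<in> carrier M \<Longrightarrow> f (x \<oplus>\<^bsub>M\<^esub> y) z = f x z \<oplus>\<^bsub>R\<^esub> f y z"
    "x \<in> carrier M \<Longrightarrow> y \<in> carrier M \<Longrightarrow> z \<in> carrier M \<Longrightarrow> f z (x \<oplus>\<^bsub>M\<^esub> y) = f z x \<oplus>\<^bsub>R\<^esub> f z y"
    "r \<in> carrier R \<Longrightarrow> x \<in> carrier M \<Longrightarrow> y \<in> carrier M \<Longrightarrow> f (r \<odot>\<^bsub>M\<^esub> x) y = r \<otimes>\<^bsub>R\<^esub> f x y"
    "r \<in> carrier R \<Longrightarrow> x \<in> carrier M \<Longrightarrow> y \<in> carrier M \<Longrightarrow> f x (r \<odot>\<^bsub>M\<^esub> y) = r \<otimes>\<^bsub>R\<^esub> f x y"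
proof -
  have r: "(\<lambda>y\<in>carrier M. f x y) \<in> dual_module R M" if "x \<in> carrier M" for x
    using f that by (simp add: bilinear_form_def)
  have l: "(\<lambda>x\<in>carrier M. f x y) \<in> dual_module R M" if "y \<in> carrier M" for y
    using f that by (simp add: bilinear_form_def)
  show "x \<in> carrier M \<Longrightarrow> y \<in> carrier M \<Longrightarrow> f x y \<in> carrier R"
    using dual_moduleD(1)[OF r, of x y] by simp
  show "x \<in> carrier M \<Longrightarrow> y \<in> carrier M \<Longrightarrow> z \<in> carrier M \<Longrightarrow> f (x \<oplus>\<^bsub>M\<^esub> y) z = f x z \<oplus>\<^bsub>R\<^esub> f y z"
    using dual_moduleD(2)[OF l, of z x y] closed(1)[of x y] by simp
  show "x \<in> carrier M \<Longrightarrow> y \<in> carrier M \<Longrightarrow> z \<in> carrier M \<Longrightarrow> f z (x \<oplus>\<^bsub>M\<^esub> y) = f z x \<oplus>\<^bsub>R\<^esub> f z y"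
    using dual_moduleD(2)[OF r, of z x y] closed(1)[of x y] by simp
  show "r \<in> carrier R \<Longrightarrow> x \<in> carrier M \<Longrightarrow> y \<in> carrier M \<Longrightarrow> f (r \<odot>\<^bsub>M\<^esub> x) y = r \<otimes>\<^bsub>R\<^esub> f x y"
    using dual_moduleD(3)[OF l, of y r x] closed(2)[of r x] by simp
  show "r \<in> carrier R \<Longrightarrow> x \<in> carrier M \<Longrightarrow> y \<in> carrier M \<Longrightarrow> f x (r \<odot>\<^bsub>M\<^esub> y) = r \<otimes>\<^bsub>R\<^esub> f x y"
    using dual_moduleD(3)[OF r, of x r y] closed(2)[of r y] by simp
qed

locale symplectic_tower = cyclotomic_tower l vF vK i j \<zeta> bar
  for l :: nat and vF :: "'f::field_char_0 \<Rightarrow> int" and vK :: "'k::field \<Rightarrow> int"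
    and i :: "'f \<Rightarrow> 'k" and j :: "'k \<Rightarrow> 'l::field" and \<zeta> :: 'l and bar :: "'l \<Rightarrow> 'l" +
  fixes N :: "'n monoid" and W :: "('k, 'w) module" and \<rho> :: "'n \<Rightarrow> 'w \<Rightarrow> 'w" and f1 :: "'w \<Rightarrow> 'w \<Rightarrow> 'k"
  assumes group_N: "group N" and finite_N: "finite (carrier N)" and order_N: "\<not> l dvd Coset.order N"
    and repr: "group_ring_module ring_of_type_algebra N W \<rho>"
    and W_nonzero: "carrier W \<noteq> {\<zero>\<^bsub>W\<^esub>}"
    and abs_simple: "absolutely_simple N W \<rho>" and faithful: "acts_faithfully N W \<rho>"
    and f1: "symplectic_form ring_of_type_algebra N W \<rho> f1"
begin

sublocale N: group N by (rule group_N)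

sublocale E: extended_scalars j W
  by (rule extended_scalars.intro) (use repr in \<open>auto simp: group_ring_module_def j_hom\<close>)

abbreviation "K \<equiv> ring_of_type_algebra :: 'k ring"
abbreviation "V \<equiv> tensor K W (ext_module j)"
abbreviation "pt \<equiv> pure_tensor K W (ext_module j)"
abbreviation "sc \<equiv> E.sc"
abbreviation "tm f c \<equiv> tensor_map K W (ext_module j) f (\<lambda>y. c * y)"

lemma ex_nonzero: "\<exists>w\<in>carrier W. w \<noteq> \<zero>\<^bsub>W\<^esub>"
  using W_nonzero E.M.M.zero_closed by blast

lemma \<rho>: "n \<in> carrier N \<Longrightarrow> \<rho> n \<in> linear_maps K W W"
  "n \<in> carrier N \<Longrightarrow> x \<in> carrier W \<Longrightarrow> \<rho> n x \<in> carrier W"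
  "x \<in> carrier W \<Longrightarrow> \<rho> \<one>\<^bsub>N\<^esub> x = x"
  "n \<in> carrier N \<Longrightarrow> m \<in> carrier N \<Longrightarrow> x \<in> carrier W \<Longrightarrow> \<rho> (n \<otimes>\<^bsub>N\<^esub> m) x = \<rho> n (\<rho> m x)"
  using repr by (auto simp: group_ring_module_def linear_maps_def)

lemma linear_mapsD:
  assumes "f \<in> linear_maps K W W"
  shows "x \<in> carrier W \<Longrightarrow> f x \<in> carrier W" "x \<in> carrier W \<Longrightarrow> y \<in> carrier W \<Longrightarrow> f (x \<oplus>\<^bsub>W\<^esub> y) = f x \<oplus>\<^bsub>W\<^esub> f y"
    "x \<in> carrier W \<Longrightarrow> f (a \<odot>\<^bsub>W\<^esub> x) = a \<odot>\<^bsub>W\<^esub> f x"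
  using assms by (auto simp: linear_maps_def)

lemma W_smult: "x \<in> carrier W \<Longrightarrow> a \<odot>\<^bsub>W\<^esub> x \<in> carrier W"
  "x \<in> carrier W \<Longrightarrow> y \<in> carrier W \<Longrightarrow> a \<odot>\<^bsub>W\<^esub> (x \<oplus>\<^bsub>W\<^esub> y) = a \<odot>\<^bsub>W\<^esub> x \<oplus>\<^bsub>W\<^esub> a \<odot>\<^bsub>W\<^esub> y"
  by (simp_all add: E.M.smult_r_distr)

lemma f1_bilinear: "bilinear_form K W f1"
  and f1_alt: "x \<in> carrier W \<Longrightarrow> f1 x x = 0"
  and f1_nondeg: "x \<in> carrier W \<Longrightarrow> (\<And>y. y \<in> carrier W \<Longrightarrow> f1 x y = 0) \<Longrightarrow> x = \<zero>\<^bsub>W\<^esub>"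
  and f1_inv: "n \<in> carrier N \<Longrightarrow> x \<in> carrier W \<Longrightarrow> y \<in> carrier W \<Longrightarrow> f1 (\<rho> n x) (\<rho> n y) = f1 x y"
  using f1 by (auto simp: symplectic_form_def alternating_form_def nondegenerate_form_def invariant_form_def)

lemma f1_simps:
  "x \<in> carrier W \<Longrightarrow> y \<in> carrier W \<Longrightarrow> z \<in> carrier W \<Longrightarrow> f1 (x \<oplus>\<^bsub>W\<^esub> y) z = f1 x z + f1 y z"
  "x \<in> carrier W \<Longrightarrow> y \<in> carrier W \<Longrightarrow> z \<in> carrier W \<Longrightarrow> f1 z (x \<oplus>\<^bsub>W\<^esub> y) = f1 z x + f1 z y"
  "x \<in> carrier W \<Longrightarrow> y \<in> carrier W \<Longrightarrow> f1 (a \<odot>\<^bsub>W\<^esub> x) y = a * f1 x y"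
  "x \<in> carrier W \<Longrightarrow> y \<in> carrier W \<Longrightarrow> f1 x (a \<odot>\<^bsub>W\<^esub> y) = a * f1 x y"
  using bilinear_formD[OF f1_bilinear] by auto

lemma f1_skew: "x \<in> carrier W \<Longrightarrow> y \<in> carrier W \<Longrightarrow> f1 y x = - f1 x y"
proof -
  assume *: "x \<in> carrier W" "y \<in> carrier W"
  then have "f1 (x \<oplus>\<^bsub>W\<^esub> y) (x \<oplus>\<^bsub>W\<^esub> y) = f1 y x + f1 x y"
    by (simp add: f1_simps f1_alt[of x] f1_alt[of y])
  then show ?thesis using f1_alt[of "x \<oplus>\<^bsub>W\<^esub> y"] * by (simp add: eq_neg_iff_add_eq_0)
qed

lemma linear_re_im:
  "Vector_Spaces.linear (\<lambda>c y. j c * y) (*) re" "Vector_Spaces.linear (\<lambda>c y. j c * y) (*) im"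
  by (unfold_locales; simp add: j_simps algebra_simps)+

text \<open>The map id \<otimes> \<theta> on V, fixed by choice since \<open>contraction\<close>
  only gives its existence; on V its values are determined by those on pure tensors.\<close>

definition coordinate :: "('l \<Rightarrow> 'k) \<Rightarrow> ('w \<times> 'l \<Rightarrow>\<^sub>0 int) set \<Rightarrow> 'w" where
  "coordinate \<theta> = (SOME C. C \<in> carrier V \<rightarrow> carrier W \<and>
    (\<forall>u\<in>carrier V. \<forall>v\<in>carrier V. C (u \<oplus>\<^bsub>V\<^esub> v) = C u \<oplus>\<^bsub>W\<^esub> C v) \<and>
    (\<forall>x\<in>carrier W. \<forall>y. C (pt x y) = \<theta> y \<odot>\<^bsub>W\<^esub> x))"

lemma coordinate:
  assumes "Vector_Spaces.linear (\<lambda>c y. j c * y) (*) \<theta>"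
  shows "u \<in> carrier V \<Longrightarrow> coordinate \<theta> u \<in> carrier W"
    "u \<in> carrier V \<Longrightarrow> v \<in> carrier V \<Longrightarrow> coordinate \<theta> (u \<oplus>\<^bsub>V\<^esub> v) = coordinate \<theta> u \<oplus>\<^bsub>W\<^esub> coordinate \<theta> v"
    "x \<in> carrier W \<Longrightarrow> coordinate \<theta> (pt x y) = \<theta> y \<odot>\<^bsub>W\<^esub> x"
proof -
  have "\<exists>C. C \<in> carrier V \<rightarrow> carrier W \<and>
    (\<forall>u\<in>carrier V. \<forall>v\<in>carrier V. C (u \<oplus>\<^bsub>V\<^esub> v) = C u \<oplus>\<^bsub>W\<^esub> C v) \<and>
    (\<forall>x\<in>carrier W. \<forall>y. C (pt x y) = \<theta> y \<odot>\<^bsub>W\<^esub> x)"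
    using E.contraction[OF assms] by metis
  from someI_ex[OF this, folded coordinate_def]
  show "u \<in> carrier V \<Longrightarrow> coordinate \<theta> u \<in> carrier W"
    "u \<in> carrier V \<Longrightarrow> v \<in> carrier V \<Longrightarrow> coordinate \<theta> (u \<oplus>\<^bsub>V\<^esub> v) = coordinate \<theta> u \<oplus>\<^bsub>W\<^esub> coordinate \<theta> v"
    "x \<in> carrier W \<Longrightarrow> coordinate \<theta> (pt x y) = \<theta> y \<odot>\<^bsub>W\<^esub> x" by auto
qed

text \<open>\<open>P\<close> and \<open>Q\<close> are the components for the basis 1, \<delta> of
  \<open>L\<close>. Equality in \<open>V\<close> is tested on them, so no representative of a coset
  is handled any more.\<close>

definition "P = coordinate re"
definition "Q = coordinate im"

lemmas P_simps = coordinate[OF linear_re_im(1), folded P_def]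
lemmas Q_simps = coordinate[OF linear_re_im(2), folded Q_def]

lemma V_decompose: "u \<in> carrier V \<Longrightarrow> u = pt (P u) 1 \<oplus>\<^bsub>V\<^esub> pt (Q u) \<delta>"
proof (induction rule: E.tensor_induct)
  case (pure x y)
  have "pt (re y \<odot>\<^bsub>W\<^esub> x) 1 = pt x (j (re y))" "pt (im y \<odot>\<^bsub>W\<^esub> x) \<delta> = pt x (j (im y) * \<delta>)"
    using E.pt_balanced[of "re y" x 1] E.pt_balanced[of "im y" x \<delta>] pure by simp_all
  moreover have "pt x y = pt x (j (re y) + j (im y) * \<delta>)"
    using re_im[of y] by (simp add: mult.commute)
  ultimately have "pt x y = pt (re y \<odot>\<^bsub>W\<^esub> x) 1 \<oplus>\<^bsub>V\<^esub> pt (im y \<odot>\<^bsub>W\<^esub> x) \<delta>"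
    using pure E.pt_add_right[of x "j (re y)" "j (im y) * \<delta>"] by simp
  then show ?case unfolding P_simps(3)[OF pure(1)] Q_simps(3)[OF pure(1)] .
next
  case (add u v)
  have "pt (P u) 1 \<oplus>\<^bsub>V\<^esub> pt (Q u) \<delta> \<oplus>\<^bsub>V\<^esub> (pt (P v) 1 \<oplus>\<^bsub>V\<^esub> pt (Q v) \<delta>)
    = pt (P (u \<oplus>\<^bsub>V\<^esub> v)) 1 \<oplus>\<^bsub>V\<^esub> pt (Q (u \<oplus>\<^bsub>V\<^esub> v)) \<delta>"
    using add(1,2) by (simp add: P_simps Q_simps E.pt_add_left E.T.a_ac)
  then show ?case using add by metis
qed

lemma V_eqI: "u \<in> carrier V \<Longrightarrow> v \<in> carrier V \<Longrightarrow> P u = P v \<Longrightarrow> Q u = Q v \<Longrightarrow> u = v"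
  using V_decompose by metis

text \<open>Expand the product of re c + \<delta> im c with P u + \<delta> Q u, using that \<delta>
  has square \<pi>.\<close>

lemma P_tm: "f \<in> linear_maps K W W \<Longrightarrow> u \<in> carrier V \<Longrightarrow>
    P (tm f c u) = re c \<odot>\<^bsub>W\<^esub> f (P u) \<oplus>\<^bsub>W\<^esub> (\<pi> * im c) \<odot>\<^bsub>W\<^esub> f (Q u)"
  and Q_tm: "f \<in> linear_maps K W W \<Longrightarrow> u \<in> carrier V \<Longrightarrow>
    Q (tm f c u) = re c \<odot>\<^bsub>W\<^esub> f (Q u) \<oplus>\<^bsub>W\<^esub> im c \<odot>\<^bsub>W\<^esub> f (P u)"
proof -
  assume f: "f \<in> linear_maps K W W" and u: "u \<in> carrier V"
  note tm = E.tensor_map_closed[OF f E.mult_linear] E.tensor_map_add[OF f E.mult_linear]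
    E.tensor_map_pt[OF f E.mult_linear]
  note simps = P_simps Q_simps tm linear_mapsD[OF f] W_smult E.M_simps E.M.M.a_ac
  show "P (tm f c u) = re c \<odot>\<^bsub>W\<^esub> f (P u) \<oplus>\<^bsub>W\<^esub> (\<pi> * im c) \<odot>\<^bsub>W\<^esub> f (Q u)"
    using u by (induction rule: E.tensor_induct) (simp_all add: simps)
  show "Q (tm f c u) = re c \<odot>\<^bsub>W\<^esub> f (Q u) \<oplus>\<^bsub>W\<^esub> im c \<odot>\<^bsub>W\<^esub> f (P u)"
    using u by (induction rule: E.tensor_induct) (simp_all add: simps)
qed

lemma P_sc: "u \<in> carrier V \<Longrightarrow> P (sc c u) = re c \<odot>\<^bsub>W\<^esub> P u \<oplus>\<^bsub>W\<^esub> (\<pi> * im c) \<odot>\<^bsub>W\<^esub> Q u"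
  and Q_sc: "u \<in> carrier V \<Longrightarrow> Q (sc c u) = re c \<odot>\<^bsub>W\<^esub> Q u \<oplus>\<^bsub>W\<^esub> im c \<odot>\<^bsub>W\<^esub> P u"
  using P_tm[OF E.id_linear(1)] Q_tm[OF E.id_linear(1)] by (simp_all add: E.sc_def)

lemma P_smult: "u \<in> carrier V \<Longrightarrow> P (a \<odot>\<^bsub>V\<^esub> u) = a \<odot>\<^bsub>W\<^esub> P u"
  and Q_smult: "u \<in> carrier V \<Longrightarrow> Q (a \<odot>\<^bsub>V\<^esub> u) = a \<odot>\<^bsub>W\<^esub> Q u"
  using P_sc[of u "j a"] Q_sc[of u "j a"] by (simp_all add: E.sc_smult P_simps Q_simps E.M_simps)

lemma P_Q_zero: "P \<zero>\<^bsub>V\<^esub> = \<zero>\<^bsub>W\<^esub>" "Q \<zero>\<^bsub>V\<^esub> = \<zero>\<^bsub>W\<^esub>"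
  using P_smult[of "\<zero>\<^bsub>V\<^esub>" 0] Q_smult[of "\<zero>\<^bsub>V\<^esub>" 0] E.sc_smult[of "\<zero>\<^bsub>V\<^esub>" 0] E.sc_zero
  by (simp_all add: E.M_simps P_simps Q_simps)

section \<open>The group G and its invariant form on V\<close>

abbreviation "\<mu> \<equiv> subgroup_generated (units_of (ring_of_type_algebra :: 'l ring)) {\<zeta>}"
abbreviation "G \<equiv> N \<times>\<times> \<mu>"
abbreviation "\<rho>V \<equiv> (\<lambda>(n, z). tm (\<rho> n) z)"

lemma group_\<mu>: "group \<mu>"
proof -
  interpret L: field "ring_of_type_algebra :: 'l ring" by (rule field_from_type_algebra)
  show ?thesis using L.units_group by (rule group.group_subgroup_generated)
qed

lemma \<mu>_simps: "\<one>\<^bsub>\<mu>\<^esub> = 1" "\<one>\<^bsub>units_of (ring_of_type_algebra :: 'l ring)\<^esub> = 1" "x \<otimes>\<^bsub>\<mu>\<^esub> y = x * y"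
  "x \<otimes>\<^bsub>units_of (ring_of_type_algebra :: 'l ring)\<^esub> y = x * y"
  by (simp_all add: subgroup_generated_def units_of_def)

lemma \<mu>_elem: "z \<in> carrier \<mu> \<Longrightarrow> z ^ l = 1 \<and> z * bar z = 1"
  and \<mu>_\<zeta>: "\<zeta> \<in> carrier \<mu>" "inverse \<zeta> \<in> carrier \<mu>"
proof -
  interpret L: field "ring_of_type_algebra :: 'l ring" by (rule field_from_type_algebra)
  let ?U = "units_of (ring_of_type_algebra :: 'l ring)"
  have U: "carrier ?U = - {0}"
    using L.field_Units by (auto simp: units_of_def)
  have inv_L: "inv\<^bsub>ring_of_type_algebra\<^esub> x = inverse x" if "x \<noteq> 0" for x :: 'l
    by (rule L.comm_inv_char) (use that in simp_all)
  have inv_U: "inv\<^bsub>?U\<^esub> \<zeta> = inverse \<zeta>"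
    using L.units_of_inv[of \<zeta>] U \<zeta>_simps inv_L by (simp add: units_of_def)
  have C: "carrier \<mu> = generate ?U {\<zeta>}"
    using U \<zeta>_simps by (simp add: carrier_subgroup_generated)
  show "\<zeta> \<in> carrier \<mu>" "inverse \<zeta> \<in> carrier \<mu>"
    unfolding C using generate.incl[of \<zeta> "{\<zeta>}" ?U] generate.inv[of \<zeta> "{\<zeta>}" ?U] inv_U by auto
  assume "z \<in> carrier \<mu>"
  then have "z \<in> generate ?U {\<zeta>}" by (simp add: C)
  then show "z ^ l = 1 \<and> z * bar z = 1"
  proof induction
    case one
    then show ?case by (simp add: units_of_def bar_simps)
  next
    case (incl h)
    then show ?case using \<zeta>_simps by (simp add: bar_\<zeta>)
  next
    case (inv h)
    then show ?case using \<zeta>_simps inv_U by (simp add: bar_\<zeta> bar_simps power_inverse)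
  next
    case (eng g h)
    have "g * h * bar (g * h) = (g * bar g) * (h * bar h)" by (simp add: bar_simps mult_ac)
    with eng show ?case by (simp add: units_of_def power_mult_distrib)
  qed
qed

text \<open>Such an element is fixed by \<open>bar\<close> and has norm 1, so its square is 1; its
  order divides the odd number \<open>l\<close>.\<close>

lemma \<mu>_real: "z \<in> carrier \<mu> \<Longrightarrow> im z = 0 \<Longrightarrow> z = 1"
proof -
  assume z: "z \<in> carrier \<mu>" "im z = 0"
  then have "bar z = z" by (intro re_im_eqI) simp_all
  then have "z ^ 2 = 1" using \<mu>_elem[OF z(1)] by (simp add: power2_eq_square)
  moreover have "z ^ l = (z ^ 2) ^ hl * z" by (subst l_eq) (simp add: power_mult)
  ultimately show "z = 1" using \<mu>_elem[OF z(1)] by simp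
qed

lemma \<rho>V_linear: "g \<in> carrier G \<Longrightarrow> \<rho>V g \<in> linear_maps K V V"
  by (auto intro!: E.tensor_map_linear \<rho> E.mult_linear)

lemma group_G: "group G"
  by (rule DirProd_group[OF group_N group_\<mu>])

lemma group_ring_module_V: "group_ring_module K G V \<rho>V"
  unfolding group_ring_module_def
proof (intro conjI ballI)
  show "module K V" by (rule E.module_T)
  show "group G" by (rule group_G)
  show "\<rho>V g \<in> linear_maps K V V" if "g \<in> carrier G" for g using that by (rule \<rho>V_linear)
  fix u assume u: "u \<in> carrier V"
  note tm = E.tensor_map_closed[OF \<rho>(1) E.mult_linear] E.tensor_map_add[OF \<rho>(1) E.mult_linear]
    E.tensor_map_pt[OF \<rho>(1) E.mult_linear]
  have "tm (\<rho> \<one>\<^bsub>N\<^esub>) 1 u = u"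
    using u
  proof (induction rule: E.tensor_induct)
    case (pure x y)
    then show ?case using tm(3)[OF N.one_closed, of x y 1] by (simp add: \<rho>)
  next
    case (add u v)
    then show ?case using tm(2)[OF N.one_closed, of u v 1] by simp
  qed
  then show "\<rho>V \<one>\<^bsub>G\<^esub> u = u" by (simp only: one_DirProd \<mu>_simps case_prod_conv)
  fix g h assume "g \<in> carrier G" "h \<in> carrier G"
  then obtain n z m z' where g: "g = (n, z)" "n \<in> carrier N" and h: "h = (m, z')" "m \<in> carrier N" by auto
  then have nm: "n \<otimes>\<^bsub>N\<^esub> m \<in> carrier N" by simp
  have "tm (\<rho> (n \<otimes>\<^bsub>N\<^esub> m)) (z * z') u = tm (\<rho> n) z (tm (\<rho> m) z' u)"
    using u
  proof (induction rule: E.tensor_induct)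
    case (pure x y)
    then show ?case
      using tm(3)[OF nm, of x y "z * z'"] tm(3)[OF h(2), of x y z'] tm(3)[OF g(2), of "\<rho> m x" "z' * y" z] g(2) h(2)
      by (simp add: \<rho> mult.assoc)
  next
    case (add u v)
    show ?case
      using tm(2)[OF nm, of u v "z * z'"] tm(2)[OF h(2), of u v z'] tm(1)[OF h(2)] add
        tm(2)[OF g(2), of "tm (\<rho> m) z' u" "tm (\<rho> m) z' v" z] by simp
  qed
  then show "\<rho>V (g \<otimes>\<^bsub>G\<^esub> h) u = \<rho>V g (\<rho>V h u)" using g h by (simp add: \<mu>_simps)
qed

text \<open>Testing on \<open>pt w 1\<close> separates the two factors: the \<delta>-component
  forces \<open>z\<close> into \<open>K\<close>, hence \<open>z = 1\<close>, and what is left is the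
  faithfulness of \<open>W\<close>.\<close>

lemma acts_faithfully_V: "acts_faithfully G V \<rho>V"
  unfolding acts_faithfully_def
proof (intro ballI impI)
  fix g assume "g \<in> carrier G" and triv: "\<forall>x\<in>carrier V. \<rho>V g x = x"
  then obtain n z where g: "g = (n, z)" "n \<in> carrier N" "z \<in> carrier \<mu>" by auto
  have *: "re z \<odot>\<^bsub>W\<^esub> \<rho> n w = w" "im z \<odot>\<^bsub>W\<^esub> \<rho> n w = \<zero>\<^bsub>W\<^esub>" if w: "w \<in> carrier W" for w
  proof -
    have eq: "pt (\<rho> n w) z = pt w 1"
      using triv w g E.tensor_map_pt[OF \<rho>(1)[OF g(2)] E.mult_linear, of w 1 z] by force
    have "P (pt (\<rho> n w) z) = P (pt w 1)" "Q (pt (\<rho> n w) z) = Q (pt w 1)" by (simp_all only: eq)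
    then show "re z \<odot>\<^bsub>W\<^esub> \<rho> n w = w" "im z \<odot>\<^bsub>W\<^esub> \<rho> n w = \<zero>\<^bsub>W\<^esub>"
      using w g(2) by (simp_all add: P_simps Q_simps \<rho> E.M_simps)
  qed
  have "im z = 0"
  proof (rule ccontr)
    assume nz: "im z \<noteq> 0"
    obtain w where w: "w \<in> carrier W" "w \<noteq> \<zero>\<^bsub>W\<^esub>" using ex_nonzero by auto
    have "\<rho> n w = (inverse (im z) * im z) \<odot>\<^bsub>W\<^esub> \<rho> n w"
      using nz w g by (simp add: E.M_simps \<rho>)
    also have "\<dots> = inverse (im z) \<odot>\<^bsub>W\<^esub> \<zero>\<^bsub>W\<^esub>"
      using w g *(2)[OF w(1)] E.M_simps(2)[of "\<rho> n w"] by (simp add: \<rho>)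
    also have "\<dots> = \<zero>\<^bsub>W\<^esub>" using E.M.smult_r_null[of "inverse (im z)"] by simp
    finally have "re z \<odot>\<^bsub>W\<^esub> \<rho> n w = \<zero>\<^bsub>W\<^esub>" using E.M.smult_r_null[of "re z"] by simp
    then show False using *(1)[OF w(1)] w by simp
  qed
  then have z: "z = 1" using g(3) \<mu>_real by blast
  then have "\<forall>w\<in>carrier W. \<rho> n w = w" using *(1) g(2) by (simp add: E.M_simps \<rho>)
  then have "n = \<one>\<^bsub>N\<^esub>" using faithful g(2) by (auto simp: acts_faithfully_def)
  then show "g = \<one>\<^bsub>G\<^esub>" using g z by (simp add: \<mu>_simps)
qed

text \<open>With respect to \<open>V = W \<oplus> \<delta> W\<close> the form \<open>f1 \<otimes> f2\<close> is an orthogonal sum.\<close>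

definition "fV u v = 2 * f1 (P u) (P v) - 2 * \<pi> * f1 (Q u) (Q v)"

lemma fV_bilinear: "bilinear_form K V fV"
  unfolding bilinear_form_def dual_module_def
  by (auto simp: fV_def P_simps Q_simps P_smult Q_smult f1_simps algebra_simps E.module_T[THEN module.smult_closed, simplified])

text \<open>The trace is twice the real part, and \<delta> times its conjugate is -\<pi>; this
  explains the coefficients 2 and -2\<pi> of \<open>fV\<close>.\<close>

lemma is_tensor_form_fV: "is_tensor_form K W (ext_module j) f1 (\<lambda>x y. field_trace j (x * bar y)) fV"
  unfolding is_tensor_form_def
  by (auto simp: fV_bilinear field_trace_eq fV_def P_simps Q_simps f1_simps algebra_simps)

lemma symplectic_form_fV: "symplectic_form K G V \<rho>V fV"
  unfolding symplectic_form_def alternating_form_def nondegenerate_form_def invariant_form_def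
proof (intro conjI ballI impI)
  show "bilinear_form K V fV" by (rule fV_bilinear)
  show "fV u u = \<zero>\<^bsub>K\<^esub>" if "u \<in> carrier V" for u
    using that by (simp add: fV_def f1_alt P_simps Q_simps)
  have skew: "fV v u = - fV u v" if "u \<in> carrier V" "v \<in> carrier V" for u v
    using that f1_skew[of "P u" "P v"] f1_skew[of "Q u" "Q v"] by (simp add: fV_def P_simps Q_simps)
  show zero: "u = \<zero>\<^bsub>V\<^esub>" if u: "u \<in> carrier V" and *: "\<forall>v\<in>carrier V. fV u v = \<zero>\<^bsub>K\<^esub>" for u
  proof (rule V_eqI[OF u])
    have f1_0: "f1 \<zero>\<^bsub>W\<^esub> y = 0" "f1 y \<zero>\<^bsub>W\<^esub> = 0" if "y \<in> carrier W" for y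
      using f1_simps(3,4)[of "\<zero>\<^bsub>W\<^esub>" y 0] f1_simps(4)[of y "\<zero>\<^bsub>W\<^esub>" 0] that by (simp_all add: E.M_simps)
    \<comment> \<open>The test vectors w \<otimes> 1 here and w \<otimes> \<delta> below each see
      only one of the two orthogonal summands.\<close>
    have "f1 (P u) w = 0" if "w \<in> carrier W" for w
      using *[rule_format, of "pt w 1"] that u two_K by (simp add: fV_def P_simps Q_simps E.M_simps f1_0)
    then show "P u = P \<zero>\<^bsub>V\<^esub>" using f1_nondeg[of "P u"] u by (simp add: P_Q_zero P_simps)
    have "f1 (Q u) w = 0" if "w \<in> carrier W" for w
      using *[rule_format, of "pt w \<delta>"] that u two_K \<pi>_nonzero
      by (simp add: fV_def P_simps Q_simps E.M_simps f1_0)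
    then show "Q u = Q \<zero>\<^bsub>V\<^esub>" using f1_nondeg[of "Q u"] u by (simp add: P_Q_zero Q_simps)
  qed simp
  show "u = \<zero>\<^bsub>V\<^esub>" if u: "u \<in> carrier V" and *: "\<forall>v\<in>carrier V. fV v u = \<zero>\<^bsub>K\<^esub>" for u
    using zero[OF u] * skew[OF u] by simp
  fix g u v assume "g \<in> carrier G" and u: "u \<in> carrier V" and v: "v \<in> carrier V"
  then obtain n z where g: "g = (n, z)" "n \<in> carrier N" "z \<in> carrier \<mu>" by auto
  \<comment> \<open>An element \<open>z\<close> of \<open>L\<close> scales the form by its norm, and
    on \<mu> the norm is 1.\<close>
  have "re z * re z - \<pi> * (im z * im z) = re (z * bar z)" by simp
  then have norm: "re z * re z - \<pi> * (im z * im z) = 1" using \<mu>_elem[OF g(3)] by simp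
  have "fV (\<rho>V g u) (\<rho>V g v) = (re z * re z - \<pi> * (im z * im z)) * fV u v"
    using g u v by (simp add: fV_def P_tm[OF \<rho>(1)] Q_tm[OF \<rho>(1)] f1_simps \<rho> P_simps Q_simps f1_inv algebra_simps)
  then show "fV (\<rho>V g u) (\<rho>V g v) = fV u v" using norm by simp
qed

end

section \<open>Invariant lattices\<close>

text \<open>The images of the first \<open>card S + 1\<close> monomials lie in a space spanned by
  \<open>card S\<close> vectors, so they satisfy a linear relation.\<close>

lemma (in vector_space) ex_poly_in_kernel:
  fixes h :: "'a poly \<Rightarrow> 'b"
  assumes add: "\<And>p q. h (p + q) = h p + h q" and smult: "\<And>c p. h (Polynomial.smult c p) = scale c (h p)"
    and S: "finite S" "\<And>p. h p \<in> span S"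
  shows "\<exists>p. p \<noteq> 0 \<and> h p = 0"
proof -
  have zero: "h 0 = 0" using smult[of 0 0] by simp
  have hsum: "h (sum g A) = (\<Sum>a\<in>A. h (g a))" for g :: "nat \<Rightarrow> 'a poly" and A
    by (induction A rule: infinite_finite_induct) (simp_all add: zero add)
  let ?v = "\<lambda>k. h (monom 1 k)"
  let ?I = "{..card S}"
  show ?thesis
  proof (cases "inj_on ?v ?I")
    \<comment> \<open>\<open>dependent\<close> speaks of sets and does not notice repeated vectors;
      here the difference of two monomials with equal image is the polynomial sought.\<close>
    case False
    then obtain a b where ab: "a \<noteq> b" "?v a = ?v b" by (auto simp: inj_on_def)
    have "h (monom 1 a + Polynomial.smult (- 1) (monom 1 b)) = 0"
      unfolding add smult using ab by simp
    moreover have "coeff (monom 1 a + Polynomial.smult (- 1) (monom 1 b)) a = (1 :: 'a)" using ab by simp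
    then have "monom 1 a + Polynomial.smult (- 1) (monom 1 b) \<noteq> (0 :: 'a poly)" by (metis coeff_0 zero_neq_one)
    ultimately show ?thesis by blast
  next
    case True
    have "dependent (?v ` ?I)"
    proof (rule ccontr)
      assume "\<not> dependent (?v ` ?I)"
      then have "card (?v ` ?I) \<le> card S"
        using independent_span_bound[OF S(1), of "?v ` ?I"] S(2) by auto
      then show False using True by (simp add: card_image)
    qed
    then obtain u x where u: "(\<Sum>x\<in>?v ` ?I. scale (u x) x) = 0" "x \<in> ?v ` ?I" "u x \<noteq> 0"
      by (auto simp: dependent_finite)
    then obtain k where k: "k \<in> ?I" "u (?v k) \<noteq> 0" by auto
    define p where "p = (\<Sum>k\<in>?I. Polynomial.smult (u (?v k)) (monom 1 k))"
    have "h p = (\<Sum>k\<in>?I. scale (u (?v k)) (?v k))" by (simp only: p_def hsum smult)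
    also have "\<dots> = 0" using u(1) True by (simp add: sum.reindex)
    finally have "h p = 0" .
    moreover have "coeff p k = u (?v k)" using k by (simp add: p_def coeff_sum if_distrib[of "(*) _"] sum.delta cong: if_cong)
    then have "p \<noteq> 0" using k by auto
    ultimately show ?thesis by blast
  qed
qed

context symplectic_tower
begin

text \<open>
  Pairing with \<open>f1\<close> embeds \<open>W\<close>, and after extension of scalars \<open>V\<close>, into a type of functions, where
  the linear algebra of the locale \<open>vector_space\<close> is available.
\<close>

definition "EW w = (\<lambda>w'. if w' \<in> carrier W then f1 w w' else 0)"
definition "EV u = (\<lambda>w'. j (EW (P u) w') + \<delta> * j (EW (Q u) w'))"
definition "scaleK c g = (\<lambda>w :: 'w. c * g w :: 'k)"
definition "scaleL c g = (\<lambda>w :: 'w. c * g w :: 'l)"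

sublocale VK: vector_space scaleK
  by unfold_locales (simp_all add: scaleK_def fun_eq_iff algebra_simps)

sublocale VL: vector_space scaleL
  by unfold_locales (simp_all add: scaleL_def fun_eq_iff algebra_simps)

lemma EW_simps: "x \<in> carrier W \<Longrightarrow> y \<in> carrier W \<Longrightarrow> EW (x \<oplus>\<^bsub>W\<^esub> y) = EW x + EW y"
  "x \<in> carrier W \<Longrightarrow> EW (a \<odot>\<^bsub>W\<^esub> x) = scaleK a (EW x)"
  by (auto simp: EW_def f1_simps scaleK_def fun_eq_iff)

lemma EW_eqD: "x \<in> carrier W \<Longrightarrow> y \<in> carrier W \<Longrightarrow> EW x = EW y \<Longrightarrow> x = y"
proof -
  assume x: "x \<in> carrier W" and y: "y \<in> carrier W" and eq: "EW x = EW y"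
  let ?d = "x \<oplus>\<^bsub>W\<^esub> (- 1) \<odot>\<^bsub>W\<^esub> y"
  have "f1 x w = f1 y w" if "w \<in> carrier W" for w
    using fun_cong[OF eq, of w] that by (simp add: EW_def)
  then have "f1 ?d w = 0" if "w \<in> carrier W" for w
    using that x y by (simp add: f1_simps W_smult)
  then have 1: "?d = \<zero>\<^bsub>W\<^esub>" using x y by (intro f1_nondeg) (simp_all add: W_smult)
  have "((- 1) + 1) \<odot>\<^bsub>W\<^esub> y = (- 1) \<odot>\<^bsub>W\<^esub> y \<oplus>\<^bsub>W\<^esub> 1 \<odot>\<^bsub>W\<^esub> y" by (rule E.M_simps(1)[OF y])
  then have "(- 1) \<odot>\<^bsub>W\<^esub> y \<oplus>\<^bsub>W\<^esub> y = \<zero>\<^bsub>W\<^esub>" using y by (simp add: E.M_simps)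
  then have "x = ?d \<oplus>\<^bsub>W\<^esub> y"
    using x y W_smult(1)[OF y, of "- 1"] by (simp add: E.M.M.a_assoc)
  then show "x = y" using 1 y by simp
qed

lemma re_EV: "re (EV u w) = EW (P u) w" and im_EV: "im (EV u w) = EW (Q u) w"
  by (simp_all add: EV_def)

lemma EV_add: "u \<in> carrier V \<Longrightarrow> v \<in> carrier V \<Longrightarrow> EV (u \<oplus>\<^bsub>V\<^esub> v) = EV u + EV v"
  by (rule ext, rule re_im_eqI) (simp_all add: re_EV im_EV P_simps Q_simps EW_simps)

lemma EV_sc: "u \<in> carrier V \<Longrightarrow> EV (sc c u) = scaleL c (EV u)"
  by (rule ext, rule re_im_eqI)
    (simp_all add: re_EV im_EV P_sc Q_sc P_simps Q_simps W_smult EW_simps scaleK_def scaleL_def algebra_simps)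

lemma EV_smult: "u \<in> carrier V \<Longrightarrow> EV (a \<odot>\<^bsub>V\<^esub> u) = scaleL (j a) (EV u)"
  using EV_sc[of u "j a"] by (simp add: E.sc_smult)

lemma EV_zero: "EV \<zero>\<^bsub>V\<^esub> = 0"
  using EV_sc[of "\<zero>\<^bsub>V\<^esub>" 0] by (simp add: E.sc_zero scaleL_def fun_eq_iff)

lemma EV_eqD: "u \<in> carrier V \<Longrightarrow> v \<in> carrier V \<Longrightarrow> EV u = EV v \<Longrightarrow> u = v"
proof (rule V_eqI)
  assume u: "u \<in> carrier V" and v: "v \<in> carrier V" and eq: "EV u = EV v"
  have "EW (P u) = EW (P v)" using eq re_EV by (metis ext)
  then show "P u = P v" using u v by (intro EW_eqD) (simp_all add: P_simps)
  have "EW (Q u) = EW (Q v)" using eq im_EV by (metis ext)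
  then show "Q u = Q v" using u v by (intro EW_eqD) (simp_all add: Q_simps)
qed

definition "DV = inv_into (carrier V) EV"

lemma DV_EV [simp]: "u \<in> carrier V \<Longrightarrow> DV (EV u) = u"
  unfolding DV_def using EV_eqD by (intro inv_into_f_f) (auto simp: inj_on_def)

text \<open>The scalars \<open>D\<close> are left open because the same sets are needed as modules
  over \<open>OK\<close> and over \<open>K\<close>. Negatives come from the scalar -1.\<close>

lemma submoduleI':
  assumes "U \<subseteq> carrier V" "\<zero>\<^bsub>V\<^esub> \<in> U" "\<And>x y. x \<in> U \<Longrightarrow> y \<in> U \<Longrightarrow> x \<oplus>\<^bsub>V\<^esub> y \<in> U"
    "\<And>r x. r \<in> carrier D \<Longrightarrow> x \<in> U \<Longrightarrow> r \<odot>\<^bsub>V\<^esub> x \<in> U" "- 1 \<in> carrier D"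
  shows "submodule U D V"
proof -
  interpret MV: module K V by (rule E.module_T)
  have "\<ominus>\<^bsub>V\<^esub> x = (- 1) \<odot>\<^bsub>V\<^esub> x" if "x \<in> carrier V" for x
  proof -
    have "(- 1 + 1) \<odot>\<^bsub>V\<^esub> x = (- 1) \<odot>\<^bsub>V\<^esub> x \<oplus>\<^bsub>V\<^esub> x"
      using MV.smult_l_distr[of "- 1" 1 x] MV.smult_one[of x] that by simp
    then have "(- 1) \<odot>\<^bsub>V\<^esub> x \<oplus>\<^bsub>V\<^esub> x = \<zero>\<^bsub>V\<^esub>" using MV.smult_l_null[of x] that by simp
    then show ?thesis using that MV.smult_closed[of "- 1" x] by (intro E.T.minus_equality) simp_all
  qed
  then have "\<ominus>\<^bsub>V\<^esub> x \<in> U" if "x \<in> U" for x using assms that by auto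
  then show ?thesis
    using assms by (intro submodule.intro subgroup.intro submodule_axioms.intro) (auto simp: a_inv_def[symmetric])
qed

end

section \<open>From an invariant lattice to a unimodular Hermitian form\<close>

locale invariant_lattice = symplectic_tower l vF vK i j \<zeta> bar N W \<rho> f1
  for l :: nat and vF :: "'f::field_char_0 \<Rightarrow> int" and vK :: "'k::field \<Rightarrow> int"
    and i :: "'f \<Rightarrow> 'k" and j :: "'k \<Rightarrow> 'l::field" and \<zeta> :: 'l and bar :: "'l \<Rightarrow> 'l"
    and N :: "'n monoid" and W :: "('k, 'w) module" and \<rho> :: "'n \<Rightarrow> 'w \<Rightarrow> 'w" and f1 :: "'w \<Rightarrow> 'w \<Rightarrow> 'k" +
  fixes OK :: "'k ring" and T :: "('w \<times> 'l \<Rightarrow>\<^sub>0 int) set set"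
    and f' :: "('w \<times> 'l \<Rightarrow>\<^sub>0 int) set \<Rightarrow> ('w \<times> 'l \<Rightarrow>\<^sub>0 int) set \<Rightarrow> 'k"
  assumes OK: "OK = K\<lparr>carrier := valuation_ring vK\<rparr>"
    and lattice: "lattice_in K OK V T" and stable: "stable_under G \<rho>V T"
    and perfect: "perfect_form OK (V\<lparr>carrier := T\<rparr>) f'"
    and alternating: "alternating_form OK (V\<lparr>carrier := T\<rparr>) f'"
    and invariant: "invariant_form G (V\<lparr>carrier := T\<rparr>) \<rho>V f'"
begin

lemma OK_simps: "x \<oplus>\<^bsub>OK\<^esub> y = x + y" "x \<otimes>\<^bsub>OK\<^esub> y = x * y" "\<zero>\<^bsub>OK\<^esub> = 0"
  by (simp_all add: OK)

lemma in_OK: "x \<in> carrier OK \<longleftrightarrow> val_ge vK 0 x"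
  by (auto simp: OK valuation_ring_def val_ge_def)

lemma minus_one_OK: "- 1 \<in> carrier OK"
  by (simp add: in_OK val_ge_def)

lemma T_V: "x \<in> T \<Longrightarrow> x \<in> carrier V"
  and T_add: "x \<in> T \<Longrightarrow> y \<in> T \<Longrightarrow> x \<oplus>\<^bsub>V\<^esub> y \<in> T"
  and T_zero: "\<zero>\<^bsub>V\<^esub> \<in> T"
  and T_smult: "val_ge vK 0 a \<Longrightarrow> x \<in> T \<Longrightarrow> a \<odot>\<^bsub>V\<^esub> x \<in> T"
proof -
  interpret TT: submodule T OK V using lattice by (simp add: lattice_in_def)
  show "x \<in> T \<Longrightarrow> x \<in> carrier V" using TT.subset by auto
  show "x \<in> T \<Longrightarrow> y \<in> T \<Longrightarrow> x \<oplus>\<^bsub>V\<^esub> y \<in> T" using TT.m_closed[of x y] by simp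
  show "\<zero>\<^bsub>V\<^esub> \<in> T" using TT.one_closed by simp
  show "val_ge vK 0 a \<Longrightarrow> x \<in> T \<Longrightarrow> a \<odot>\<^bsub>V\<^esub> x \<in> T" using TT.smult_closed[of a x] by (simp add: in_OK)
qed

lemma tm_one: "u \<in> carrier V \<Longrightarrow> tm (\<rho> \<one>\<^bsub>N\<^esub>) c u = sc c u"
  using \<rho>(1)[OF N.one_closed]
  by (intro V_eqI E.tensor_map_closed E.mult_linear E.sc_closed)
    (simp_all add: P_tm Q_tm P_sc Q_sc \<rho> P_simps Q_simps)

lemma one_\<mu>: "1 \<in> carrier \<mu>"
  using group.is_monoid[OF group_\<mu>, THEN monoid.one_closed] unfolding \<mu>_simps .

lemma T_stable: "n \<in> carrier N \<Longrightarrow> z \<in> carrier \<mu> \<Longrightarrow> u \<in> T \<Longrightarrow> tm (\<rho> n) z u \<in> T"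
  using stable unfolding stable_under_def by force

lemma T_\<mu>: "z \<in> carrier \<mu> \<Longrightarrow> u \<in> T \<Longrightarrow> sc z u \<in> T"
  using T_stable[OF N.one_closed] by (simp only: tm_one T_V)

lemmas T_act = T_stable[OF _ one_\<mu>]

lemma sc_minus_one: "u \<in> carrier V \<Longrightarrow> sc (- 1) u = (- 1) \<odot>\<^bsub>V\<^esub> u"
  using E.sc_smult[of u "- 1"] by (simp add: j_simps)

lemma sc_\<delta>: "u \<in> carrier V \<Longrightarrow> sc \<delta> u = sc \<zeta> u \<oplus>\<^bsub>V\<^esub> (- 1) \<odot>\<^bsub>V\<^esub> sc (inverse \<zeta>) u"
proof -
  assume u: "u \<in> carrier V"
  have "\<delta> = \<zeta> + (- 1) * inverse \<zeta>" by (simp add: \<delta>_def)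
  then show ?thesis
    using u E.sc_add_left[OF u, of \<zeta> "(- 1) * inverse \<zeta>"] E.sc_mult[OF u, of "- 1" "inverse \<zeta>"]
    by (simp only: sc_minus_one E.sc_closed)
qed

text \<open>\<delta> is a difference of two elements of \<mu>, so stability under the group gives
  stability under \<delta>, and with it a module structure over \<open>OL\<close>.\<close>

lemma T_\<delta>: "u \<in> T \<Longrightarrow> sc \<delta> u \<in> T"
  unfolding sc_\<delta>[OF T_V] using minus_one_OK by (intro T_add T_smult T_\<mu> \<mu>_\<zeta>) (simp_all add: in_OK)

lemma sc_decompose: "u \<in> carrier V \<Longrightarrow> sc c u = re c \<odot>\<^bsub>V\<^esub> u \<oplus>\<^bsub>V\<^esub> im c \<odot>\<^bsub>V\<^esub> sc \<delta> u"
proof -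
  assume u: "u \<in> carrier V"
  have "sc c u = sc (j (re c) + j (im c) * \<delta>) u" using re_im[of c] by (simp add: mult.commute)
  also have "\<dots> = sc (j (re c)) u \<oplus>\<^bsub>V\<^esub> sc (j (im c)) (sc \<delta> u)"
    using u by (simp only: E.sc_add_left E.sc_mult)
  also have "\<dots> = re c \<odot>\<^bsub>V\<^esub> u \<oplus>\<^bsub>V\<^esub> im c \<odot>\<^bsub>V\<^esub> sc \<delta> u"
    using u by (simp only: E.sc_smult E.sc_closed)
  finally show ?thesis .
qed

lemma T_sc: "c \<in> OL \<Longrightarrow> u \<in> T \<Longrightarrow> sc c u \<in> T"
  by (subst sc_decompose[OF T_V]) (auto simp: OL_def intro!: T_add T_smult T_\<delta>)

lemma f'_bilinear: "bilinear_form OK (V\<lparr>carrier := T\<rparr>) f'"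
  using perfect by (simp add: perfect_form_def)

lemma f'_simps:
  "x \<in> T \<Longrightarrow> y \<in> T \<Longrightarrow> val_ge vK 0 (f' x y)"
  "x \<in> T \<Longrightarrow> y \<in> T \<Longrightarrow> z \<in> T \<Longrightarrow> f' (x \<oplus>\<^bsub>V\<^esub> y) z = f' x z + f' y z"
  "x \<in> T \<Longrightarrow> y \<in> T \<Longrightarrow> z \<in> T \<Longrightarrow> f' z (x \<oplus>\<^bsub>V\<^esub> y) = f' z x + f' z y"
  "val_ge vK 0 r \<Longrightarrow> x \<in> T \<Longrightarrow> y \<in> T \<Longrightarrow> f' (r \<odot>\<^bsub>V\<^esub> x) y = r * f' x y"
  "val_ge vK 0 r \<Longrightarrow> x \<in> T \<Longrightarrow> y \<in> T \<Longrightarrow> f' x (r \<odot>\<^bsub>V\<^esub> y) = r * f' x y"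
  using bilinear_formD[OF f'_bilinear] T_add T_smult by (simp_all add: OK_simps in_OK)

lemma f'_skew: "x \<in> T \<Longrightarrow> y \<in> T \<Longrightarrow> f' y x = - f' x y"
proof -
  assume *: "x \<in> T" "y \<in> T"
  have alt: "f' x x = 0" if "x \<in> T" for x
    using alternating that by (simp add: alternating_form_def OK_simps)
  have "f' (x \<oplus>\<^bsub>V\<^esub> y) (x \<oplus>\<^bsub>V\<^esub> y) = f' y x + f' x y"
    using * by (simp add: f'_simps T_add alt[of x] alt[of y])
  then show ?thesis using alt[of "x \<oplus>\<^bsub>V\<^esub> y"] * by (simp add: eq_neg_iff_add_eq_0 T_add)
qed

lemma f'_invariant: "n \<in> carrier N \<Longrightarrow> z \<in> carrier \<mu> \<Longrightarrow> x \<in> T \<Longrightarrow> y \<in> T \<Longrightarrow>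
    f' (tm (\<rho> n) z x) (tm (\<rho> n) z y) = f' x y"
  using invariant unfolding invariant_form_def by force

lemma f'_\<mu>: "z \<in> carrier \<mu> \<Longrightarrow> x \<in> T \<Longrightarrow> y \<in> T \<Longrightarrow> f' (sc z x) (sc z y) = f' x y"
  using f'_invariant[OF N.one_closed] by (simp only: tm_one T_V)

lemmas f'_act = f'_invariant[OF _ one_\<mu>]

text \<open>Invariance makes \<zeta> and its inverse adjoint to each other, so their difference is
  skew-adjoint.\<close>

lemma f'_\<delta>: "x \<in> T \<Longrightarrow> y \<in> T \<Longrightarrow> f' (sc \<delta> x) y = - f' x (sc \<delta> y)"
proof -
  assume *: "x \<in> T" "y \<in> T"
  have inv: "sc \<zeta> (sc (inverse \<zeta>) y) = y" "sc (inverse \<zeta>) (sc \<zeta> y) = y"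
    using E.sc_mult[OF T_V[OF *(2)], symmetric] E.sc_one[OF T_V[OF *(2)]] \<zeta>_simps by simp_all
  have "f' (sc \<zeta> x) y = f' x (sc (inverse \<zeta>) y)" "f' (sc (inverse \<zeta>) x) y = f' x (sc \<zeta> y)"
    using f'_\<mu>[OF \<mu>_\<zeta>(1) *(1) T_\<mu>[OF \<mu>_\<zeta>(2) *(2)]] f'_\<mu>[OF \<mu>_\<zeta>(2) *(1) T_\<mu>[OF \<mu>_\<zeta>(1) *(2)]] inv by simp_all
  then show ?thesis
    using * minus_one_OK by (simp add: sc_\<delta> T_V f'_simps T_\<mu> \<mu>_\<zeta> T_smult in_OK)
qed

lemma sc_\<delta>_\<delta>: "u \<in> carrier V \<Longrightarrow> sc \<delta> (sc \<delta> u) = \<pi> \<odot>\<^bsub>V\<^esub> u"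
  using E.sc_mult[of u \<delta> \<delta>] E.sc_smult[of u \<pi>] by (simp add: \<delta>_square)

lemma f'_\<delta>_\<delta>: "x \<in> T \<Longrightarrow> y \<in> T \<Longrightarrow> f' (sc \<delta> x) (sc \<delta> y) = - \<pi> * f' x y"
  by (simp add: f'_\<delta> T_\<delta> sc_\<delta>_\<delta> T_V f'_simps \<pi>_integral)

text \<open>\<open>AA\<close> is the \<open>L\<close>-bilinear extension of \<open>f1\<close>; \<open>HH\<close> is the Hermitian form with \<open>im\<close>-part \<open>f'\<close>.\<close>

definition "T' = EV ` T"
definition "act n g = EV (tm (\<rho> n) 1 (DV g))"
definition "AA u v = j (f1 (P u) (P v) + \<pi> * f1 (Q u) (Q v)) + \<delta> * j (f1 (P u) (Q v) + f1 (Q u) (P v))"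
definition "HH u v = j (f' (sc \<delta> u) v) + \<delta> * j (f' u v)"
definition "A g h = AA (DV g) (DV h)"
definition "H g h = HH (DV g) (DV h)"

lemma V_minimal: "T \<subseteq> U \<Longrightarrow> submodule U K V \<Longrightarrow> U = carrier V"
  using lattice by (auto simp: lattice_in_def)

lemma span_T': "VL.span T' = EV ` carrier V"
proof
  have "VL.subspace (EV ` carrier V)"
  proof (rule VL.subspaceI)
    show "0 \<in> EV ` carrier V" using EV_zero[symmetric] by auto
    show "x + y \<in> EV ` carrier V" if xy: "x \<in> EV ` carrier V" "y \<in> EV ` carrier V" for x y
    proof -
      obtain u v where "u \<in> carrier V" "v \<in> carrier V" "x = EV u" "y = EV v" using xy by auto
      then show ?thesis using EV_add[of u v, symmetric] by auto
    qed
    show "scaleL c x \<in> EV ` carrier V" if x: "x \<in> EV ` carrier V" for c x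
      using x EV_sc[symmetric] E.sc_closed by auto
  qed
  then show "VL.span T' \<subseteq> EV ` carrier V"
    unfolding T'_def by (intro VL.span_minimal) (auto intro: T_V)
  let ?U = "{u \<in> carrier V. EV u \<in> VL.span T'}"
  interpret MV: module K V by (rule E.module_T)
  have "?U = carrier V"
  proof (rule V_minimal)
    show "T \<subseteq> ?U" by (auto simp: T_V T'_def intro: VL.span_base)
    show "submodule ?U K V"
      by (rule submoduleI') (auto simp: EV_zero EV_add EV_smult VL.span_zero VL.span_add VL.span_scale)
  qed
  then show "EV ` carrier V \<subseteq> VL.span T'" by auto
qed

lemma T_generators:
  obtains S where "finite S" "S \<subseteq> T" "\<And>U. submodule U OK V \<Longrightarrow> S \<subseteq> U \<Longrightarrow> T \<subseteq> U"
  using lattice by (auto simp: lattice_in_def)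

text \<open>Schur's lemma for \<open>W\<close>. The annihilating polynomial that it requires exists
  because the components of a finite generating set of the lattice span \<open>W\<close>.\<close>

lemma scalar_endomorphism:
  assumes \<phi>: "\<phi> \<in> linear_maps K W W"
    and comm: "\<And>n x. n \<in> carrier N \<Longrightarrow> x \<in> carrier W \<Longrightarrow> \<phi> (\<rho> n x) = \<rho> n (\<phi> x)"
  shows "\<exists>a. \<forall>x\<in>carrier W. \<phi> x = a \<odot>\<^bsub>W\<^esub> x"
proof -
  interpret X: schur N W \<rho> \<phi>
    by (intro schur.intro repr abs_simple \<phi> comm)
  obtain w where w: "w \<in> carrier W" "w \<noteq> \<zero>\<^bsub>W\<^esub>" using ex_nonzero by auto
  obtain S where S: "finite S" "S \<subseteq> T" and gen: "\<And>U. submodule U OK V \<Longrightarrow> S \<subseteq> U \<Longrightarrow> T \<subseteq> U"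
    using T_generators by blast
  let ?S = "(\<lambda>u. EW (P u)) ` S"
  let ?U = "{u \<in> carrier V. EW (P u) \<in> VK.span ?S}"
  interpret MV: module K V by (rule E.module_T)
  have EW_zero: "EW \<zero>\<^bsub>W\<^esub> = 0"
    using EW_simps(2)[of "\<zero>\<^bsub>W\<^esub>" 0] by (simp add: E.M_simps)
  have sub: "submodule ?U D V" if "- 1 \<in> carrier D" for D :: "'k ring"
    by (rule submoduleI')
      (use that in \<open>auto simp: EW_simps EW_zero P_simps P_smult P_Q_zero VK.span_zero VK.span_add VK.span_scale\<close>)
  have "S \<subseteq> ?U" using S T_V by (auto intro: VK.span_base)
  then have "T \<subseteq> ?U" using gen sub minus_one_OK by blast
  then have U: "?U = carrier V" using sub by (intro V_minimal) simp_all
  have span: "EW x \<in> VK.span ?S" if "x \<in> carrier W" for x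
  proof -
    have "pt x 1 \<in> ?U" unfolding U using that by simp
    then show ?thesis using that by (simp add: P_simps E.M_simps)
  qed
  note U0 = X.U0_add[OF w] X.U0_smult[OF w] X.U0_closed[OF w]
  let ?U0 = "horner (\<lambda>u v. u \<oplus>\<^bsub>W\<^esub> v) \<zero>\<^bsub>W\<^esub> (\<lambda>a. a \<odot>\<^bsub>W\<^esub> w) \<phi>"
  let ?h = "\<lambda>p. EW (?U0 p)"
  obtain p where p: "p \<noteq> 0" "?h p = 0"
    using VK.ex_poly_in_kernel[of ?h ?S] S(1) by (auto simp: U0 EW_simps span)
  from p(2) have "?h p = EW \<zero>\<^bsub>W\<^esub>" by (simp only: EW_zero)
  then have "?U0 p = \<zero>\<^bsub>W\<^esub>"
    by (intro EW_eqD U0) simp_all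
  then show ?thesis using X.schur_scalar[OF w p(1)] by simp
qed

text \<open>An \<open>L\<close>-linear map is determined by its values on w \<otimes> 1. There its
  two components are equivariant endomorphisms of \<open>W\<close>, hence scalars a and b of
  \<open>K\<close>, and the map is multiplication by a + \<delta> b.\<close>

lemma V_endomorphism_scalar:
  assumes closed: "\<And>u. u \<in> carrier V \<Longrightarrow> \<Phi> u \<in> carrier V"
    and add: "\<And>u v. u \<in> carrier V \<Longrightarrow> v \<in> carrier V \<Longrightarrow> \<Phi> (u \<oplus>\<^bsub>V\<^esub> v) = \<Phi> u \<oplus>\<^bsub>V\<^esub> \<Phi> v"
    and scal: "\<And>c u. u \<in> carrier V \<Longrightarrow> \<Phi> (sc c u) = sc c (\<Phi> u)"
    and comm: "\<And>n u. n \<in> carrier N \<Longrightarrow> u \<in> carrier V \<Longrightarrow> \<Phi> (tm (\<rho> n) 1 u) = tm (\<rho> n) 1 (\<Phi> u)"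
  shows "\<exists>c. \<forall>u\<in>carrier V. \<Phi> u = sc c u"
proof -
  let ?p = "\<lambda>w. P (\<Phi> (pt w 1))" and ?q = "\<lambda>w. Q (\<Phi> (pt w 1))"
  have smult: "pt (a \<odot>\<^bsub>W\<^esub> w) 1 = sc (j a) (pt w 1)" if "w \<in> carrier W" for a w
    using that E.smult_pt[of a w 1] by (simp add: E.sc_smult)
  have act: "pt (\<rho> n w) 1 = tm (\<rho> n) 1 (pt w 1)" if "n \<in> carrier N" "w \<in> carrier W" for n w
    using E.tensor_map_pt[OF \<rho>(1)[OF that(1)] E.mult_linear, of w 1 1] that by simp
  have "?p \<in> linear_maps K W W" "?q \<in> linear_maps K W W"
    unfolding linear_maps_def
    by (auto simp: closed P_simps Q_simps E.pt_add_left add smult scal P_sc Q_sc E.M_simps W_smult)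
  moreover have "?p (\<rho> n w) = \<rho> n (?p w)" "?q (\<rho> n w) = \<rho> n (?q w)"
    if n: "n \<in> carrier N" and w: "w \<in> carrier W" for n w
  proof -
    have ptV: "pt w 1 \<in> carrier V" using w by simp
    have "\<Phi> (pt (\<rho> n w) 1) = tm (\<rho> n) 1 (\<Phi> (pt w 1))"
      unfolding act[OF n w] by (rule comm[OF n ptV])
    moreover have "\<Phi> (pt w 1) \<in> carrier V" by (rule closed[OF ptV])
    ultimately show "?p (\<rho> n w) = \<rho> n (?p w)" "?q (\<rho> n w) = \<rho> n (?q w)"
      using n by (simp_all only: P_tm[OF \<rho>(1)[OF n]] Q_tm[OF \<rho>(1)[OF n]])
        (simp_all add: P_simps Q_simps \<rho> E.M_simps)
  qed
  ultimately obtain a b where a: "\<And>w. w \<in> carrier W \<Longrightarrow> ?p w = a \<odot>\<^bsub>W\<^esub> w"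
    and b: "\<And>w. w \<in> carrier W \<Longrightarrow> ?q w = b \<odot>\<^bsub>W\<^esub> w"
    using scalar_endomorphism[of ?p] scalar_endomorphism[of ?q] by blast
  define c where "c = j a + \<delta> * j b"
  have c: "re c = a" "im c = b" by (simp_all add: c_def)
  have pt: "\<Phi> (pt w 1) = sc c (pt w 1)" if w: "w \<in> carrier W" for w
    using w by (intro V_eqI closed E.sc_closed)
      (simp_all add: a b P_sc Q_sc P_simps Q_simps c E.M_simps W_smult)
  have "\<Phi> u = sc c u" if u: "u \<in> carrier V" for u
  proof -
    have "u = pt (P u) 1 \<oplus>\<^bsub>V\<^esub> sc \<delta> (pt (Q u) 1)"
      using V_decompose[OF u] u E.sc_pt[of "Q u" 1 \<delta>] by (simp add: Q_simps)
    moreover have "\<Phi> (pt (P u) 1 \<oplus>\<^bsub>V\<^esub> sc \<delta> (pt (Q u) 1)) = sc c (pt (P u) 1 \<oplus>\<^bsub>V\<^esub> sc \<delta> (pt (Q u) 1))"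
      using u by (simp add: add scal pt P_simps Q_simps E.sc_closed E.sc_add E.sc_mult[symmetric] mult.commute)
    ultimately show ?thesis by simp
  qed
  then show ?thesis by blast
qed

lemma act_EV: "n \<in> carrier N \<Longrightarrow> u \<in> carrier V \<Longrightarrow> act n (EV u) = EV (tm (\<rho> n) 1 u)"
  and A_EV: "u \<in> carrier V \<Longrightarrow> v \<in> carrier V \<Longrightarrow> A (EV u) (EV v) = AA u v"
  and H_EV: "u \<in> T \<Longrightarrow> v \<in> T \<Longrightarrow> H (EV u) (EV v) = HH u v"
  by (simp_all add: act_def A_def H_def T_V)

lemma tm_V: "n \<in> carrier N \<Longrightarrow> u \<in> carrier V \<Longrightarrow> tm (\<rho> n) 1 u \<in> carrier V"
  by (rule E.tensor_map_closed[OF \<rho>(1) E.mult_linear])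

lemma tm_simps:
  assumes n: "n \<in> carrier N"
  shows "u \<in> carrier V \<Longrightarrow> v \<in> carrier V \<Longrightarrow> tm (\<rho> n) 1 (u \<oplus>\<^bsub>V\<^esub> v) = tm (\<rho> n) 1 u \<oplus>\<^bsub>V\<^esub> tm (\<rho> n) 1 v"
    "u \<in> carrier V \<Longrightarrow> P (tm (\<rho> n) 1 u) = \<rho> n (P u)" "u \<in> carrier V \<Longrightarrow> Q (tm (\<rho> n) 1 u) = \<rho> n (Q u)"
    "u \<in> carrier V \<Longrightarrow> tm (\<rho> n) 1 (sc c u) = sc c (tm (\<rho> n) 1 u)"
proof -
  show "u \<in> carrier V \<Longrightarrow> v \<in> carrier V \<Longrightarrow> tm (\<rho> n) 1 (u \<oplus>\<^bsub>V\<^esub> v) = tm (\<rho> n) 1 u \<oplus>\<^bsub>V\<^esub> tm (\<rho> n) 1 v"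
    by (rule E.tensor_map_add[OF \<rho>(1)[OF n] E.mult_linear])
  show PQ: "u \<in> carrier V \<Longrightarrow> P (tm (\<rho> n) 1 u) = \<rho> n (P u)" "u \<in> carrier V \<Longrightarrow> Q (tm (\<rho> n) 1 u) = \<rho> n (Q u)"
    for u
    using P_tm[OF \<rho>(1)[OF n], of u 1] Q_tm[OF \<rho>(1)[OF n], of u 1] n
    by (simp_all only: re_im_simps) (simp_all add: \<rho> P_simps Q_simps E.M_simps)
  note lin = linear_mapsD[OF \<rho>(1)[OF n]]
  assume u: "u \<in> carrier V"
  show "tm (\<rho> n) 1 (sc c u) = sc c (tm (\<rho> n) 1 u)"
  proof (rule V_eqI)
    show "P (tm (\<rho> n) 1 (sc c u)) = P (sc c (tm (\<rho> n) 1 u))"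
      unfolding PQ(1)[OF E.sc_closed[OF u]] P_sc[OF tm_V[OF n u]] P_sc[OF u] PQ[OF u]
      using u by (simp add: lin P_simps Q_simps W_smult)
    show "Q (tm (\<rho> n) 1 (sc c u)) = Q (sc c (tm (\<rho> n) 1 u))"
      unfolding PQ(2)[OF E.sc_closed[OF u]] Q_sc[OF tm_V[OF n u]] Q_sc[OF u] PQ[OF u]
      using u by (simp add: lin P_simps Q_simps W_smult)
  qed (intro tm_V E.sc_closed n u)+
qed

lemma tm_one_one: "u \<in> carrier V \<Longrightarrow> tm (\<rho> \<one>\<^bsub>N\<^esub>) 1 u = u"
  using tm_one[of u 1] by (simp only: E.sc_one)

lemma tm_mult: "m \<in> carrier N \<Longrightarrow> n \<in> carrier N \<Longrightarrow> u \<in> carrier V \<Longrightarrow>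
    tm (\<rho> (m \<otimes>\<^bsub>N\<^esub> n)) 1 u = tm (\<rho> m) 1 (tm (\<rho> n) 1 u)"
  by (rule V_eqI) (simp_all only: tm_V tm_simps N.m_closed \<rho> P_simps Q_simps)

lemma AA_add: "u \<in> carrier V \<Longrightarrow> v \<in> carrier V \<Longrightarrow> w \<in> carrier V \<Longrightarrow> AA (u \<oplus>\<^bsub>V\<^esub> v) w = AA u w + AA v w"
  by (rule re_im_eqI) (simp_all add: AA_def P_simps Q_simps f1_simps algebra_simps)

lemma AA_sc: "u \<in> carrier V \<Longrightarrow> v \<in> carrier V \<Longrightarrow> AA (sc c u) v = c * AA u v"
  by (rule re_im_eqI)
    (simp_all add: AA_def P_sc Q_sc P_simps Q_simps f1_simps W_smult algebra_simps)

lemma AA_skew: "u \<in> carrier V \<Longrightarrow> v \<in> carrier V \<Longrightarrow> AA v u = - AA u v"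
  using f1_skew[of "P u" "P v"] f1_skew[of "Q u" "Q v"] f1_skew[of "P u" "Q v"] f1_skew[of "Q u" "P v"]
  by (intro re_im_eqI) (simp_all add: AA_def P_simps Q_simps)

lemma HH_OL: "u \<in> T \<Longrightarrow> v \<in> T \<Longrightarrow> HH u v \<in> OL"
  by (simp add: OL_def HH_def f'_simps T_\<delta>)

lemma HH_add: "u \<in> T \<Longrightarrow> v \<in> T \<Longrightarrow> w \<in> T \<Longrightarrow> HH w (u \<oplus>\<^bsub>V\<^esub> v) = HH w u + HH w v"
  by (rule re_im_eqI) (simp_all add: HH_def f'_simps T_\<delta>)

lemma HH_sc:
  assumes "c \<in> OL" and uv: "u \<in> T" "v \<in> T"
  shows "HH v (sc c u) = bar c * HH v u"
proof (rule re_im_eqI)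
  have c: "val_ge vK 0 (re c)" "val_ge vK 0 (im c)" using assms(1) by (auto simp: OL_def)
  have *: "f' x (sc c u) = re c * f' x u + im c * f' x (sc \<delta> u)" if "x \<in> T" for x
    unfolding sc_decompose[OF T_V[OF uv(1)], of c] using that uv c by (simp add: f'_simps T_\<delta> T_smult)
  have 1: "f' v (sc \<delta> u) = - f' (sc \<delta> v) u" using uv by (simp add: f'_\<delta>)
  show "re (HH v (sc c u)) = re (bar c * HH v u)" "im (HH v (sc c u)) = im (bar c * HH v u)"
    using uv by (simp_all add: HH_def * T_\<delta> f'_\<delta>_\<delta> 1)
qed

lemma HH_hermitian: "u \<in> T \<Longrightarrow> v \<in> T \<Longrightarrow> HH v u = bar (HH u v)"
  using f'_skew[of u "sc \<delta> v"] f'_skew[of u v]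
  by (intro re_im_eqI) (simp_all add: HH_def f'_\<delta> T_\<delta>)

text \<open>Perfectness of \<open>f'\<close> represents the \<delta>-part of the functional. The
  other part follows by evaluating at \<delta> u, since \<open>re x\<close> is the \<delta>-part of
  \<delta> x.\<close>

lemma HH_unimodular:
  assumes OL: "\<And>u. u \<in> T \<Longrightarrow> \<alpha> u \<in> OL" and add: "\<And>u v. u \<in> T \<Longrightarrow> v \<in> T \<Longrightarrow> \<alpha> (u \<oplus>\<^bsub>V\<^esub> v) = \<alpha> u + \<alpha> v"
    and scal: "\<And>c u. c \<in> OL \<Longrightarrow> u \<in> T \<Longrightarrow> \<alpha> (sc c u) = c * \<alpha> u"
  shows "\<exists>a\<in>T. \<forall>u\<in>T. \<alpha> u = HH u a"
proof -
  let ?M = "V\<lparr>carrier := T\<rparr>"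
  have "im (\<alpha> (r \<odot>\<^bsub>V\<^esub> u)) = r * im (\<alpha> u)" if "u \<in> T" "val_ge vK 0 r" for r u
    using scal[of "j r" u] that by (simp add: E.sc_smult T_V OL_j)
  then have "(\<lambda>u\<in>T. im (\<alpha> u)) \<in> dual_module OK ?M"
    using OL add by (auto simp: dual_module_def in_OK OK_simps OL_def T_add T_smult)
  then have "(\<lambda>u\<in>T. im (\<alpha> u)) \<in> (\<lambda>y. \<lambda>x\<in>T. f' x y) ` T"
    using perfect by (simp add: perfect_form_def bij_betw_def)
  then obtain a where a: "a \<in> T" "(\<lambda>u\<in>T. im (\<alpha> u)) = (\<lambda>x\<in>T. f' x a)" by auto
  have im: "im (\<alpha> u) = f' u a" if "u \<in> T" for u
    using fun_cong[OF a(2), of u] that by simp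
  have "\<alpha> u = HH u a" if u: "u \<in> T" for u
  proof (rule re_im_eqI)
    show "im (\<alpha> u) = im (HH u a)" using im[OF u] by (simp add: HH_def)
    have "re (\<alpha> u) = im (\<alpha> (sc \<delta> u))" using scal[OF OL_\<delta> u] by simp
    then show "re (\<alpha> u) = re (HH u a)" using im[OF T_\<delta>[OF u]] by (simp add: HH_def)
  qed
  then show ?thesis using a(1) by blast
qed

text \<open>Generators over \<open>OK\<close> still generate over \<open>OL\<close>, since the
  \<open>OL\<close>-combinations of them form an \<open>OK\<close>-submodule.\<close>

lemma T'_finitely_generated:
  "\<exists>S. finite S \<and> S \<subseteq> T' \<and> (\<forall>x\<in>T'. \<exists>c. (\<forall>s\<in>S. c s \<in> OL) \<and> x = (\<Sum>s\<in>S. scaleL (c s) s))"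
proof -
  obtain S where S: "finite S" "S \<subseteq> T" and gen: "\<And>U. submodule U OK V \<Longrightarrow> S \<subseteq> U \<Longrightarrow> T \<subseteq> U"
    using T_generators by blast
  let ?S = "EV ` S"
  let ?U = "{u \<in> carrier V. \<exists>c. (\<forall>s\<in>?S. c s \<in> OL) \<and> EV u = (\<Sum>s\<in>?S. scaleL (c s) s)}"
  interpret MV: module K V by (rule E.module_T)
  have "submodule ?U OK V"
  proof (rule submoduleI')
    show "\<zero>\<^bsub>V\<^esub> \<in> ?U" by (auto intro!: exI[of _ "\<lambda>_. 0"] simp: EV_zero OL_0)
    show "- 1 \<in> carrier OK" by (rule minus_one_OK)
  next
    fix u v assume "u \<in> ?U" "v \<in> ?U"
    then obtain c d where uv: "u \<in> carrier V" "v \<in> carrier V" and c: "\<forall>s\<in>?S. c s \<in> OL" "EV u = (\<Sum>s\<in>?S. scaleL (c s) s)"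
      and d: "\<forall>s\<in>?S. d s \<in> OL" "EV v = (\<Sum>s\<in>?S. scaleL (d s) s)" by auto
    have "EV (u \<oplus>\<^bsub>V\<^esub> v) = (\<Sum>s\<in>?S. scaleL (c s + d s) s)"
      using uv by (simp only: EV_add c d VL.scale_left_distrib sum.distrib)
    then show "u \<oplus>\<^bsub>V\<^esub> v \<in> ?U"
      using uv c(1) d(1) OL_add by (auto intro!: exI[of _ "\<lambda>s. c s + d s"])
  next
    fix r u assume r: "r \<in> carrier OK" and "u \<in> ?U"
    then obtain c where u: "u \<in> carrier V" and c: "\<forall>s\<in>?S. c s \<in> OL" "EV u = (\<Sum>s\<in>?S. scaleL (c s) s)" by auto
    have "EV (r \<odot>\<^bsub>V\<^esub> u) = (\<Sum>s\<in>?S. scaleL (j r * c s) s)"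
      using u by (simp only: EV_smult c VL.scale_sum_right VL.scale_scale)
    moreover have "j r \<in> OL" using r by (simp add: OL_j in_OK)
    ultimately show "r \<odot>\<^bsub>V\<^esub> u \<in> ?U"
      using u c(1) OL_mult MV.smult_closed[of r u] by (auto intro!: exI[of _ "\<lambda>s. j r * c s"])
  qed auto
  moreover have "S \<subseteq> ?U"
  proof
    fix s assume s: "s \<in> S"
    have "(\<Sum>x\<in>?S. scaleL (if x = EV s then 1 else 0) x) = (\<Sum>x\<in>?S. if x = EV s then x else 0)"
      by (rule sum.cong) simp_all
    also have "\<dots> = EV s" using s S(1) by simp
    finally have "EV s = (\<Sum>x\<in>?S. scaleL (if x = EV s then 1 else 0) x)" by (rule sym)
    then show "s \<in> ?U" using s S(2) T_V OL_0 OL_1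
      by (auto intro!: exI[of _ "\<lambda>x. if x = EV s then 1 else 0"])
  qed
  ultimately have "T \<subseteq> ?U" by (rule gen)
  then show ?thesis using S unfolding T'_def by (intro exI[of _ ?S]) blast
qed

lemma no_invariant_lattice: False
proof -
  interpret local_conjugation OL PL bar
  proof (rule local_conjugation.intro)
    show "2 \<notin> PL" using of_nat_PL[OF l_not_dvd(1)] by simp
  qed (auto intro: OL_0 OL_1 OL_add OL_uminus OL_mult OL_valuation_ring PL_add PL_mult OL_unit bar_diff
      simp: PL_one)
  have "unimodular_hermitian_lattice OL PL bar scaleL N act T' A H"
  proof (intro unimodular_hermitian_lattice.intro unimodular_hermitian_lattice_axioms.intro)
    show "local_conjugation OL PL bar" by unfold_locales
    show "vector_space scaleL" by unfold_locales
    show "group N" by (rule group_N)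
    show "finite (carrier N)" by (rule finite_N)
    show "of_nat (card (carrier N)) \<notin> PL" using of_nat_PL[OF order_N] by (simp add: Coset.order_def)
    show "0 \<in> T'" using EV_zero T_zero unfolding T'_def by (metis imageI)
    show "x + y \<in> T'" if "x \<in> T'" "y \<in> T'" for x y
      using that unfolding T'_def by (auto simp: EV_add[symmetric] T_V T_add)
    show "scaleL c x \<in> T'" if "c \<in> OL" "x \<in> T'" for c x
      using that unfolding T'_def by (auto simp: EV_sc[symmetric] T_V T_sc)
    show "\<exists>S. finite S \<and> S \<subseteq> T' \<and> (\<forall>x\<in>T'. \<exists>c. (\<forall>s\<in>S. c s \<in> OL) \<and> x = (\<Sum>s\<in>S. scaleL (c s) s))"
      by (rule T'_finitely_generated)
    show "act n x \<in> T'" if "n \<in> carrier N" "x \<in> T'" for n x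
      using that T_act unfolding T'_def by (auto simp only: act_EV T_V image_iff)
    show "act n (x + y) = act n x + act n y" if "n \<in> carrier N" "x \<in> VL.span T'" "y \<in> VL.span T'" for n x y
      using that unfolding span_T'
      by (elim imageE) (simp only: EV_add[symmetric] act_EV E.T.a_closed tm_simps tm_V)
    show "act n (scaleL c x) = scaleL c (act n x)" if "n \<in> carrier N" "x \<in> VL.span T'" for n c x
      using that unfolding span_T'
      by (elim imageE) (simp only: EV_sc[symmetric] act_EV E.sc_closed tm_simps tm_V)
    show "act \<one>\<^bsub>N\<^esub> x = x" if "x \<in> VL.span T'" for x
      using that unfolding span_T' by (elim imageE) (simp only: act_EV N.one_closed tm_one_one)
    show "act (m \<otimes>\<^bsub>N\<^esub> n) x = act m (act n x)" if "m \<in> carrier N" "n \<in> carrier N" "x \<in> VL.span T'" for m n x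
      using that unfolding span_T' by (elim imageE) (simp only: act_EV N.m_closed tm_V tm_mult)
    show "A (x + y) z = A x z + A y z" if "x \<in> VL.span T'" "y \<in> VL.span T'" "z \<in> VL.span T'" for x y z
      using that unfolding span_T'
      by (elim imageE) (simp only: EV_add[symmetric] A_EV E.T.a_closed AA_add)
    show "A (scaleL c x) y = c * A x y" if "x \<in> VL.span T'" "y \<in> VL.span T'" for c x y
      using that unfolding span_T'
      by (elim imageE) (simp only: EV_sc[symmetric] A_EV E.sc_closed AA_sc)
    show "A y x = - A x y" if "x \<in> VL.span T'" "y \<in> VL.span T'" for x y
      using that unfolding span_T' by (elim imageE) (simp only: A_EV, rule AA_skew)
    show "A (act n x) (act n y) = A x y" if "n \<in> carrier N" "x \<in> VL.span T'" "y \<in> VL.span T'" for n x y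
      using that unfolding span_T'
      by (elim imageE) (simp only: act_EV A_EV tm_V AA_def tm_simps f1_inv P_simps Q_simps)
    show "\<exists>x\<in>VL.span T'. \<exists>y\<in>VL.span T'. A x y \<noteq> 0"
    proof -
      obtain w where w: "w \<in> carrier W" "w \<noteq> \<zero>\<^bsub>W\<^esub>" using ex_nonzero by auto
      then obtain w' where w': "w' \<in> carrier W" "f1 w w' \<noteq> 0" using f1_nondeg by blast
      have f1_0: "f1 \<zero>\<^bsub>W\<^esub> \<zero>\<^bsub>W\<^esub> = 0" by (simp add: f1_alt)
      have "re (AA (pt w 1) (pt w' 1)) = f1 w w'"
        using w w' by (simp add: AA_def P_simps Q_simps E.M_simps f1_0)
      then have "A (EV (pt w 1)) (EV (pt w' 1)) \<noteq> 0" using w w' by (auto simp: A_EV)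
      then show ?thesis unfolding span_T' using w w' by (auto intro!: bexI)
    qed
    show "H x y \<in> OL" if "x \<in> T'" "y \<in> T'" for x y
      using that unfolding T'_def by (elim imageE) (simp only: H_EV HH_OL)
    show "H z (x + y) = H z x + H z y" if "x \<in> T'" "y \<in> T'" "z \<in> T'" for x y z
      using that unfolding T'_def by (elim imageE) (simp only: EV_add[symmetric] T_V H_EV T_add HH_add)
    show "H y (scaleL c x) = bar c * H y x" if "c \<in> OL" "x \<in> T'" "y \<in> T'" for c x y
      using that unfolding T'_def by (elim imageE) (simp only: EV_sc[symmetric] T_V H_EV T_sc HH_sc)
    show "H y x = bar (H x y)" if "x \<in> T'" "y \<in> T'" for x y
      using that unfolding T'_def by (elim imageE) (simp only: H_EV, rule HH_hermitian)
    \<comment> \<open>The action of \<open>N\<close> commutes with \<delta>, so both components of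
      \<open>HH\<close> inherit the invariance of \<open>f'\<close>.\<close>
    show "H (act n x) (act n y) = H x y" if "n \<in> carrier N" "x \<in> T'" "y \<in> T'" for n x y
      using that unfolding T'_def
      by (elim imageE)
        (simp only: act_EV T_V H_EV T_act HH_def tm_simps(4)[symmetric] f'_act T_\<delta>)
    show "\<exists>a\<in>T'. \<forall>y\<in>T'. \<alpha> y = H y a"
      if OL: "\<And>x. x \<in> T' \<Longrightarrow> \<alpha> x \<in> OL" and add: "\<And>x y. x \<in> T' \<Longrightarrow> y \<in> T' \<Longrightarrow> \<alpha> (x + y) = \<alpha> x + \<alpha> y"
        and scal: "\<And>c x. c \<in> OL \<Longrightarrow> x \<in> T' \<Longrightarrow> \<alpha> (scaleL c x) = c * \<alpha> x" for \<alpha>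
    proof -
      have "\<exists>a\<in>T. \<forall>u\<in>T. \<alpha> (EV u) = HH u a"
        by (rule HH_unimodular)
          (use OL add scal in \<open>simp_all add: T'_def EV_add EV_sc T_V\<close>)
      then show ?thesis unfolding T'_def by (auto simp: H_EV)
    qed
    show "\<exists>c. \<forall>x\<in>VL.span T'. \<Phi> x = scaleL c x"
      if closed: "\<And>x. x \<in> VL.span T' \<Longrightarrow> \<Phi> x \<in> VL.span T'"
        and add: "\<And>x y. x \<in> VL.span T' \<Longrightarrow> y \<in> VL.span T' \<Longrightarrow> \<Phi> (x + y) = \<Phi> x + \<Phi> y"
        and scal: "\<And>c x. x \<in> VL.span T' \<Longrightarrow> \<Phi> (scaleL c x) = scaleL c (\<Phi> x)"
        and comm: "\<And>n x. n \<in> carrier N \<Longrightarrow> x \<in> VL.span T' \<Longrightarrow> \<Phi> (act n x) = act n (\<Phi> x)" for \<Phi>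
    proof -
      \<comment> \<open>Conjugation by \<open>EV\<close> carries the endomorphism of the function
        space back to \<open>V\<close>, where it is known to be scalar.\<close>
      let ?\<Phi> = "\<lambda>u. DV (\<Phi> (EV u))"
      have im: "EV u \<in> VL.span T'" if "u \<in> carrier V" for u using that by (simp add: span_T')
      have D: "DV x \<in> carrier V \<and> EV (DV x) = x" if "x \<in> VL.span T'" for x
        using that by (auto simp: span_T')
      have V\<Phi>: "?\<Phi> u \<in> carrier V" and E\<Phi>: "EV (?\<Phi> u) = \<Phi> (EV u)" if "u \<in> carrier V" for u
        using D[OF closed[OF im[OF that]]] by auto
      have "\<exists>c. \<forall>u\<in>carrier V. ?\<Phi> u = sc c u"
      proof (rule V_endomorphism_scalar)
        show "?\<Phi> (u \<oplus>\<^bsub>V\<^esub> v) = ?\<Phi> u \<oplus>\<^bsub>V\<^esub> ?\<Phi> v" if "u \<in> carrier V" "v \<in> carrier V" for u v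
          using E\<Phi>[OF E.T.a_closed[OF that]] that
          by (intro EV_eqD V\<Phi> E.T.a_closed) (simp_all only: EV_add V\<Phi> E\<Phi> add im)
        show "?\<Phi> (sc c u) = sc c (?\<Phi> u)" if "u \<in> carrier V" for c u
          using E\<Phi>[OF E.sc_closed[OF that]] that
          by (intro EV_eqD V\<Phi> E.sc_closed) (simp_all only: EV_sc V\<Phi> E\<Phi> scal im)
        show "?\<Phi> (tm (\<rho> n) 1 u) = tm (\<rho> n) 1 (?\<Phi> u)" if n: "n \<in> carrier N" and u: "u \<in> carrier V" for n u
        proof (rule EV_eqD)
          have "EV (?\<Phi> (tm (\<rho> n) 1 u)) = \<Phi> (act n (EV u))"
            by (simp only: E\<Phi> tm_V n u act_EV)
          also have "\<dots> = act n (EV (?\<Phi> u))" by (simp only: comm n u im E\<Phi>)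
          also have "\<dots> = EV (tm (\<rho> n) 1 (?\<Phi> u))" by (simp only: act_EV n u V\<Phi>)
          finally show "EV (?\<Phi> (tm (\<rho> n) 1 u)) = EV (tm (\<rho> n) 1 (?\<Phi> u))" .
        qed (simp_all only: V\<Phi> tm_V n u)
      qed (rule V\<Phi>)
      then obtain c where c: "\<And>u. u \<in> carrier V \<Longrightarrow> ?\<Phi> u = sc c u" by blast
      have "\<Phi> x = scaleL c x" if "x \<in> VL.span T'" for x
      proof -
        obtain u where u: "u \<in> carrier V" "x = EV u" using \<open>x \<in> VL.span T'\<close> by (auto simp: span_T')
        then show ?thesis using E\<Phi>[OF u(1)] c[OF u(1)] EV_sc[OF u(1)] by simp
      qed
      then show ?thesis by blast
    qed
  qed
  then show False by (rule unimodular_hermitian_lattice.contradiction)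
qed

end

theorem theorem6p6:
  fixes l :: nat
    and vF :: "'f::field_char_0 \<Rightarrow> int"
    and vK :: "'k::field \<Rightarrow> int"
    and i :: "'f \<Rightarrow> 'k"
    and j :: "'k \<Rightarrow> 'l::field"
    and \<zeta> :: 'l
    and bar :: "'l \<Rightarrow> 'l"
    and K OK :: "'k ring"
    and L :: "('k, 'l) module"
    and N :: "'n monoid"
    and W :: "('k, 'w) module"
    and \<rho> :: "'n \<Rightarrow> 'w \<Rightarrow> 'w"
    and f\<^sub>1 :: "'w \<Rightarrow> 'w \<Rightarrow> 'k"
    and f\<^sub>2 :: "'l \<Rightarrow> 'l \<Rightarrow> 'k"
    and \<mu> :: "'l monoid"
    and G :: "('n \<times> 'l) monoid"
    and V :: "('k, ('w \<times> 'l \<Rightarrow>\<^sub>0 int) set) module"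
    and \<rho>V :: "'n \<times> 'l \<Rightarrow> ('w \<times> 'l \<Rightarrow>\<^sub>0 int) set \<Rightarrow> ('w \<times> 'l \<Rightarrow>\<^sub>0 int) set"
  assumes "Factorial_Ring.prime l" and "odd l"
    \<comment> \<open>the field \<open>F = 'f\<close>\<close>
    and "discrete_valuation vF" and "val_complete vF" and "residue_char vF l"
    and "unramified_over vF (closure_of_rationals vF)"
    \<comment> \<open>the fields \<open>F \<subseteq> K = 'k = F(\<zeta> + \<zeta>\<inverse>) \<subseteq> 'l = K(\<zeta>)\<close>\<close>
    and "field_hom i" and "field_hom j"
    and "primitive_root_of_unity l \<zeta>"
    and "range j = subfield_generated (range (j \<circ> i) \<union> {\<zeta> + inverse \<zeta>})"
    and "UNIV = subfield_generated (range j \<union> {\<zeta>})"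
    and "discrete_valuation vK" and "valuation_extends i vF vK"
    and "K = ring_of_type_algebra" and "OK = K\<lparr>carrier := valuation_ring vK\<rparr>"
    and "L = ext_module j"
    and "field_hom bar" and "bij bar" and "\<And>c. bar (j c) = j c" and "bar \<noteq> id"
    \<comment> \<open>the group \<open>N\<close> and the module \<open>W\<close>\<close>
    and "group N" and "finite (carrier N)" and "\<not> l dvd Coset.order N"
    and "group_ring_module K N W \<rho>" and "carrier W \<noteq> {\<zero>\<^bsub>W\<^esub>}"
    and "absolutely_simple N W \<rho>" and "acts_faithfully N W \<rho>"
    and "symplectic_form K N W \<rho> f\<^sub>1"
    \<comment> \<open>the group \<open>G\<close> and the module \<open>V\<close>\<close>
    and "\<mu> = subgroup_generated (units_of (ring_of_type_algebra :: 'l ring)) {\<zeta>}"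
    and "G = N \<times>\<times> \<mu>"
    and "V = tensor K W L"
    and "\<rho>V = (\<lambda>(n, z). tensor_map K W L (\<rho> n) (\<lambda>x. z * x))"
    and "f\<^sub>2 = (\<lambda>x y. field_trace j (x * bar y))"
  shows "group_ring_module K G V \<rho>V \<and>
    acts_faithfully G V \<rho>V \<and>
    (\<exists>f. is_tensor_form K W L f\<^sub>1 f\<^sub>2 f \<and> symplectic_form K G V \<rho>V f) \<and>
    \<not> (\<exists>T f'. lattice_in K OK V T \<and> stable_under G \<rho>V T \<and>
           perfect_form OK (V\<lparr>carrier := T\<rparr>) f' \<and> alternating_form OK (V\<lparr>carrier := T\<rparr>) f' \<and>
           invariant_form G (V\<lparr>carrier := T\<rparr>) \<rho>V f')"
    (is "_ \<and> _ \<and> _ \<and> \<not> (\<exists>T f'. ?lattice T f')")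
proof -
  note defs = assms(14) assms(15) assms(16) assms(29-33)
  have "cyclotomic_tower l vF vK i j \<zeta> bar"
    by (rule cyclotomic_tower.intro) (use assms in blast)+
  then interpret symplectic_tower l vF vK i j \<zeta> bar N W \<rho> f\<^sub>1
    by (intro symplectic_tower.intro symplectic_tower_axioms.intro assms(21-23,25-27))
      (use assms(24,28) in \<open>simp_all only: assms(14)\<close>)
  have "\<not> ?lattice T f'" for T f'
  proof
    assume *: "?lattice T f'"
    have "invariant_lattice l vF vK i j \<zeta> bar N W \<rho> f\<^sub>1 OK T f'"
      using * unfolding defs
      by (intro invariant_lattice.intro invariant_lattice_axioms.intro symplectic_tower_axioms) auto
    then show False by (rule invariant_lattice.no_invariant_lattice)
  qed
  moreover have "is_tensor_form K W L f\<^sub>1 f\<^sub>2 fV \<and> symplectic_form K G V \<rho>V fV"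
    unfolding defs using is_tensor_form_fV symplectic_form_fV by simp
  moreover have "group_ring_module K G V \<rho>V \<and> acts_faithfully G V \<rho>V"
    unfolding defs using group_ring_module_V acts_faithfully_V by simp
  ultimately show ?thesis by blast
qed

end
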